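(* Let $q$ be an odd prime power, $m\ge1$, and let $G=\operatorname{O}^{\epsilon}(m,q)$ be the isometry group of a nondegenerate quadratic form on $V=\mathbb{F}_q^m$ with associated nondegenerate symmetric bilinear form $B$. Let $C$ be a conjugacy class of $G$ with representative $g$, and let $o(C)$ be the number of orbits of $C_G(g)$ on $V/[g,V]$, where $[g,V]=(I-g)V$. Let $V_1=\ker(g-I)^{m}$ (on which $B$ is nondegenerate and $g$ is unipotent) and let $a_i$ be the number of Jordan blocks of size $i$ of $g$ on $V_1$. Write $V_1$ as a $B$-orthogonal direct sum of $g$-invariant subspaces $W_i$ such that $g|_{W_i}$ has exactly $a_i$ Jordan blocks, all of size $i$. For odd $i$, the form $(x,y)\mapsto B(x,(g-I)^{i-1}y)$ induces a nondegenerate symmetric bilinear form on $W_i/(g-I)W_i$; when $a_i=2$, say the sign attached to $i$ is $+$ if this $2$-dimensional form is isotropic (hyperbolic) and $-$ otherwise. Then \[ o(C)=1+\#\{i\text{ even}: a_i\ne0\}+\sum_{i\text{ odd},\,a_i\ne0} f_i, \] where $f_i=q$ if $a_i>2$; $f_i=q$ if $a_i=2$ and the sign is $+$; $f_i=q-1$ if $a_i=2$ and the sign is $-$; and $f_i=(q-1)/2$ if $a_i=1$.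
   Context: $o(C)$ depends only on the class $C$. The signs are those of the standard parametrization of unipotent classes of orthogonal groups in odd characteristic by signed partitions (a sign for each odd part size); the isometry type of the form described does not depend on the chosen decomposition. *)

theory Defs
  imports "HOL-Analysis.Analysis" "HOL-Algebra.Group_Action"
begin

definition polar_form :: "('a::field ^ 'n \<Rightarrow> 'a) \<Rightarrow> 'a ^ 'n \<Rightarrow> 'a ^ 'n \<Rightarrow> 'a" where
  "polar_form Q x y = Q (x + y) - Q x - Q y"

definition bilinear_form :: "('a::field ^ 'n \<Rightarrow> 'a ^ 'n \<Rightarrow> 'a) \<Rightarrow> bool" where
  "bilinear_form B \<longleftrightarrow>
     (\<forall>y. Vector_Spaces.linear (*s) (*) (\<lambda>x. B x y)) \<and>
     (\<forall>x. Vector_Spaces.linear (*s) (*) (B x))"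

definition quadratic_form :: "('a::field ^ 'n \<Rightarrow> 'a) \<Rightarrow> bool" where
  "quadratic_form Q \<longleftrightarrow>
     (\<forall>c x. Q (c *s x) = c\<^sup>2 * Q x) \<and> bilinear_form (polar_form Q)"

text \<open>The polar form is always symmetric, so one radical suffices.\<close>

definition nondegenerate :: "('a::field ^ 'n \<Rightarrow> 'a ^ 'n \<Rightarrow> 'a) \<Rightarrow> bool" where
  "nondegenerate B \<longleftrightarrow> (\<forall>x. (\<forall>y. B x y = 0) \<longrightarrow> x = 0)"

text \<open>The group \<open>O(Q)\<close>; as \<open>Q\<close> runs over all nondegenerate quadratic forms it covers every type
  \<open>\<epsilon>\<close> of \<open>O\<^sup>\<epsilon>(m, q)\<close>.\<close>

definition isometry_group :: "('a::field ^ 'n \<Rightarrow> 'a) \<Rightarrow> ('a ^ 'n ^ 'n) monoid" where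
  "isometry_group Q =
     \<lparr>carrier = {g. invertible g \<and> (\<forall>x. Q (g *v x) = Q x)}, mult = (**), one = mat 1\<rparr>"

definition conjugacy_classes :: "('g, 'r) monoid_scheme \<Rightarrow> 'g set set" where
  "conjugacy_classes G =
     orbits G (carrier G)
       (\<lambda>h. \<lambda>x \<in> carrier G. h \<otimes>\<^bsub>G\<^esub> x \<otimes>\<^bsub>G\<^esub> inv\<^bsub>G\<^esub> h)"

definition centralizer :: "('g, 'r) monoid_scheme \<Rightarrow> 'g \<Rightarrow> 'g set" where
  "centralizer G g = {h \<in> carrier G. h \<otimes>\<^bsub>G\<^esub> g = g \<otimes>\<^bsub>G\<^esub> h}"

definition add_coset :: "'v::ab_group_add set \<Rightarrow> 'v \<Rightarrow> 'v set" where
  "add_coset U x = (\<lambda>u. x + u) ` U"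

definition quotient_space :: "'v::ab_group_add set \<Rightarrow> 'v set \<Rightarrow> 'v set set" where
  "quotient_space W U = add_coset U ` W"

text \<open>The subspace \<open>[g, V]\<close>.\<close>

definition commutator_space :: "'a::field ^ 'n ^ 'n \<Rightarrow> ('a ^ 'n) set" where
  "commutator_space g = range ((*v) (mat 1 - g))"

text \<open>An element \<open>h\<close> of the centralizer sends the coset \<open>v + [g, V]\<close> to
  \<open>h v + [g, V]\<close>, which is its image as a set.\<close>

definition centralizer_orbits ::
    "('a::field ^ 'n ^ 'n) monoid \<Rightarrow> 'a ^ 'n ^ 'n \<Rightarrow> ('a ^ 'n) set set set" where
  "centralizer_orbits G g =
     orbits (G\<lparr>carrier := centralizer G g\<rparr>)
       (quotient_space UNIV (commutator_space g))
       (\<lambda>h. \<lambda>X \<in> quotient_space UNIV (commutator_space g). (*v) h ` X)"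

text \<open>The number \<open>o(C)\<close>; by \<open>class_orbit_number_eq\<close> below it can be computed from any
  representative.\<close>

definition class_orbit_number ::
    "('a::field ^ 'n ^ 'n) monoid \<Rightarrow> ('a ^ 'n ^ 'n) set \<Rightarrow> nat" where
  "class_orbit_number G C = (THE k. \<exists>g \<in> C. k = card (centralizer_orbits G g))"

abbreviation nil_part :: "'a::field ^ 'n ^ 'n \<Rightarrow> 'a ^ 'n \<Rightarrow> 'a ^ 'n" where
  "nil_part g \<equiv> (*v) (g - mat 1)"

definition unipotent_space :: "'a::field ^ 'n ^ 'n \<Rightarrow> ('a ^ 'n) set" where
  "unipotent_space g = {x. (nil_part g ^^ CARD('n)) x = 0}"

text \<open>\<open>L\<close> lists the generators \<open>v\<close> and lengths \<open>k\<close> of strings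
  \<open>v, (g - I) v, \<dots>, (g - I)\<^sup>k\<^sup>-\<^sup>1 v\<close> with \<open>(g - I)\<^sup>k v = 0\<close> which
  together form a basis of \<open>W\<close>: a basis in which the restriction of \<open>g\<close> to \<open>W\<close> is in Jordan
  normal form with eigenvalue 1, with one block of size \<open>k\<close> for each entry \<open>(v, k)\<close>.\<close>

definition jordan_basis ::
    "'a::field ^ 'n ^ 'n \<Rightarrow> ('a ^ 'n) set \<Rightarrow> (('a ^ 'n) \<times> nat) list \<Rightarrow> bool" where
  "jordan_basis g W L \<longleftrightarrow>
     (\<forall>(v, k) \<in> set L. 0 < k \<and> (nil_part g ^^ k) v = 0) \<and>
     (let I = {(l, j). l < length L \<and> j < snd (L ! l)};
          b = (\<lambda>(l, j). (nil_part g ^^ j) (fst (L ! l)))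
      in inj_on b I \<and> vec.independent (b ` I) \<and> vec.span (b ` I) = W)"

definition unipotent_jordan_type ::
    "'a::field ^ 'n ^ 'n \<Rightarrow> ('a ^ 'n) set \<Rightarrow> nat list \<Rightarrow> bool" where
  "unipotent_jordan_type g W ks \<longleftrightarrow> (\<exists>L. jordan_basis g W L \<and> map snd L = ks)"

definition jordan_blocks :: "'a::field ^ 'n ^ 'n \<Rightarrow> ('a ^ 'n) set \<Rightarrow> nat \<Rightarrow> nat" where
  "jordan_blocks g W i =
     (THE c. \<exists>ks. unipotent_jordan_type g W ks \<and> c = count_list ks i)"

text \<open>Orthogonal decompositions \<open>V\<^sub>1 = \<Oplus>\<^sub>i W\<^sub>i\<close> of the unipotent space into \<open>g\<close>-invariant
  subspaces such that \<open>g\<close> has on \<open>W\<^sub>i\<close> exactly the \<open>a\<^sub>i\<close> blocks of size \<open>i\<close>. Block sizes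
  do not exceed the dimension, so \<open>i\<close> ranges over \<open>1, \<dots>, dim V\<close>.\<close>

definition block_decomposition ::
    "('a::field ^ 'n \<Rightarrow> 'a) \<Rightarrow> 'a ^ 'n ^ 'n \<Rightarrow> (nat \<Rightarrow> ('a ^ 'n) set) \<Rightarrow> bool" where
  "block_decomposition Q g W \<longleftrightarrow>
     (\<forall>i \<in> {1..CARD('n)}.
        vec.subspace (W i) \<and> (*v) g ` W i \<subseteq> W i \<and>
        unipotent_jordan_type g (W i)
          (replicate (jordan_blocks g (unipotent_space g) i) i)) \<and>
     (\<forall>i \<in> {1..CARD('n)}. \<forall>j \<in> {1..CARD('n)}. i \<noteq> j \<longrightarrow>
        (\<forall>x \<in> W i. \<forall>y \<in> W j. polar_form Q x y = 0)) \<and>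
     {\<Sum>i=1..CARD('n). w i | w. \<forall>i \<in> {1..CARD('n)}. w i \<in> W i} = unipotent_space g \<and>
     (\<forall>w. (\<forall>i \<in> {1..CARD('n)}. w i \<in> W i) \<and> (\<Sum>i=1..CARD('n). w i) = 0 \<longrightarrow>
        (\<forall>i \<in> {1..CARD('n)}. w i = 0))"

text \<open>The form induced by \<open>(x, y) \<mapsto> B(x, (g - I)\<^sup>i\<^sup>-\<^sup>1 y)\<close> on the quotient of \<open>W\<^sub>i\<close> by
  \<open>(g - I) W\<^sub>i\<close>, evaluated on cosets; see \<open>top_form_coset\<close> for well-definedness.\<close>

definition top_form ::
    "('a::field ^ 'n \<Rightarrow> 'a) \<Rightarrow> 'a ^ 'n ^ 'n \<Rightarrow> nat \<Rightarrow>
      ('a ^ 'n) set \<Rightarrow> ('a ^ 'n) set \<Rightarrow> 'a" where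
  "top_form Q g i X Y =
     (THE c. \<exists>x \<in> X. \<exists>y \<in> Y. c = polar_form Q x ((nil_part g ^^ (i - 1)) y))"

text \<open>The sign attached to \<open>i\<close> is \<open>+\<close>: the form above represents 0 nontrivially. It is used
  only when the quotient has dimension 2.\<close>

definition sign_plus ::
    "('a::field ^ 'n \<Rightarrow> 'a) \<Rightarrow> 'a ^ 'n ^ 'n \<Rightarrow> nat \<Rightarrow> ('a ^ 'n) set \<Rightarrow> bool" where
  "sign_plus Q g i W \<longleftrightarrow>
     (\<exists>X \<in> quotient_space W (nil_part g ` W). X \<noteq> nil_part g ` W \<and> top_form Q g i X X = 0)"


lemma polar_isometry:
  assumes "\<forall>x. Q (g *v x) = Q x"
  shows "polar_form Q (g *v x) (g *v y) = polar_form Q x y"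
  using assms by (simp add: polar_form_def flip: matrix_vector_right_distrib)

lemma group_isometry_group: "group (isometry_group Q)"
proof (rule groupI)
  fix x assume x: "x \<in> carrier (isometry_group Q)"
  then obtain y where y: "x ** y = mat 1" "y ** x = mat 1"
    by (auto simp: isometry_group_def invertible_def)
  have "Q (y *v v) = Q v" for v
  proof -
    have "Q (x *v (y *v v)) = Q (y *v v)"
      using x by (simp add: isometry_group_def)
    then show ?thesis by (simp add: matrix_vector_mul_assoc y)
  qed
  then show "\<exists>y \<in> carrier (isometry_group Q). y \<otimes>\<^bsub>isometry_group Q\<^esub> x = \<one>\<^bsub>isometry_group Q\<^esub>"
    using y by (auto simp: isometry_group_def invertible_def intro!: bexI[of _ y])
next
  show "\<one>\<^bsub>isometry_group Q\<^esub> \<in> carrier (isometry_group Q)"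
    unfolding isometry_group_def by (auto simp: invertible_def intro!: exI[of _ "mat 1"])
qed (auto simp: isometry_group_def matrix_mul_assoc invertible_mult
       simp flip: matrix_vector_mul_assoc)

lemma centralizer_orbits_eq:
  "centralizer_orbits G g =
    {{(*v) h ` X | h. h \<in> centralizer G g} | X. X \<in> quotient_space UNIV (commutator_space g)}"
  unfolding centralizer_orbits_def orbits_def orbit_def by (auto simp: setcompr_eq_image)

lemma image_quotient_space:
  fixes k k' g g' :: "'a::field ^ 'n ^ 'n"
  assumes kk: "k ** k' = mat 1" "k' ** k = mat 1" and gg: "k ** g = g' ** k"
    and X: "X \<in> quotient_space UNIV (commutator_space g)"
  shows "(*v) k ` X \<in> quotient_space UNIV (commutator_space g')"
proof -
  obtain v where v: "X = add_coset (commutator_space g) v"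
    using X by (auto simp: quotient_space_def)
  have 1: "k *v ((mat 1 - g) *v x) = (mat 1 - g') *v (k *v x)" for x
    unfolding matrix_vector_mult_diff_rdistrib matrix_vector_mult_diff_distrib
    by (simp add: matrix_vector_mul_assoc gg)
  have "(*v) k ` commutator_space g = commutator_space g'"
  proof
    show "(*v) k ` commutator_space g \<subseteq> commutator_space g'"
      using 1 by (auto simp: commutator_space_def)
    show "commutator_space g' \<subseteq> (*v) k ` commutator_space g"
    proof
      fix y assume "y \<in> commutator_space g'"
      then obtain x where "y = (mat 1 - g') *v x" by (auto simp: commutator_space_def)
      then have "y = k *v ((mat 1 - g) *v (k' *v x))"
        by (simp only: 1) (simp add: matrix_vector_mul_assoc kk)
      then show "y \<in> (*v) k ` commutator_space g" by (auto simp: commutator_space_def)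
    qed
  qed
  moreover have "(*v) k ` X = (\<lambda>u. k *v v + u) ` ((*v) k ` commutator_space g)"
    by (simp add: v add_coset_def image_image matrix_vector_right_distrib)
  ultimately have "(*v) k ` X = add_coset (commutator_space g') (k *v v)"
    by (simp add: add_coset_def)
  then show ?thesis by (auto simp: quotient_space_def)
qed

lemma image_centralizer_orbits:
  fixes k k' g g' :: "'a::field ^ 'n ^ 'n"
  assumes k: "k \<in> carrier (isometry_group Q)" and k': "k' \<in> carrier (isometry_group Q)"
    and kk: "k ** k' = mat 1" "k' ** k = mat 1" and gg: "k ** g = g' ** k"
  shows "(`) ((`) ((*v) k)) ` centralizer_orbits (isometry_group Q) g
    \<subseteq> centralizer_orbits (isometry_group Q) g'"
proof -
  interpret G: group "isometry_group Q" by (rule group_isometry_group)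
  have mult: "x \<otimes>\<^bsub>isometry_group Q\<^esub> y = x ** y" for x y
    by (simp add: isometry_group_def)
  have gg': "k' ** g' = g ** k'"
    by (metis gg kk matrix_mul_assoc matrix_mul_lid matrix_mul_rid)
  have conj: "c ** h ** d \<in> centralizer (isometry_group Q) b"
    if "h \<in> centralizer (isometry_group Q) a" "c ** a = b ** c" "d ** b = a ** d"
      "c \<in> carrier (isometry_group Q)" "d \<in> carrier (isometry_group Q)" for a b c d h
  proof -
    have h: "h \<in> carrier (isometry_group Q)" "h ** a = a ** h"
      using that by (auto simp: centralizer_def mult)
    have "c ** h ** d ** b = c ** h ** a ** d"
      using that by (simp flip: matrix_mul_assoc)
    also have "\<dots> = c ** a ** h ** d" using h by (simp flip: matrix_mul_assoc)
    also have "\<dots> = b ** (c ** h ** d)" using that by (simp add: matrix_mul_assoc)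
    finally show ?thesis
      using G.m_closed[OF G.m_closed[OF that(4) h(1)] that(5)]
      by (simp add: centralizer_def mult)
  qed
  show ?thesis
  proof
    fix S assume "S \<in> (`) ((`) ((*v) k)) ` centralizer_orbits (isometry_group Q) g"
    then obtain X where X: "X \<in> quotient_space UNIV (commutator_space g)"
      and S: "S = (`) ((*v) k) ` {(*v) h ` X | h. h \<in> centralizer (isometry_group Q) g}"
      by (auto simp: centralizer_orbits_eq)
    have "S = {(*v) h ` ((*v) k ` X) | h. h \<in> centralizer (isometry_group Q) g'}" (is "_ = ?R")
    proof
      show "S \<subseteq> ?R"
      proof
        fix Y assume "Y \<in> S"
        then obtain h where h: "h \<in> centralizer (isometry_group Q) g"
          and Y: "Y = (*v) k ` (*v) h ` X" by (auto simp: S)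
        have "k ** h ** k' ** k = k ** h"
          by (metis kk(2) matrix_mul_assoc matrix_mul_rid)
        then have "Y = (*v) (k ** h ** k') ` ((*v) k ` X)"
          by (simp add: Y image_image matrix_vector_mul_assoc)
        then show "Y \<in> ?R" using conj[OF h gg gg' k k'] by blast
      qed
      show "?R \<subseteq> S"
      proof
        fix Y assume "Y \<in> ?R"
        then obtain h where h: "h \<in> centralizer (isometry_group Q) g'"
          and Y: "Y = (*v) h ` ((*v) k ` X)" by auto
        have "k ** (k' ** h ** k) = h ** k"
          by (metis kk(1) matrix_mul_assoc matrix_mul_lid)
        then have "Y = (*v) k ` (*v) (k' ** h ** k) ` X"
          by (simp add: Y image_image matrix_vector_mul_assoc)
        then show "Y \<in> S" unfolding S using conj[OF h gg' gg k' k] by blast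
      qed
    qed
    then show "S \<in> centralizer_orbits (isometry_group Q) g'"
      using image_quotient_space[OF kk gg X] by (auto simp: centralizer_orbits_eq)
  qed
qed

lemma card_centralizer_orbits_conj:
  fixes k k' g g' :: "'a::field ^ 'n ^ 'n"
  assumes k: "k \<in> carrier (isometry_group Q)" and k': "k' \<in> carrier (isometry_group Q)"
    and kk: "k ** k' = mat 1" "k' ** k = mat 1" and gg: "k ** g = g' ** k"
  shows "card (centralizer_orbits (isometry_group Q) g) =
    card (centralizer_orbits (isometry_group Q) g')"
proof -
  have gg': "k' ** g' = g ** k'"
    by (metis gg kk matrix_mul_assoc matrix_mul_lid matrix_mul_rid)
  have inv: "(`) ((`) ((*v) c)) ((`) ((`) ((*v) d)) S) = S" if "c ** d = mat 1"
    for c d :: "'a ^ 'n ^ 'n" and S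
    by (simp add: image_image matrix_vector_mul_assoc that)
  have "bij_betw ((`) ((`) ((*v) k))) (centralizer_orbits (isometry_group Q) g)
      (centralizer_orbits (isometry_group Q) g')"
    using image_centralizer_orbits[OF k k' kk gg] image_centralizer_orbits[OF k' k kk(2,1) gg']
    by (intro bij_betw_byWitness[where f' = "(`) ((`) ((*v) k'))"] ballI inv kk)
  then show ?thesis by (rule bij_betw_same_card)
qed

lemma class_orbit_number_eq:
  assumes C: "C \<in> conjugacy_classes (isometry_group Q)" and g: "g \<in> C"
  shows "class_orbit_number (isometry_group Q) C =
    card (centralizer_orbits (isometry_group Q) g)"
proof -
  interpret G: group "isometry_group Q" by (rule group_isometry_group)
  have mult: "x \<otimes>\<^bsub>isometry_group Q\<^esub> y = x ** y" for x y
    by (simp add: isometry_group_def)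
  have one: "\<one>\<^bsub>isometry_group Q\<^esub> = mat 1"
    by (simp add: isometry_group_def)
  obtain r where r: "r \<in> carrier (isometry_group Q)"
    and C': "C = {k ** r ** inv\<^bsub>isometry_group Q\<^esub> k | k. k \<in> carrier (isometry_group Q)}"
  proof -
    obtain r where r: "r \<in> carrier (isometry_group Q)"
      and C': "C = {(\<lambda>x \<in> carrier (isometry_group Q). k \<otimes>\<^bsub>isometry_group Q\<^esub> x
        \<otimes>\<^bsub>isometry_group Q\<^esub> inv\<^bsub>isometry_group Q\<^esub> k) r | k. k \<in> carrier (isometry_group Q)}"
      using C unfolding conjugacy_classes_def orbits_def orbit_def by blast
    show thesis
      by (rule that[OF r]) (simp only: C' restrict_apply' [OF r] mult)
  qed
  have *: "card (centralizer_orbits (isometry_group Q) x) =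
      card (centralizer_orbits (isometry_group Q) r)" if xC: "x \<in> C" for x
  proof -
    obtain k where k: "k \<in> carrier (isometry_group Q)"
      and x: "x = k ** r ** inv\<^bsub>isometry_group Q\<^esub> k" using xC unfolding C' by blast
    have kk: "k ** inv\<^bsub>isometry_group Q\<^esub> k = mat 1" "inv\<^bsub>isometry_group Q\<^esub> k ** k = mat 1"
      using G.r_inv[OF k] G.l_inv[OF k] by (simp_all add: mult one)
    have "k ** r = x ** k"
      by (metis kk(2) matrix_mul_assoc matrix_mul_rid x)
    then show ?thesis
      using card_centralizer_orbits_conj[OF k G.inv_closed[OF k] kk] by metis
  qed
  show ?thesis
    unfolding class_orbit_number_def using * g by (intro the_equality) auto
qed

lemma unipotent_jordan_type_replicate_nilpotent:
  assumes W: "unipotent_jordan_type g W (replicate c i)" and x: "x \<in> W"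
  shows "(nil_part g ^^ i) x = 0"
proof -
  obtain L where L: "jordan_basis g W L" "map snd L = replicate c i"
    using W by (auto simp: unipotent_jordan_type_def)
  define I where "I = {(l, j). l < length L \<and> j < snd (L ! l)}"
  define b where "b = (\<lambda>(l, j). (nil_part g ^^ j) (fst (L ! l)))"
  have span: "W = vec.span (b ` I)"
    using L(1) unfolding jordan_basis_def Let_def I_def b_def by blast
  have add: "(nil_part g ^^ n) (x + y) = (nil_part g ^^ n) x + (nil_part g ^^ n) y" for n x y
    by (induction n) (simp_all add: matrix_vector_right_distrib)
  have scale: "(nil_part g ^^ n) (s *s y) = s *s (nil_part g ^^ n) y" for n s y
    by (induction n) (simp_all add: vector_scalar_commute)
  have zero: "(nil_part g ^^ n) 0 = 0" for n
    by (induction n) simp_all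
  have sub: "vec.subspace {x. (nil_part g ^^ i) x = 0}"
    unfolding vec.subspace_def by (simp add: add scale zero)
  have "b ` I \<subseteq> {x. (nil_part g ^^ i) x = 0}"
  proof clarsimp
    fix l j assume "(l, j) \<in> I"
    then have l: "l < length L" by (simp add: I_def)
    have "snd (L ! l) = i"
      using L(2) l by (metis length_map length_replicate nth_map nth_replicate)
    moreover have "(nil_part g ^^ snd (L ! l)) (fst (L ! l)) = 0"
      using L(1) nth_mem[OF l] unfolding jordan_basis_def by (auto split: prod.splits)
    ultimately have "(nil_part g ^^ i) (fst (L ! l)) = 0" by simp
    then have "(nil_part g ^^ (j + i)) (fst (L ! l)) = 0" by (simp add: funpow_add zero)
    then show "(nil_part g ^^ i) (b (l, j)) = 0"
      by (simp add: b_def add.commute[of j i] funpow_add)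
  qed
  then have "W \<subseteq> {x. (nil_part g ^^ i) x = 0}"
    unfolding span by (rule vec.span_minimal[OF _ sub])
  then show ?thesis using x by blast
qed

lemma top_form_coset:
  fixes Q :: "'a::field ^ 'n \<Rightarrow> 'a"
  assumes Q: "quadratic_form Q" and g: "g \<in> carrier (isometry_group Q)"
    and W: "block_decomposition Q g W" and i: "i \<in> {1..CARD('n)}"
    and x: "x \<in> W i" and y: "y \<in> W i"
  shows "top_form Q g i (add_coset (nil_part g ` W i) x) (add_coset (nil_part g ` W i) y) =
    polar_form Q x ((nil_part g ^^ (i - 1)) y)"
proof -
  have Wi: "vec.subspace (W i) \<and> (*v) g ` W i \<subseteq> W i \<and>
      unipotent_jordan_type g (W i) (replicate (jordan_blocks g (unipotent_space g) i) i)"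
    by (rule bspec[OF conjunct1[OF W[unfolded block_decomposition_def]] i])
  have nil: "(nil_part g ^^ i) u = 0" if "u \<in> W i" for u
    by (rule unipotent_jordan_type_replicate_nilpotent[OF _ that]) (use Wi in blast)
  have sub: "vec.subspace (W i)" using Wi by blast
  have add: "(nil_part g ^^ n) (x + y) = (nil_part g ^^ n) x + (nil_part g ^^ n) y" for n x y
    by (induction n) (simp_all add: matrix_vector_right_distrib)
  have Suc: "Suc (i - 1) = i" using i by simp
  have pow: "(nil_part g ^^ (i - 1)) (nil_part g u) = (nil_part g ^^ i) u" for u
    using Suc by (metis comp_apply funpow_Suc_right)
  have pow': "nil_part g ((nil_part g ^^ (i - 1)) u) = (nil_part g ^^ i) u" for u
    using Suc by (metis comp_apply funpow.simps(2))
  have lin: "Vector_Spaces.linear (*s) (*) (\<lambda>x. polar_form Q x z)" for z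
    using Q by (simp add: quadratic_form_def bilinear_form_def)
  note hom = lin[unfolded linear_iff_module_hom]
  have eq: "polar_form Q (x + nil_part g u) ((nil_part g ^^ (i - 1)) (y + nil_part g v)) =
      polar_form Q x ((nil_part g ^^ (i - 1)) y)" if "u \<in> W i" "v \<in> W i" for u v
  proof -
    define z where "z = (nil_part g ^^ (i - 1)) y"
    have "(nil_part g ^^ (i - 1)) (y + nil_part g v) = z"
      by (simp only: add pow nil that z_def add_0_right)
    moreover have "polar_form Q (nil_part g u) z = 0"
    proof -
      have "nil_part g z = 0" by (simp only: z_def pow' nil y)
      then have "g *v z = z" by (simp add: matrix_vector_mult_diff_rdistrib)
      moreover have "polar_form Q (g *v u) (g *v z) = polar_form Q u z"
        using g by (intro polar_isometry) (simp add: isometry_group_def)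
      ultimately show ?thesis
        by (simp add: matrix_vector_mult_diff_rdistrib module_hom.diff[OF hom])
    qed
    ultimately show ?thesis
      by (simp only: z_def module_hom.add[OF hom] add_0_right)
  qed
  have "0 \<in> W i" using sub by (rule vec.subspace_0)
  then have "x \<in> add_coset (nil_part g ` W i) x" "y \<in> add_coset (nil_part g ` W i) y"
    by (force simp: add_coset_def image_iff)+
  moreover have "polar_form Q x' ((nil_part g ^^ (i - 1)) y') =
      polar_form Q x ((nil_part g ^^ (i - 1)) y)"
    if "x' \<in> add_coset (nil_part g ` W i) x" "y' \<in> add_coset (nil_part g ` W i) y" for x' y'
  proof -
    obtain u v where "u \<in> W i" "v \<in> W i" "x' = x + nil_part g u" "y' = y + nil_part g v"
      using \<open>x' \<in> _\<close> \<open>y' \<in> _\<close> unfolding add_coset_def by blast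
    then show ?thesis using eq by blast
  qed
  ultimately show ?thesis
    unfolding top_form_def by (intro the_equality) blast+
qed

end

theory Submission
  imports Defs "HOL-Number_Theory.Residues"
begin

text \<open>Write \<open>N = g - 1\<close>. A coset of \<open>N V\<close> other than \<open>N V\<close> itself meets \<open>ker N\<^sup>i\<close> for a least
  \<open>i > 0\<close>, and \<open>c = B x (N\<^sup>i\<^sup>-\<^sup>1 x)\<close> does not depend on the choice of \<open>x\<close> in the intersection.
  The pair \<open>(i, c)\<close> is a complete invariant of the orbit of the coset under the centralizer of \<open>g\<close>:
  given \<open>x\<close> and \<open>y\<close> with the same pair, change \<open>y\<close> modulo \<open>N (ker N\<^sup>i)\<close>, by solving for one
  coefficient at a time, until \<open>B x (N\<^sup>j x) = B y (N\<^sup>j y)\<close> for all \<open>j\<close>; then, as in Witt's theorem,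
  a generalized reflection commuting with \<open>g\<close>, or a product of two of them, takes \<open>x\<close> to \<open>y\<close> or
  to \<open>- y\<close>.
  Only the component of \<open>x\<close> in \<open>W\<^sub>i\<close> contributes to \<open>c\<close>, so the values \<open>c\<close> that occur are those of
  the nondegenerate form \<open>B w (N\<^sup>i\<^sup>-\<^sup>1 w)\<close> of dimension \<open>a\<^sub>i\<close> at nonzero vectors. This form is
  alternating for even \<open>i\<close> and symmetric for odd \<open>i\<close>.\<close>

section \<open>Powers of the nilpotent part and the bilinear form\<close>

text \<open>\<open>N\<close> is not skew-adjoint: its adjoint is
  \<open>g^-1 - 1 = -N (1 + N)^-1\<close>, so moving \<open>N\<close> across the form costs terms
  with higher powers of \<open>N\<close>. Hence identities between the numbers
  \<open>B (N^a x) (N^b x)\<close> are proved, and their values prescribed, from the highest total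
  power downwards, where nilpotency kills the corrections. The whole family of these numbers matters
  because the reflection has to carry the cyclic subspace of \<open>x\<close> isometrically to that
  of \<open>y\<close>. What makes the reflection exist is an invertible pairing between the strings
  of \<open>x - y\<close> and of \<open>x\<close>, that is,
  \<open>B (x - y) (N^(i-1) x) \<noteq> 0\<close>; this condition forces the detours through
  \<open>- y\<close> and through a third, isotropic vector. Since the sign of an odd size is defined
  through an orthogonal splitting into homogeneous pieces, the existence of such a splitting is
  proved as well, by splitting off strings of maximal length.\<close>

definition nilpow :: "'a::field ^ 'n ^ 'n \<Rightarrow> nat \<Rightarrow> 'a ^ 'n \<Rightarrow> 'a ^ 'n" where
  "nilpow g k x = (nil_part g ^^ k) x"

lemma nilpow_0 [simp]: "nilpow g 0 x = x"
  by (simp add: nilpow_def)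

lemma nilpow_add: "nilpow g k (x + y) = nilpow g k x + nilpow g k y"
  unfolding nilpow_def by (induction k) (simp_all add: matrix_vector_right_distrib)

lemma nilpow_scale: "nilpow g k (s *s x) = s *s nilpow g k x"
  unfolding nilpow_def by (induction k) (simp_all add: vector_scalar_commute)

lemma nilpow_zero [simp]: "nilpow g k 0 = 0"
  unfolding nilpow_def by (induction k) simp_all

lemma nilpow_minus: "nilpow g k (- x) = - nilpow g k x"
  by (metis nilpow_add nilpow_zero add.right_inverse eq_neg_iff_add_eq_0 add.commute)

lemma nilpow_diff: "nilpow g k (x - y) = nilpow g k x - nilpow g k y"
  by (metis nilpow_add nilpow_minus diff_conv_add_uminus)

lemma nilpow_sum: "nilpow g k (sum f A) = (\<Sum>a\<in>A. nilpow g k (f a))"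
  by (induction A rule: infinite_finite_induct) (simp_all add: nilpow_add)

lemma nilpow_nilpow [simp]: "nilpow g k (nilpow g l x) = nilpow g (k + l) x"
  by (simp add: nilpow_def funpow_add)

lemma nil_part_eq_nilpow: "nil_part g x = nilpow g (Suc 0) x"
  by (simp add: nilpow_def)

lemma nilpow_1: "nilpow g (Suc 0) x = g *v x - x"
  by (simp add: nilpow_def matrix_vector_mult_diff_rdistrib)

lemma mult_eq_nilpow: "g *v x = x + nilpow g (Suc 0) x"
  by (simp add: nilpow_1)

lemma nilpow_commute:
  assumes "h ** g = g ** h"
  shows "nilpow g k (h *v x) = h *v nilpow g k x"
proof (induction k)
  case (Suc k)
  have "nilpow g (Suc k) y = nilpow g (Suc 0) (nilpow g k y)" for y by simp
  then show ?case
    using assms by (simp add: Suc nilpow_1 matrix_vector_mult_diff_distrib matrix_vector_mul_assoc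
        del: nilpow_nilpow)
qed simp

lemma nilpow_eq_0_mono: "nilpow g i x = 0 \<Longrightarrow> i \<le> k \<Longrightarrow> nilpow g k x = 0"
  by (metis le_add_diff_inverse2 nilpow_nilpow nilpow_zero)

lemma linear_vecI:
  assumes "\<And>x y. f (x + y) = f x + f y" "\<And>s x. f (s *s x) = s *s f x"
  shows "Vector_Spaces.linear (*s) (*s) (f :: 'a::field ^ 'm \<Rightarrow> 'a ^ 'n)"
  unfolding Vector_Spaces.linear_iff
  using assms by (simp add: vec.vector_space_axioms)

lemma linear_nilpow: "Vector_Spaces.linear (*s) (*s) (nilpow g k)"
  by (rule linear_vecI) (simp_all add: nilpow_add nilpow_scale)

lemma subspace_ker_nilpow: "vec.subspace {x. nilpow g k x = 0}"
  by (simp add: vec.subspace_def nilpow_add nilpow_scale)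

lemma subspace_range_nilpow: "vec.subspace (range (nilpow g k))"
  by (metis linear_nilpow vec.linear_subspace_image vec.subspace_UNIV)

text \<open>The recursion is the one satisfied by \<open>D a b = B (N\<^sup>a u) (N\<^sup>b v)\<close> for
  \<open>N = g - 1\<close> and \<open>g\<close> an isometry of \<open>B\<close>.\<close>

lemma pairing_recursion:
  fixes D :: "nat \<Rightarrow> nat \<Rightarrow> 'a::comm_ring_1"
  assumes rec: "\<And>a b. D (Suc a) b = - D a (Suc b) - D (Suc a) (Suc b)"
    and fin: "\<And>a b. b \<ge> n \<Longrightarrow> D a b = 0"
    and top: "\<And>j. j \<ge> J \<Longrightarrow> D 0 j = 0"
  shows pairing_recursion_vanish: "a + b \<ge> J \<Longrightarrow> D a b = 0"
    and pairing_recursion_sign: "a + b + 1 \<ge> J \<Longrightarrow> D a b = (- 1) ^ a * D 0 (a + b)"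
proof -
  have *: "D a b = 0" if "a + b \<ge> J" for a b
    using that
  proof (induction a arbitrary: b)
    case 0
    then show ?case using top by simp
  next
    case (Suc a)
    \<comment> \<open>The recursion for \<open>D (Suc a) b\<close> refers to
      \<open>D (Suc a) (Suc b)\<close>, so an inner induction runs downwards in \<open>b\<close>,
      starting where \<open>b \<ge> n\<close> and \<open>fin\<close> applies.\<close>
    show ?case
      using Suc.prems
    proof (induction "n - b" arbitrary: b rule: less_induct)
      case less
      show ?case
      proof (cases "b \<ge> n")
        case False
        then have "D (Suc a) (Suc b) = 0" using less by (intro less.hyps) auto
        moreover have "D a (Suc b) = 0" using less by (intro Suc.IH) auto
        ultimately show ?thesis by (simp add: rec[of a b])
      qed (simp add: fin)
    qed
  qed
  then show "a + b \<ge> J \<Longrightarrow> D a b = 0" .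
  show "a + b + 1 \<ge> J \<Longrightarrow> D a b = (- 1) ^ a * D 0 (a + b)"
  proof (induction a arbitrary: b)
    case (Suc a)
    have "D (Suc a) (Suc b) = 0" using Suc.prems by (intro *) auto
    then have "D (Suc a) b = - D a (Suc b)" by (simp add: rec[of a b])
    also have "D a (Suc b) = (- 1) ^ a * D 0 (a + Suc b)"
      using Suc.prems by (intro Suc.IH) auto
    finally show ?case by simp
  qed simp
qed

section \<open>Moving powers of \<open>N\<close> across an invariant bilinear form\<close>

locale orthogonal_isometry =
  fixes B :: "'a::field ^ 'n \<Rightarrow> 'a ^ 'n \<Rightarrow> 'a" and g :: "'a ^ 'n ^ 'n"
  assumes add_left: "B (x + y) z = B x z + B y z"
    and scale_left: "B (s *s x) z = s * B x z"
    and sym: "B x y = B y x"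
    and nondeg: "(\<And>y. B x y = 0) \<Longrightarrow> x = 0"
    and isom: "B (g *v x) (g *v y) = B x y"
    and two: "(2::'a) \<noteq> 0"
begin

lemma add_right: "B z (x + y) = B z x + B z y"
  by (metis sym add_left)

lemma scale_right: "B z (s *s x) = s * B z x"
  by (metis sym scale_left)

lemma zero_left [simp]: "B 0 z = 0"
  by (metis add_left add_cancel_right_right)

lemma zero_right [simp]: "B z 0 = 0"
  by (metis sym zero_left)

lemma minus_left: "B (- x) z = - B x z"
  by (metis add_left add.right_inverse eq_neg_iff_add_eq_0 add.commute zero_left)

lemma minus_right: "B z (- x) = - B z x"
  by (metis sym minus_left)

lemma diff_left: "B (x - y) z = B x z - B y z"
  by (metis add_left minus_left diff_conv_add_uminus)

lemma diff_right: "B z (x - y) = B z x - B z y"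
  by (metis sym diff_left)

lemma sum_left: "B (sum f A) z = (\<Sum>a\<in>A. B (f a) z)"
  by (induction A rule: infinite_finite_induct) (simp_all add: add_left)

lemma sum_right: "B z (sum f A) = (\<Sum>a\<in>A. B z (f a))"
  by (induction A rule: infinite_finite_induct) (simp_all add: add_right)

lemmas bilin = add_left add_right diff_left diff_right scale_left scale_right
  minus_left minus_right

abbreviation N :: "nat \<Rightarrow> 'a ^ 'n \<Rightarrow> 'a ^ 'n" where
  "N \<equiv> nilpow g"

lemmas Nlin = nilpow_add nilpow_diff nilpow_scale nilpow_minus

text \<open>Expanding invariance under \<open>g = 1 + N\<close> gives
  \<open>B (N u) v + B u (N v) + B (N u) (N v) = 0\<close>.\<close>

lemma adjoint_step: "B (N (Suc a) u) v = - B (N a u) (N (Suc 0) v) - B (N (Suc a) u) (N (Suc 0) v)"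
proof -
  have "N (Suc a) u = g *v N a u - N a u"
    using nilpow_1[of g "N a u"] by simp
  then show ?thesis
    using isom[of "N a u" v] by (simp add: nilpow_1 bilin)
qed

lemma pairing_step:
  "B (N (Suc a) u) (N b v) = - B (N a u) (N (Suc b) v) - B (N (Suc a) u) (N (Suc b) v)"
  using adjoint_step[of a u "N b v"] by simp

text \<open>Each transfer of \<open>N\<close> from left to right keeps or raises the total exponent,
  and \<open>N^i v = 0\<close> stops the process.\<close>

lemma N_pairing_vanish:
  assumes "N i v = 0" "\<And>j. j \<ge> J \<Longrightarrow> B u (N j v) = 0" "a + b \<ge> J"
  shows "B (N a u) (N b v) = 0"
proof -
  have "B (N a u) (N b v) = 0" if "i \<le> b" for a b
    using nilpow_eq_0_mono[OF assms(1) that] by simp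
  from pairing_recursion_vanish[of "\<lambda>a b. B (N a u) (N b v)" i J a b, OF pairing_step this]
  show ?thesis using assms by simp
qed

text \<open>One degree below the vanishing range the correction terms are already zero, so there
  \<open>N\<close> behaves as if it were skew-adjoint.\<close>

lemma N_pairing_sign:
  assumes "N i v = 0" "\<And>j. j \<ge> J \<Longrightarrow> B u (N j v) = 0" "a + b + 1 \<ge> J"
  shows "B (N a u) (N b v) = (- 1) ^ a * B u (N (a + b) v)"
proof -
  have "B (N a u) (N b v) = 0" if "i \<le> b" for a b
    using nilpow_eq_0_mono[OF assms(1) that] by simp
  from pairing_recursion_sign[of "\<lambda>a b. B (N a u) (N b v)" i J a b, OF pairing_step this]
  show ?thesis using assms by simp
qed

lemma N_pairing_0: "N i v = 0 \<Longrightarrow> a + b \<ge> i \<Longrightarrow> B (N a u) (N b v) = 0"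
  by (rule N_pairing_vanish[of i _ i]) (simp_all add: nilpow_eq_0_mono)

lemma N_pairing_0': "N i v = 0 \<Longrightarrow> a + b \<ge> i \<Longrightarrow> B (N a v) (N b u) = 0"
  using N_pairing_0[of i v b a u] by (simp add: sym add.commute)

lemma N_pairing_top: "N i v = 0 \<Longrightarrow> a + b + 1 \<ge> i \<Longrightarrow> B (N a u) (N b v) = (- 1) ^ a * B u (N (a + b) v)"
  by (rule N_pairing_sign[of i _ i]) (simp_all add: nilpow_eq_0_mono)

lemma top_pairing_sym:
  "N i v = 0 \<Longrightarrow> B v (N (i - 1) u) = (- 1) ^ (i - 1) * B u (N (i - 1) v)"
  using N_pairing_top[of i v "i - 1" 0 u] by (simp add: sym)

lemma inj_g: "g *v x = 0 \<Longrightarrow> x = 0"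
  by (rule nondeg) (metis isom zero_left)

lemma surj_g: "surj ((*v) g)"
  by (rule vec.linear_injective_imp_surjective)
    (auto simp: vec.inj_iff_eq_0 inj_g)

lemma N_g: "N k (g *v x) = g *v N k x"
  by (rule nilpow_commute) simp

lemma orth_range_N:
  assumes "\<And>u. B (N i u) z = 0"
  shows "N i z = 0"
proof (rule nondeg)
  have *: "B (N a u) (N b z) = 0" if "a + b = i" for a b u
    using that
  proof (induction b arbitrary: a u)
    case 0
    then show ?case using assms by simp
  next
    case (Suc b)
    \<comment> \<open>Writing \<open>u = g w\<close> absorbs the correction term:
      \<open>B (N^(a+1) w) (N^b z) = - B (N^a (g w)) (N^(b+1) z)\<close> holds exactly.\<close>
    obtain w where w: "u = g *v w" using surj_g by (metis surjD)
    have "N (Suc a) w = g *v N a w - N a w"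
      using nilpow_1[of g "N a w"] by simp
    then have "B (N (Suc a) w) (N b z) = B (N a u) (N b z) - B (N a w) (N b z)"
      by (simp add: w N_g diff_left)
    moreover have "B (N a w) (N b z) = B (N a u) (g *v N b z)"
      by (simp add: w N_g isom)
    ultimately have "B (N (Suc a) w) (N b z) = - B (N a u) (N (Suc b) z)"
      by (simp add: mult_eq_nilpow add_right)
    then show ?case using Suc by simp
  qed
  show "B (N i z) y = 0" for y
    using *[of 0 i y] by (simp add: sym)
qed

section \<open>Duality and the Fitting decomposition\<close>

lemma functional_representable:
  assumes "Vector_Spaces.linear (*s) (*) f"
  shows "\<exists>w. \<forall>x. f x = B w x"
proof -
  \<comment> \<open>\<open>\<phi> w\<close> lists the values of \<open>B w\<close> on the standard
    basis. Nondegeneracy makes \<open>\<phi>\<close> injective, hence surjective in finite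
    dimension.\<close>
  define \<phi> where "\<phi> w = (\<chi> j. B w (axis j 1))" for w
  have ex: "f x = (\<Sum>j\<in>UNIV. x $ j * f (axis j 1))"
    if "Vector_Spaces.linear (*s) (*) f" for f x
  proof -
    interpret f: Vector_Spaces.linear "(*s)" "(*)" f by fact
    have "f x = f (\<Sum>j\<in>UNIV. x $ j *s axis j 1)" by (simp add: basis_expansion)
    then show ?thesis by (simp add: f.sum f.scale)
  qed
  have linB: "Vector_Spaces.linear (*s) (*) (B w)" for w
    using add_right scale_right
    by unfold_locales (auto simp: algebra_simps)
  have "Vector_Spaces.linear (*s) (*s) \<phi>"
    by (rule linear_vecI) (simp_all add: \<phi>_def vec_eq_iff add_left scale_left)
  note lin = this
  moreover have "w = 0" if "\<phi> w = 0" for w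
  proof (rule nondeg)
    fix x show "B w x = 0"
      using that ex[OF linB, of w x] by (simp add: \<phi>_def vec_eq_iff)
  qed
  ultimately have "surj \<phi>"
    by (intro vec.linear_injective_imp_surjective)
      (auto simp: vec.linear_inj_iff_eq_0[OF lin])
  then obtain w where "\<phi> w = (\<chi> j. f (axis j 1))" by (metis surjD)
  then have "B w (axis j 1) = f (axis j 1)" for j by (simp add: \<phi>_def vec_eq_iff)
  then have "f x = B w x" for x
    using ex[OF assms, of x] ex[OF linB, of w x] by simp
  then show ?thesis by blast
qed

text \<open>A vector outside \<open>U\<close> is separated from \<open>U\<close> by a functional,
  and every functional has the form \<open>B z\<close>.\<close>

lemma double_perp:
  assumes "vec.subspace U" and w: "\<And>z. (\<And>u. u \<in> U \<Longrightarrow> B z u = 0) \<Longrightarrow> B z w = 0"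
  shows "w \<in> U"
proof (rule ccontr)
  assume "w \<notin> U"
  obtain b where b: "b \<subseteq> U" "vec.independent b" "U = vec.span b"
    by (metis assms(1) vec.basis_exists vec.span_subspace)
  then have ind: "vec.independent (insert w b)"
    using \<open>w \<notin> U\<close> by (simp add: vec.independent_insert)
  have w': "w \<notin> b" using b \<open>w \<notin> U\<close> by blast
  \<comment> \<open>The extension of a map from a basis is taken with values in the space of
    vectors; its coordinate \<open>j\<close>, chosen arbitrarily, is the separating
    functional.\<close>
  obtain j :: 'n where True by simp
  obtain F where F: "Vector_Spaces.linear (*s) (*s) F"
    "\<And>x. x \<in> insert w b \<Longrightarrow> F x = (if x = w then axis j 1 else (0::'a^'n))"
    using vec.linear_independent_extend[OF ind, of "\<lambda>x. if x = w then axis j 1 else (0::'a^'n)"]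
    by blast
  interpret F: Vector_Spaces.linear "(*s)" "(*s)" F by fact
  have "Vector_Spaces.linear (*s) (*) (\<lambda>x. F x $ j)"
    by unfold_locales (auto simp: F.add F.scale algebra_simps)
  then obtain z where z: "\<And>x. F x $ j = B z x" using functional_representable by blast
  have "F u = 0" if "u \<in> U" for u
    using F.eq_0_on_span[of b u] F(2) b(3) that w' by fastforce
  then have "B z w = 0" using w[of z] z by (metis zero_index)
  then show False using F(2)[of w] z[of w] by simp
qed

text \<open>The orthogonal complement of the range of \<open>N^i\<close> lies in the kernel of
  \<open>N^i\<close>; taking complements once more gives this inclusion.\<close>

lemma orth_ker_N:
  assumes "\<And>z. N i z = 0 \<Longrightarrow> B z w = 0"
  shows "w \<in> range (N i)"
proof (rule double_perp[OF subspace_range_nilpow])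
  fix z assume "\<And>u. u \<in> range (N i) \<Longrightarrow> B z u = 0"
  then have "N i z = 0" by (intro orth_range_N) (metis sym rangeI)
  then show "B z w = 0" by (rule assms)
qed

text \<open>If the kernels still grew at exponent \<open>m = CARD('n)\<close>, they would have grown
  strictly at every earlier exponent, and \<open>ker N^(m+1)\<close> would have dimension above
  \<open>m\<close>.\<close>

lemma ker_N_stable: "N (CARD('n) + k) x = 0 \<Longrightarrow> N (CARD('n)) x = 0"
proof (induction k)
  case (Suc k)
  have "N (CARD('n)) (N k x) = 0"
  proof (rule ccontr)
    define y where "y = N k x"
    assume "N (CARD('n)) (N k x) \<noteq> 0"
    then have y: "N (CARD('n)) y \<noteq> 0" "N (Suc (CARD('n))) y = 0"
      using Suc.prems by (simp_all add: y_def add.commute)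
    have "k \<le> vec.dim {x. N k x = 0}" if "k \<le> Suc (CARD('n))" for k
      using that
    proof (induction k)
      case (Suc k)
      \<comment> \<open>This vector lies in \<open>ker N^(k+1)\<close> but not in
        \<open>ker N^k\<close>, since \<open>N^k z = N^m y\<close>.\<close>
      define z where "z = N (CARD('n) - k) y"
      have "N k z \<noteq> 0" "N (Suc k) z = 0"
        using y Suc.prems by (simp_all add: z_def)
      then have "{x. N k x = 0} \<subset> {x. N (Suc k) x = 0}"
        using nilpow_eq_0_mono[of g k _ "Suc k"] by fastforce
      then have "vec.dim {x. N k x = 0} < vec.dim {x. N (Suc k) x = 0}"
        by (intro vec.dim_psubset) (simp add: vec.span_eq_iff[THEN iffD2, OF subspace_ker_nilpow])
      then show ?case using Suc by simp
    qed simp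
    from this[of "Suc (CARD('n))"] show False
      using dim_subset_UNIV_cart_gen[of "{x. N (Suc (CARD('n))) x = 0}"] by simp
  qed
  then show ?case using Suc.IH by simp
qed simp

text \<open>A vector orthogonal to both the kernel and the range of \<open>N^m\<close> lies in both
  by duality, hence is zero by stability of kernels. So the two subspaces span everything.\<close>

lemma fitting_sum: "\<exists>u. N (CARD('n)) (x - N (CARD('n)) u) = 0"
proof -
  let ?m = "CARD('n)"
  let ?U = "{y + z | y z. y \<in> {x. N ?m x = 0} \<and> z \<in> range (N ?m)}"
  have sub: "vec.subspace ?U"
    using vec.subspace_sums[OF subspace_ker_nilpow subspace_range_nilpow] .
  have "x \<in> ?U"
  proof (rule double_perp[OF sub])
    fix z assume z: "\<And>u. u \<in> ?U \<Longrightarrow> B z u = 0"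
    have "B z (N ?m u) = 0" for u
    proof (rule z)
      show "N ?m u \<in> ?U" by simp (metis add_0 nilpow_zero rangeI)
    qed
    then have *: "N ?m z = 0" by (intro orth_range_N) (metis sym)
    have "B y z = 0" if "N ?m y = 0" for y
    proof -
      have "y \<in> ?U" using that by simp (metis add.right_neutral nilpow_zero rangeI)
      then show ?thesis using z[of y] sym[of y z] by presburger
    qed
    then obtain u where "z = N ?m u" using orth_ker_N[of ?m z] by auto
    then have "z = 0" using * ker_N_stable[of ?m u] by simp
    then show "B z x = 0" by simp
  qed
  then obtain y u where "x = y + N ?m u" "N ?m y = 0" by auto
  then show ?thesis by (intro exI[of _ u]) simp
qed

end

section \<open>Constructing isometries that commute with \<open>g\<close>\<close>

text \<open>The strings \<open>v l, N (v l), ...\<close> carry a doubly indexed array of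
  coefficients, so that \<open>N\<close> acts by shifting the second index. The same notation serves
  cyclic subspaces (\<open>r = 1\<close>) and Jordan bases.\<close>

definition string_comb ::
    "'a::field ^ 'n ^ 'n \<Rightarrow> nat \<Rightarrow> (nat \<Rightarrow> nat) \<Rightarrow> (nat \<Rightarrow> 'a ^ 'n) \<Rightarrow> (nat \<Rightarrow> nat \<Rightarrow> 'a) \<Rightarrow> 'a ^ 'n"
  where "string_comb g r K v c = (\<Sum>l<r. \<Sum>k<K l. c l k *s nilpow g k (v l))"

lemma string_comb_add:
  "string_comb g r K v (\<lambda>l k. c l k + d l k) = string_comb g r K v c + string_comb g r K v d"
  by (simp add: string_comb_def vector_sadd_rdistrib sum.distrib)

lemma string_comb_scale:
  "string_comb g r K v (\<lambda>l k. s * c l k) = s *s string_comb g r K v c"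
  by (simp add: string_comb_def vec.scale_sum_right)

lemma string_comb_diff:
  "string_comb g r K v (\<lambda>l k. c l k - d l k) = string_comb g r K v c - string_comb g r K v d"
  by (simp add: string_comb_def vector_sub_rdistrib sum_subtractf)

lemma string_comb_diff_vec:
  "string_comb g r K (\<lambda>l. v l - w l) c = string_comb g r K v c - string_comb g r K w c"
  by (simp add: string_comb_def nilpow_diff vec.scale_right_diff_distrib sum_subtractf)

lemma string_comb_0: "(\<And>l k. l < r \<Longrightarrow> k < K l \<Longrightarrow> c l k = 0) \<Longrightarrow> string_comb g r K v c = 0"
  by (simp add: string_comb_def)

lemma string_comb_cong:
  "(\<And>l k. l < r \<Longrightarrow> k < K l \<Longrightarrow> c l k = d l k) \<Longrightarrow> string_comb g r K v c = string_comb g r K v d"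
  by (simp add: string_comb_def)

lemma subspace_string_comb: "vec.subspace (range (string_comb g r K v))"
  unfolding vec.subspace_def
proof (intro conjI ballI allI)
  show "0 \<in> range (string_comb g r K v)"
    using string_comb_0[of r K "\<lambda>_ _. 0" g v] by (metis rangeI)
qed (auto simp flip: string_comb_add string_comb_scale)

lemma nilpow_string_comb:
  assumes "\<And>l. l < r \<Longrightarrow> nilpow g (K l) (v l) = 0"
  shows "nilpow g (Suc 0) (string_comb g r K v c) =
    string_comb g r K v (\<lambda>l k. if k = 0 then 0 else c l (k - 1))"
proof -
  have "(\<Sum>k<K l. c l k *s nilpow g (Suc k) (v l)) =
      (\<Sum>k<K l. (if k = 0 then 0 else c l (k - 1)) *s nilpow g k (v l))" if "l < r" for l
  proof (cases "K l")
    case (Suc n)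
    have "nilpow g (Suc n) (v l) = 0" using assms[OF that] Suc by simp
    then show ?thesis
      by (subst (2) Suc, subst sum.lessThan_Suc_shift) (simp add: Suc)
  qed simp
  then show ?thesis
    by (simp add: string_comb_def nilpow_sum nilpow_scale)
qed

lemma mult_string_comb:
  assumes "\<And>l. l < r \<Longrightarrow> nilpow g (K l) (v l) = 0"
  shows "g *v string_comb g r K v c =
    string_comb g r K v (\<lambda>l k. c l k + (if k = 0 then 0 else c l (k - 1)))"
  by (simp add: mult_eq_nilpow string_comb_add nilpow_string_comb[OF assms])

context orthogonal_isometry
begin

text \<open>The matrix of the top pairing is diagonal and invertible, so the pairing of all
  \<open>N^j (u l)\<close> with all \<open>N^k (x l)\<close> is anti-triangular and invertible. The
  two families are kept apart: the reflection pairs the string of \<open>x - y\<close> with that of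
  \<open>x\<close>, and an alternating top form pairs two different strings.\<close>

definition dual_strings :: "nat \<Rightarrow> nat \<Rightarrow> (nat \<Rightarrow> 'a ^ 'n) \<Rightarrow> (nat \<Rightarrow> 'a ^ 'n) \<Rightarrow> bool" where
  "dual_strings r i u x \<longleftrightarrow>
    (\<forall>l<r. N i (u l) = 0 \<and> N i (x l) = 0 \<and> B (u l) (N (i - 1) (x l)) \<noteq> 0 \<and>
      (\<forall>l'<r. l \<noteq> l' \<longrightarrow> B (u l) (N (i - 1) (x l')) = 0))"

text \<open>\<open>N^(i-1-k) (u l)\<close> annihilates the powers above \<open>k\<close>, and the
  coefficients below \<open>k\<close> are zero by assumption, which isolates
  \<open>c l k\<close>.\<close>

lemma dual_strings_pairing:
  assumes D: "dual_strings r i u x" and l: "l < r" and k: "k < i"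
    and c: "\<And>l k'. l < r \<Longrightarrow> k' < k \<Longrightarrow> c l k' = 0"
  shows "B (N (i - 1 - k) (u l)) (string_comb g r (\<lambda>_. i) x c) =
    c l k * (- 1) ^ (i - 1 - k) * B (u l) (N (i - 1) (x l))"
proof -
  have *: "B (N (i - 1 - k) (u l)) (N k' (x l')) =
      (if k' = k then (- 1) ^ (i - 1 - k) * B (u l) (N (i - 1) (x l')) else 0)"
    if "k \<le> k'" "k' < i" "l' < r" for k' l'
    using that N_pairing_0[of i "x l'" "i - 1 - k" k' "u l"] N_pairing_top[of i "x l'" "i - 1 - k" k "u l"] D k
    by (auto simp: dual_strings_def)
  have "B (N (i - 1 - k) (u l)) (string_comb g r (\<lambda>_. i) x c) =
      (\<Sum>l'<r. \<Sum>k'<i. c l' k' * B (N (i - 1 - k) (u l)) (N k' (x l')))"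
    by (simp add: string_comb_def sum_right scale_right)
  also have "\<dots> = (\<Sum>l'<r. \<Sum>k'<i. if k' = k then
      (if l' = l then c l k * (- 1) ^ (i - 1 - k) * B (u l) (N (i - 1) (x l)) else 0) else 0)"
  proof (intro sum.cong refl)
    fix l' k' assume "l' \<in> {..<r}" "k' \<in> {..<i}"
    then show "c l' k' * B (N (i - 1 - k) (u l)) (N k' (x l')) = (if k' = k then
      (if l' = l then c l k * (- 1) ^ (i - 1 - k) * B (u l) (N (i - 1) (x l)) else 0) else 0)"
      using *[of k' l'] c[of l' k'] D l
      by (cases "k' < k") (auto simp: dual_strings_def)
  qed
  also have "\<dots> = c l k * (- 1) ^ (i - 1 - k) * B (u l) (N (i - 1) (x l))"
    using l k by simp
  finally show ?thesis .
qed

lemma dual_strings_independent: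
  assumes D: "dual_strings r i u x"
    and orth: "\<And>j l. j < i \<Longrightarrow> l < r \<Longrightarrow> B (N j (u l)) (string_comb g r (\<lambda>_. i) x c) = 0"
    and "l < r" "k < i"
  shows "c l k = 0"
  using assms(3,4)
proof (induction k arbitrary: l rule: less_induct)
  case (less k)
  have "c l k * (- 1) ^ (i - 1 - k) * B (u l) (N (i - 1) (x l)) = 0"
    using dual_strings_pairing[OF D, of l k c] less orth[of "i - 1 - k" l] by simp
  then show ?case using D less by (auto simp: dual_strings_def)
qed

text \<open>Back substitution in the anti-triangular system: the induction on \<open>n\<close> meets
  the conditions for \<open>j \<ge> i - n\<close>, fixing one further coefficient of each string at
  every stage.\<close>

lemma dual_strings_decomp:
  assumes D: "dual_strings r i u x"
  shows "\<exists>c. \<forall>j<i. \<forall>l<r. B (N j (u l)) (z - string_comb g r (\<lambda>_. i) x c) = 0"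
proof -
  have "\<exists>c. \<forall>j<i. i \<le> j + n \<longrightarrow> (\<forall>l<r. B (N j (u l)) (z - string_comb g r (\<lambda>_. i) x c) = 0)"
    if "n \<le> i" for n
    using that
  proof (induction n)
    case (Suc n)
    then obtain c where c: "\<And>j l. j < i \<Longrightarrow> i \<le> j + n \<Longrightarrow> l < r \<Longrightarrow>
        B (N j (u l)) (z - string_comb g r (\<lambda>_. i) x c) = 0" by auto
    \<comment> \<open>The coefficient at \<open>N^n (x l)\<close> that solves the condition for
      \<open>j = i - 1 - n\<close>; it leaves those for larger \<open>j\<close> intact, because then
      \<open>j + n \<ge> i\<close>.\<close>
    define s where "s l = B (N (i - 1 - n) (u l)) (z - string_comb g r (\<lambda>_. i) x c) /
      ((- 1) ^ (i - 1 - n) * B (u l) (N (i - 1) (x l)))" for l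
    define d where "d = (\<lambda>l k. if k = n then s l else 0)"
    have "B (N j (u l)) (z - string_comb g r (\<lambda>_. i) x (\<lambda>l k. c l k + d l k)) = 0"
      if j: "j < i" "i \<le> j + Suc n" "l < r" for j l
    proof -
      have eq: "B (N j (u l)) (z - string_comb g r (\<lambda>_. i) x (\<lambda>l k. c l k + d l k)) =
        B (N j (u l)) (z - string_comb g r (\<lambda>_. i) x c) - B (N j (u l)) (string_comb g r (\<lambda>_. i) x d)"
        by (simp add: string_comb_add bilin)
      show ?thesis
      proof (cases "i \<le> j + n")
        case True
        have "B (N j (u l)) (string_comb g r (\<lambda>_. i) x d) =
          (\<Sum>l'<r. \<Sum>k'<i. d l' k' * B (N j (u l)) (N k' (x l')))"
          by (simp add: string_comb_def sum_right scale_right)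
        also have "\<dots> = 0"
          using True D N_pairing_0[of i _ j n]
          by (intro sum.neutral ballI) (auto simp: d_def dual_strings_def)
        finally show ?thesis using c[of j l] True j by (simp add: eq)
      next
        case False
        then have j': "j = i - 1 - n" using j by simp
        have "B (u l) (N (i - 1) (x l)) \<noteq> 0" using D j by (simp add: dual_strings_def)
        then show ?thesis
          unfolding eq unfolding j' using dual_strings_pairing[OF D j(3), of n d] Suc.prems
          by (simp add: d_def) (simp add: s_def)
      qed
    qed
    then show ?case by (intro exI[of _ "\<lambda>l k. c l k + d l k"]) auto
  qed auto
  from this[of i] show ?thesis by auto
qed

section \<open>The centralizer and the generalized reflection\<close>

definition commuting_isometries :: "('a ^ 'n ^ 'n) set" where
  "commuting_isometries = {h. (\<forall>x y. B (h *v x) (h *v y) = B x y) \<and> h ** g = g ** h}"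

lemma commuting_isometries_mult:
  "h \<in> commuting_isometries \<Longrightarrow> h' \<in> commuting_isometries \<Longrightarrow> h ** h' \<in> commuting_isometries"
  unfolding commuting_isometries_def
  by (auto simp flip: matrix_vector_mul_assoc) (metis matrix_mul_assoc)

lemma commuting_isometries_N:
  "h \<in> commuting_isometries \<Longrightarrow> N k (h *v x) = h *v N k x"
  by (rule nilpow_commute) (simp add: commuting_isometries_def)

lemma matrix_minus_mult: "(- h) *v x = - (h *v (x :: 'a ^ 'n))"
  by (metis (no_types) add_0 diff_0 matrix_vector_mult_0 matrix_vector_mult_diff_rdistrib)

lemma commuting_isometries_minus:
  "h \<in> commuting_isometries \<Longrightarrow> - h \<in> commuting_isometries"
proof -
  assume h: "h \<in> commuting_isometries"
  have "(- h) ** g = g ** (- h)"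
  proof -
    have "((- h) ** g) *v x = (g ** (- h)) *v x" for x
    proof -
      have "(h ** g) *v x = (g ** h) *v x" using h by (simp add: commuting_isometries_def)
      moreover have "g *v (- y) = - (g *v y)" for y
        by (metis diff_0 matrix_vector_mult_0_right matrix_vector_mult_diff_distrib)
      ultimately show ?thesis
        by (simp add: matrix_minus_mult flip: matrix_vector_mul_assoc)
    qed
    then show ?thesis by (simp add: matrix_eq)
  qed
  then show ?thesis using h by (simp add: commuting_isometries_def matrix_minus_mult bilin)
qed

lemma pairing_sum_cong:
  assumes "B e e' = B p p'" "B e' w = B p' w" "B e w' = B p w'"
  shows "B (w + e) (w' + e') = B (w + p) (w' + p')"
  by (simp add: add_left add_right sym[of w e'] sym[of w p'] assms)

text \<open>The isometry is the identity on the orthogonal complement of the \<open>g\<close>-cyclic subspace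
  generated by \<open>x - y\<close>, for which the cyclic subspace of \<open>x\<close> is a complement, and it maps
  \<open>N\<^sup>k x\<close> to \<open>N\<^sup>k y\<close>; it generalizes the reflection in the hyperplane orthogonal to
  \<open>x - y\<close>.\<close>

lemma cyclic_witt:
  assumes x: "N i x = 0" and y: "N i y = 0"
    and eq: "\<And>a b. B (N a x) (N b x) = B (N a y) (N b y)"
    and nz: "B (x - y) (N (i - 1) x) \<noteq> 0"
  shows "\<exists>h \<in> commuting_isometries. h *v x = y"
proof -
  define u where "u = x - y"
  define C where "C = (\<lambda>v c. string_comb g 1 (\<lambda>_. i) (\<lambda>_. v) c)"
  have u: "N i u = 0" by (simp add: u_def nilpow_diff x y)
  have D: "dual_strings 1 i (\<lambda>_. u) (\<lambda>_. x)"
    using nz x u by (simp add: dual_strings_def u_def)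
  have Cu: "C u c = C x c - C y c" for c
    unfolding C_def u_def by (rule string_comb_diff_vec)
  \<comment> \<open>\<open>c\<close> is the coefficient array of the projection of \<open>z\<close>
    to the cyclic subspace of \<open>x\<close>, taken along the orthogonal complement of the cyclic
    subspace of \<open>u\<close>.\<close>
  define good where "good z c \<longleftrightarrow> (\<forall>j<i. B (N j u) (z - C x c) = 0)" for z c
  have ex: "\<exists>c. good z c" for z
    using dual_strings_decomp[OF D, of z] by (simp add: good_def C_def)
  have uniq: "C v c = C v d" if "good z c" "good z d" for z c d v
    unfolding C_def
  proof (rule string_comb_cong)
    fix l k :: nat assume l: "l < 1" "k < i"
    have "C x (\<lambda>l k. c l k - d l k) = (z - C x d) - (z - C x c)"
      by (simp add: C_def string_comb_diff)
    then have "B (N j u) (C x (\<lambda>l k. c l k - d l k)) = 0" if "j < i" for j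
      using \<open>good z c\<close> \<open>good z d\<close> that by (simp add: good_def diff_right)
    then have "c l k - d l k = 0"
      using dual_strings_independent[OF D _ l, of "\<lambda>l k. c l k - d l k"] by (simp add: C_def)
    then show "c l k = d l k" by simp
  qed
  \<comment> \<open>In \<open>z = (z - C x c) + C x c\<close> the first summand is fixed and the
    second becomes \<open>C y c\<close>; the difference is \<open>C u c\<close>. By
    \<open>uniq\<close> the choice of \<open>c\<close> does not matter.\<close>
  define h where "h z = z - C u (SOME c. good z c)" for z
  have h: "h z = z - C u c" if "good z c" for z c
    unfolding h_def using uniq[OF that someI[of "good z", OF that], of u] by simp
  have good_add: "good (z + z') (\<lambda>l k. c l k + c' l k)" if "good z c" "good z' c'" for z z' c c'
    unfolding good_def
  proof (intro allI impI)
    fix j assume j: "j < i"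
    have *: "z + z' - C x (\<lambda>l k. c l k + c' l k) = (z - C x c) + (z' - C x c')"
      by (simp add: C_def string_comb_add)
    show "B (N j u) (z + z' - C x (\<lambda>l k. c l k + c' l k)) = 0"
      unfolding * using that j by (simp add: good_def add_right)
  qed
  have good_scale: "good (s *s z) (\<lambda>l k. s * c l k)" if "good z c" for z c s
    unfolding good_def
  proof (intro allI impI)
    fix j assume j: "j < i"
    have *: "s *s z - C x (\<lambda>l k. s * c l k) = s *s (z - C x c)"
      by (simp add: C_def string_comb_scale vec.scale_right_diff_distrib)
    show "B (N j u) (s *s z - C x (\<lambda>l k. s * c l k)) = 0"
      unfolding * using that j by (simp only: good_def scale_right) simp
  qed
  have lin: "Vector_Spaces.linear (*s) (*s) h"
  proof (rule linear_vecI)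
    fix z z'
    obtain c c' where "good z c" "good z' c'" using ex by blast
    with good_add[OF this] show "h (z + z') = h z + h z'"
      by (simp add: h) (simp add: C_def string_comb_add)
  next
    fix s z
    obtain c where "good z c" using ex by blast
    then show "h (s *s z) = s *s h z"
      using h[OF good_scale[of z c s]] h[of z c]
      by (simp add: C_def string_comb_scale vec.scale_right_diff_distrib)
  qed
  \<comment> \<open>The effect of \<open>g = 1 + N\<close> on coefficient arrays.\<close>
  define shift where "shift c = (\<lambda>(l::nat) k. c l k + (if k = 0 then 0 else c l (k - 1)))"
    for c :: "nat \<Rightarrow> nat \<Rightarrow> 'a"
  have gC: "g *v C v c = C v (shift c)" if "N i v = 0" for v c
    unfolding C_def shift_def by (rule mult_string_comb) (use that in simp)
  have hg: "h (g *v z) = g *v h z" for z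
  proof -
    obtain c where c: "good z c" using ex by blast
    have perp: "B (N j u) (z - C x c) = 0" for j
      using c nilpow_eq_0_mono[OF u, of j] by (cases "j < i") (auto simp: good_def)
    have "good (g *v z) (shift c)"
      unfolding good_def
    proof (intro allI impI)
      fix j
      have "B (N j u) (N (Suc 0) (z - C x c)) = 0"
        using N_pairing_vanish[OF u, of 0 "z - C x c" "Suc 0" j] perp
        by (metis le0 sym)
      then have "B (N j u) (g *v (z - C x c)) = 0"
        using perp[of j] by (simp only: mult_eq_nilpow add_right) simp
      then show "B (N j u) (g *v z - C x (shift c)) = 0"
        by (simp add: matrix_vector_mult_diff_distrib gC[OF x])
    qed
    then show ?thesis
      using c by (simp add: h matrix_vector_mult_diff_distrib gC[OF u])
  qed
  have iso: "B (h z) (h z') = B z z'" for z z'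
  proof -
    obtain c c' where c: "good z c" "good z' c'" using ex by blast
    \<comment> \<open>The fixed part is orthogonal to every \<open>C u d = C x d - C y d\<close>, so
      it pairs equally with \<open>C x d\<close> and \<open>C y d\<close>; the moved parts pair
      equally by \<open>eq\<close>.\<close>
    have perp: "B (C u d) (z - C x c) = 0" if "good z c" for z c d
      using that by (simp add: C_def string_comb_def sum_left scale_left good_def)
    have hz: "h z = (z - C x c) + C y c" "h z' = (z' - C x c') + C y c'"
      using c by (simp_all add: h Cu)
    have "B (C y c) (C y c') = B (C x c) (C x c')"
      by (simp add: C_def string_comb_def sum_left sum_right scale_left scale_right eq)
    moreover have "B (C y d) (z - C x c) = B (C x d) (z - C x c)" if "good z c" for z c d
      using perp[OF that, of d] by (simp add: Cu diff_left)
    note this[OF c(1), of c'] this[OF c(2), of c]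
    ultimately have "B (h z) (h z') = B ((z - C x c) + C x c) ((z' - C x c') + C x c')"
      unfolding hz by (intro pairing_sum_cong)
    then show ?thesis by simp
  qed
  have "h x = y"
  proof -
    have i: "i > 0" using nz x by (cases i) auto
    have *: "C v (\<lambda>l k. if k = 0 then 1 else 0) = v" for v
      using i by (cases i) (simp_all add: C_def string_comb_def sum.lessThan_Suc_shift del: sum.lessThan_Suc)
    then have "good x (\<lambda>l k. if k = 0 then 1 else 0)" by (simp add: good_def)
    then show ?thesis by (simp add: h * u_def)
  qed
  moreover have "matrix h *v z = h z" for z by (rule matrix_works[OF lin])
  moreover have "matrix h ** g = g ** matrix h"
    using hg by (simp add: matrix_eq matrix_works[OF lin] flip: matrix_vector_mul_assoc)
  ultimately show ?thesis
    using iso by (intro bexI[of _ "matrix h"]) (simp_all add: commuting_isometries_def)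
qed

text \<open>Adding \<open>s N\<^sup>k w\<close> to \<open>y\<close> with \<open>k > 0\<close> changes \<open>B y (N\<^sup>j y)\<close> for no
  \<open>j \<ge> i - k\<close> and, if \<open>j = i - 1 - k\<close> is even, to any prescribed value. For odd \<open>j\<close> the values
  \<open>B y (N\<^sup>j y)\<close> are determined by those for larger \<open>j\<close>.\<close>

lemma adjust_representative:
  assumes x: "N i x = 0" and y: "N i y = 0" and w: "N i w = 0"
    and eq: "B x (N (i - 1) x) = B y (N (i - 1) y)" and nz: "B w (N (i - 1) y) \<noteq> 0"
  shows "\<exists>u. N i u = 0 \<and> (\<forall>a b. B (N a x) (N b x) = B (N a (y + N (Suc 0) u)) (N b (y + N (Suc 0) u)))"
proof -
  have i: "i > 0" using nz y by (cases i) auto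
  have "\<exists>u. N i u = 0 \<and> (\<forall>j. i \<le> j + Suc k \<longrightarrow>
      B x (N j x) = B (y + N (Suc 0) u) (N j (y + N (Suc 0) u)))" if "k < i" for k
    using that
  proof (induction k)
    case 0
    show ?case
    proof (intro exI[of _ 0] conjI allI impI)
      fix j assume "i \<le> j + Suc 0"
      then have "j = i - 1 \<or> i \<le> j" by linarith
      then show "B x (N j x) = B (y + N (Suc 0) 0) (N j (y + N (Suc 0) 0))"
        using eq nilpow_eq_0_mono[OF x, of j] nilpow_eq_0_mono[OF y, of j] by auto
    qed simp
  next
    case (Suc k')
    define k where "k = Suc k'"
    have k: "k < i" "0 < k" using Suc.prems by (auto simp: k_def)
    obtain u where u: "N i u = 0" and IH: "\<And>j. i \<le> j + k \<Longrightarrow>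
      B x (N j x) = B (y + N (Suc 0) u) (N j (y + N (Suc 0) u))"
      using Suc by (auto simp: k_def)
    define z where "z = y + N (Suc 0) u"
    have Nz: "N (i - 1) z = N (i - 1) y" and z: "N i z = 0"
      using i u y nilpow_eq_0_mono[OF u, of "Suc i"] by (simp_all add: z_def nilpow_add)
    define j0 where "j0 = i - 1 - k"
    have j0: "j0 + k = i - 1" "j0 + Suc k = i" using k by (auto simp: j0_def)
    have IH: "B x (N j x) = B z (N j z)" if "i \<le> j + k" for j using IH[OF that] by (simp add: z_def)
    show ?case
    proof (cases "odd j0")
      case True
      define D where "D a b = B (N a x) (N b x) - B (N a z) (N b z)" for a b
      \<comment> \<open>For odd \<open>j0\<close> nothing has to be changed: the sign rule gives
        \<open>D j0 0 = - D 0 j0\<close>, symmetry of \<open>B\<close> gives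
        \<open>D j0 0 = D 0 j0\<close>, and \<open>2\<close> is invertible.\<close>
      have "D j0 0 = (- 1) ^ j0 * D 0 (j0 + 0)"
      proof (rule pairing_recursion_sign[where D = D and n = i and J = "Suc j0"])
        show "D (Suc a) b = - D a (Suc b) - D (Suc a) (Suc b)" for a b
          unfolding D_def using pairing_step[of a x b x] pairing_step[of a z b z] by simp
        show "D a b = 0" if "i \<le> b" for a b
          using nilpow_eq_0_mono[OF x that] nilpow_eq_0_mono[OF z that] by (simp add: D_def)
        show "D 0 j = 0" if "Suc j0 \<le> j" for j
          using IH[of j] that j0 by (simp add: D_def)
      qed simp
      moreover have "D j0 0 = D 0 j0" by (simp add: D_def sym)
      ultimately have "2 * D 0 j0 = 0" using True by simp
      then have "D 0 j0 = 0" using two by simp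
      then have "B x (N j x) = B z (N j z)" if "i \<le> j + Suc k" for j
        using that IH[of j] j0 by (cases "j = j0") (auto simp: D_def)
      then show ?thesis using u by (intro exI[of _ u]) (auto simp: z_def k_def)
    next
      case False
      define e where "e = B w (N (i - 1) z)"
      have e: "e \<noteq> 0" unfolding e_def Nz by (rule nz)
      \<comment> \<open>For even \<open>j0\<close> both cross terms of \<open>B z' (N^j0 z')\<close>
        equal \<open>(-1)^k e\<close>, so the value moves by \<open>2 (-1)^k e s\<close>. The term
        quadratic in \<open>s\<close> vanishes because its total power is \<open>i - 1 + k\<close>
        with \<open>k > 0\<close>.\<close>
      define s where "s = (B x (N j0 x) - B z (N j0 z)) / (2 * (- 1) ^ k * e)"
      define z' where "z' = z + s *s N k w"
      have z': "z' = y + N (Suc 0) (u + s *s N (k - 1) w)"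
        using k by (simp add: z'_def z_def Nlin)
      have exp: "B z' (N j z') = B z (N j z) + s * B z (N (j + k) w) + s * B (N k w) (N j z)
          + s * (s * B (N k w) (N (j + k) w))" for j
        by (simp add: z'_def bilin Nlin algebra_simps)
      have "B z' (N j z') = B z (N j z)" if "i \<le> j + k" for j
        unfolding exp
        using nilpow_eq_0_mono[OF w that] N_pairing_0[OF z, of k j w] that by simp
      moreover have "B z' (N j0 z') = B x (N j0 x)"
      proof -
        have "B (N k w) (N (j0 + k) w) = 0"
          using N_pairing_0[OF w, of k "j0 + k" w] k j0 by simp
        moreover have "B (N k w) (N j0 z) = (- 1) ^ k * e"
          using N_pairing_top[OF z, of k j0 w] j0 by (simp add: e_def add.commute)
        moreover have "B z (N (j0 + k) w) = (- 1) ^ k * e"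
          using top_pairing_sym[OF z, of w] False unfolding e_def j0(1)[symmetric]
          by (simp add: power_add)
        ultimately have "B z' (N j0 z') = B z (N j0 z) + s * (2 * (- 1) ^ k * e)"
          unfolding exp by (simp add: algebra_simps)
        also have "s * (2 * (- 1) ^ k * e) = B x (N j0 x) - B z (N j0 z)"
          using e two by (simp add: s_def)
        finally show ?thesis by simp
      qed
      ultimately have "B x (N j x) = B z' (N j z')" if "i \<le> j + Suc k" for j
        using that IH[of j] j0 by (cases "j = j0") auto
      moreover have "N i (u + s *s N (k - 1) w) = 0"
        using u nilpow_eq_0_mono[OF w, of "i + (k - 1)"] by (simp add: Nlin)
      ultimately show ?thesis
        unfolding z' k_def[symmetric] by blast
    qed
  qed
  from this[of "i - 1"] i obtain u where u: "N i u = 0"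
    and *: "\<And>j. B x (N j x) = B (y + N (Suc 0) u) (N j (y + N (Suc 0) u))" by auto
  define z where "z = y + N (Suc 0) u"
  have z: "N i z = 0"
    using u y nilpow_eq_0_mono[OF u, of "Suc i"] by (simp add: z_def nilpow_add)
  \<comment> \<open>All values \<open>B x (N^j x)\<close> now agree with those of \<open>z\<close>,
    and these determine every \<open>B (N^a x) (N^b x)\<close> by the recursion.\<close>
  define D where "D a b = B (N a x) (N b x) - B (N a z) (N b z)" for a b
  have "D a b = 0" for a b
  proof (rule pairing_recursion_vanish[where D = D and n = i and J = 0])
    show "D (Suc a) b = - D a (Suc b) - D (Suc a) (Suc b)" for a b
      unfolding D_def using pairing_step[of a x b x] pairing_step[of a z b z] by simp
    show "D a b = 0" if "i \<le> b" for a b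
      using nilpow_eq_0_mono[OF x that] nilpow_eq_0_mono[OF z that] by (simp add: D_def)
    show "D 0 j = 0" for j using * by (simp add: D_def z_def)
  qed simp
  then show ?thesis using u by (auto simp: D_def z_def)
qed

section \<open>Transitivity on primitive vectors with equal top value\<close>

lemma commuting_isometry_transitive_step:
  assumes x: "N i x = 0" and y: "N i y = 0" and w: "N i w = 0"
    and eq: "B x (N (i - 1) x) = B y (N (i - 1) y)" and nz: "B w (N (i - 1) y) \<noteq> 0"
    and xy: "B (x - y) (N (i - 1) x) \<noteq> 0"
  shows "\<exists>h \<in> commuting_isometries. \<exists>u. h *v x = y + N (Suc 0) u"
proof -
  have i: "i > 0" using nz y by (cases i) auto
  obtain u where u: "N i u = 0" and
    *: "\<And>a b. B (N a x) (N b x) = B (N a (y + N (Suc 0) u)) (N b (y + N (Suc 0) u))"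
    using adjust_representative[OF x y w eq nz] by blast
  have "B (N (Suc 0) u) (N (i - 1) x) = 0"
    using N_pairing_0[OF x, of "Suc 0" "i - 1" u] i by simp
  then have "B (x - (y + N (Suc 0) u)) (N (i - 1) x) \<noteq> 0"
    using xy by (simp add: bilin)
  moreover have "N i (y + N (Suc 0) u) = 0"
    using u y nilpow_eq_0_mono[OF u, of "Suc i"] by (simp add: nilpow_add)
  ultimately show ?thesis using cyclic_witt[OF x _ *] by blast
qed

text \<open>By duality, primitivity is nontriviality of the pairing \<open>B w (N^(i-1) x)\<close>
  on \<open>ker N^i\<close>; this is the form in which transitivity uses it.\<close>

lemma primitive_pairing:
  "N (i - 1) x \<notin> range (N i) \<Longrightarrow> \<exists>w. N i w = 0 \<and> B w (N (i - 1) x) \<noteq> 0"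
  using orth_ker_N by blast

lemma commuting_isometry_transitive:
  assumes x: "N i x = 0" "N (i - 1) x \<notin> range (N i)"
    and y: "N i y = 0" "N (i - 1) y \<notin> range (N i)"
    and eq: "B x (N (i - 1) x) = B y (N (i - 1) y)"
  shows "\<exists>h \<in> commuting_isometries. \<exists>u. h *v x = y + N (Suc 0) u"
proof -
  obtain w2 where w2: "N i w2 = 0" "B w2 (N (i - 1) y) \<noteq> 0" using primitive_pairing[OF y(2)] by blast
  obtain w1 where w1: "N i w1 = 0" "B w1 (N (i - 1) x) \<noteq> 0" using primitive_pairing[OF x(2)] by blast
  have sgn: "B b (N (i - 1) a) \<noteq> 0" if "N i b = 0" "B a (N (i - 1) b) \<noteq> 0" for a b
    using top_pairing_sym[OF that(1), of a] that(2) by simp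
  consider "B (x - y) (N (i - 1) x) \<noteq> 0" | "B (x - y) (N (i - 1) x) = 0" "B x (N (i - 1) x) \<noteq> 0"
    | "B (x - y) (N (i - 1) x) = 0" "B x (N (i - 1) x) = 0" by blast
  then show ?thesis
  proof cases
    case 1
    then show ?thesis by (rule commuting_isometry_transitive_step[OF x(1) y(1) w2(1) eq w2(2)])
  next
    case 2
    \<comment> \<open>\<open>x - y\<close> and \<open>x + y\<close> cannot both pair to zero with
      \<open>N^(i-1) x\<close>, since their sum is \<open>2 x\<close>.\<close>
    have "B (x - (- y)) (N (i - 1) x) \<noteq> 0"
    proof
      assume "B (x - (- y)) (N (i - 1) x) = 0"
      then have "2 * B x (N (i - 1) x) = 0" using 2(1) by (simp add: bilin)
      then show False using 2 two by simp
    qed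
    then obtain h u where h: "h \<in> commuting_isometries" "h *v x = - y + N (Suc 0) u"
      using commuting_isometry_transitive_step[OF x(1) _ w2(1), of "- y"] y(1) eq w2(2)
      by (auto simp: Nlin bilin)
    then have "(- h) *v x = y + N (Suc 0) (- u)" by (simp add: matrix_minus_mult Nlin)
    then show ?thesis using commuting_isometries_minus[OF h(1)] by blast
  next
    case 3
    then have yx: "B y (N (i - 1) x) = 0" by (simp add: bilin)
    have xx: "B x (N (i - 1) x) = 0" by fact
    have yy: "B y (N (i - 1) y) = 0" using eq xx by simp
    have xy: "B x (N (i - 1) y) = 0" using yx top_pairing_sym[OF x(1), of y] by simp
    obtain w where w: "N i w = 0" "B w (N (i - 1) x) \<noteq> 0" "B w (N (i - 1) y) \<noteq> 0"
    proof -
      \<comment> \<open>A single vector pairing with both \<open>x\<close> and \<open>y\<close>: if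
        neither \<open>w1\<close> nor \<open>w2\<close> does, each misses exactly one of them and
        their sum works.\<close>
      consider "B w1 (N (i - 1) y) \<noteq> 0" | "B w2 (N (i - 1) x) \<noteq> 0"
        | "B w1 (N (i - 1) y) = 0" "B w2 (N (i - 1) x) = 0" by blast
      then show thesis
      proof cases
        case 3
        then show thesis using that[of "w1 + w2"] w1 w2 by (simp add: Nlin bilin)
      qed (use that w1 w2 in auto)
    qed
    \<comment> \<open>Subtracting this multiple of \<open>x\<close> makes \<open>w\<close> isotropic
      when the top form is symmetric. When it is alternating, \<open>w\<close> is isotropic already
      and \<open>s = 0\<close>.\<close>
    define s where "s = B w (N (i - 1) w) / (2 * B w (N (i - 1) x))"
    define z where "z = w - s *s x"
    have z: "N i z = 0" by (simp add: z_def Nlin w x)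
    have "B z (N (i - 1) z) = B w (N (i - 1) w) - s * (B w (N (i - 1) x) + B x (N (i - 1) w))"
      using xx by (simp add: z_def Nlin bilin algebra_simps)
    also have "\<dots> = 0"
    proof (cases "even (i - 1)")
      case True
      then have "B x (N (i - 1) w) = B w (N (i - 1) x)"
        using top_pairing_sym[OF x(1), of w] by simp
      then show ?thesis using w(2) two by (simp add: s_def field_simps)
    next
      case False
      then have "2 * B w (N (i - 1) w) = 0"
        using top_pairing_sym[OF w(1), of w] by simp
      then have "B w (N (i - 1) w) = 0" using two by simp
      then show ?thesis by (simp add: s_def)
    qed
    finally have zz: "B z (N (i - 1) z) = 0" .
    have zx: "B z (N (i - 1) x) \<noteq> 0" "B z (N (i - 1) y) \<noteq> 0"
      using w xx xy by (simp_all add: z_def bilin)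
    have xz: "B x (N (i - 1) z) \<noteq> 0" "B y (N (i - 1) z) \<noteq> 0"
      using sgn[OF x(1)] sgn[OF y(1)] zx by auto
    obtain h u where h: "h \<in> commuting_isometries" "h *v x = z + N (Suc 0) u"
      using commuting_isometry_transitive_step[OF x(1) z x(1)] xx zz xz zx by (auto simp: bilin)
    obtain h' u' where h': "h' \<in> commuting_isometries" "h' *v z = y + N (Suc 0) u'"
      using commuting_isometry_transitive_step[OF z y(1) z] yy zz xz zx by (auto simp: bilin)
    have "(h' ** h) *v x = y + N (Suc 0) (u' + h' *v u)"
      by (simp add: h h' matrix_vector_right_distrib nilpow_add commuting_isometries_N
          flip: matrix_vector_mul_assoc)
    then show ?thesis using commuting_isometries_mult[OF h'(1) h(1)] by blast
  qed
qed

end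

section \<open>Orbits on cosets\<close>

lemma add_coset_eq_iff:
  assumes "vec.subspace U"
  shows "add_coset U x = add_coset U y \<longleftrightarrow> x - y \<in> U"
proof
  assume *: "add_coset U x = add_coset U y"
  have "x \<in> add_coset U x"
    using vec.subspace_0[OF assms] by (force simp: add_coset_def)
  then obtain u where "x = y + u" "u \<in> U" unfolding * by (auto simp: add_coset_def)
  then show "x - y \<in> U" by simp
next
  assume *: "x - y \<in> U"
  have "add_coset U x \<subseteq> add_coset U y" if "x - y \<in> U" for x y
  proof
    fix z assume "z \<in> add_coset U x"
    then obtain u where "u \<in> U" "z = x + u" by (auto simp: add_coset_def)
    then have "z = y + ((x - y) + u)" "(x - y) + u \<in> U"
      using vec.subspace_add[OF assms] that by auto
    then show "z \<in> add_coset U y" unfolding add_coset_def by blast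
  qed
  moreover have "y - x \<in> U" using vec.subspace_neg[OF assms *] by simp
  ultimately show "add_coset U x = add_coset U y" using * by blast
qed

lemma mem_add_coset:
  "vec.subspace U \<Longrightarrow> y \<in> add_coset U x \<longleftrightarrow> y - x \<in> U"
  unfolding add_coset_def image_iff by (metis add_diff_cancel_left' diff_add_cancel add.commute)

lemma add_coset_self: "vec.subspace U \<Longrightarrow> x \<in> add_coset U x"
  by (simp add: mem_add_coset vec.subspace_0)

lemma add_coset_eqI: "vec.subspace U \<Longrightarrow> y \<in> add_coset U x \<Longrightarrow> add_coset U x = add_coset U y"
  by (metis add_coset_eq_iff mem_add_coset)

lemma commutator_space_eq: "commutator_space g = range (nilpow g (Suc 0))"
proof -
  have "(mat 1 - g) *v x = nilpow g (Suc 0) (- x)" for x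
    by (simp add: nilpow_minus nilpow_1 matrix_vector_mult_diff_rdistrib)
  then have "commutator_space g = (\<lambda>x. nilpow g (Suc 0) (- x)) ` UNIV"
    by (simp add: commutator_space_def)
  also have "\<dots> = range (nilpow g (Suc 0))"
    by (metis (no_types) image_image surj_uminus)
  finally show ?thesis .
qed

lemma card_image_eq_card_image:
  assumes "\<And>x y. x \<in> A \<Longrightarrow> y \<in> A \<Longrightarrow> f x = f y \<longleftrightarrow> h x = h y"
  shows "card (f ` A) = card (h ` A)"
proof (rule bij_betw_same_card)
  have *: "h (SOME a. a \<in> A \<and> f a = f x) = h x" if "x \<in> A" for x
    using someI[of "\<lambda>a. a \<in> A \<and> f a = f x" x] that assms by metis
  show "bij_betw (\<lambda>y. h (SOME a. a \<in> A \<and> f a = y)) (f ` A) (h ` A)"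
    unfolding bij_betw_def inj_on_def using * assms by (force simp: image_iff)
qed

context orthogonal_isometry
begin

text \<open>For \<open>i > 0\<close> the second condition says that the coset of \<open>x\<close>
  modulo the range of \<open>N\<close> misses \<open>ker N^(i-1)\<close>. No vector is primitive for
  \<open>i = 0\<close>, as \<open>N^0\<close> is onto.\<close>

definition primitive :: "nat \<Rightarrow> 'a ^ 'n \<Rightarrow> bool" where
  "primitive i x \<longleftrightarrow> N i x = 0 \<and> N (i - 1) x \<notin> range (N i)"

definition top_values :: "nat \<Rightarrow> 'a set" where
  "top_values i = {B x (N (i - 1) x) | x. primitive i x}"

text \<open>Set-valued, so that no representative is chosen: a nontrivial coset gives a singleton
  and the trivial one gives the empty set.\<close>

definition coset_invariant :: "('a ^ 'n) set \<Rightarrow> (nat \<times> 'a) set" where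
  "coset_invariant X = {(i, B x (N (i - 1) x)) | i x. x \<in> X \<and> primitive i x}"

abbreviation NV :: "('a ^ 'n) set" where
  "NV \<equiv> range (N (Suc 0))"

lemmas subspace_NV = subspace_range_nilpow[of g "Suc 0"]

lemma primitive_pos: "primitive i x \<Longrightarrow> 0 < i"
  by (cases i) (auto simp: primitive_def)

lemma diff_mem_NV_E:
  assumes "y - x \<in> NV"
  obtains u where "y = x + N (Suc 0) u"
proof -
  obtain u where "y - x = N (Suc 0) u" using assms by blast
  then show thesis using that[of u] by (simp add: algebra_simps)
qed

text \<open>If \<open>y = x + N u\<close>, then \<open>N^i\<close> kills both \<open>x\<close> and
  \<open>y\<close>, so the two cross terms \<open>B (N u) (N^(i-1) y)\<close> and
  \<open>B x (N^i u)\<close> vanish.\<close>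

lemma primitive_unique:
  assumes x: "primitive i x" and y: "primitive j y" and xy: "y - x \<in> NV"
  shows "i = j" and "B x (N (i - 1) x) = B y (N (j - 1) y)"
proof -
  have "j \<le> i" if x: "primitive i x" and y: "primitive j y" and xy: "y - x \<in> NV" for i j x y
  proof (rule ccontr)
    assume "\<not> j \<le> i"
    then have "N (j - 1) x = 0"
      using x nilpow_eq_0_mono[of g i x "j - 1"] by (simp add: primitive_def)
    moreover obtain u where "y = x + N (Suc 0) u"
      by (rule diff_mem_NV_E[OF xy])
    ultimately have "N (j - 1) y = N j u"
      using primitive_pos[OF y] by (simp add: nilpow_add)
    then show False using y by (simp add: primitive_def)
  qed
  note le = this
  have "x - y \<in> NV" using vec.subspace_neg[OF subspace_NV xy] by simp
  from le[OF x y xy] le[OF y x this] show ij: "i = j" by simp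
  obtain u where u: "y = x + N (Suc 0) u"
    by (rule diff_mem_NV_E[OF xy])
  have i: "0 < i" using primitive_pos[OF x] .
  have "N i x = 0" "N i y = 0" using x y ij by (auto simp: primitive_def)
  then have "B (N (Suc 0) u) (N (i - 1) y) = 0" "B x (N i u) = 0"
    using N_pairing_0[of i y "Suc 0" "i - 1" u] N_pairing_0'[of i x 0 i u] by auto
  moreover have "N (i - 1) y = N (i - 1) x + N i u"
    using i by (simp add: u nilpow_add)
  ultimately have "B y (N (i - 1) y) = B x (N (i - 1) x)"
    by (subst u) (simp add: add_left, simp add: add_right)
  then show "B x (N (i - 1) x) = B y (N (j - 1) y)" using ij by simp
qed

text \<open>Minimality of the exponent is primitivity: from \<open>N^(i-1) y = N^i u\<close> one
  gets \<open>y - N u\<close> in the same coset and in \<open>ker N^(i-1)\<close>. Fitting's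
  decomposition bounds the exponent by the dimension.\<close>

lemma coset_has_primitive:
  assumes "x \<notin> NV"
  obtains i y where "i \<in> {1..CARD('n)}" "primitive i y" "y - x \<in> NV"
proof -
  let ?P = "\<lambda>i. \<exists>y. y - x \<in> NV \<and> N i y = 0"
  have m: "?P (CARD('n))"
  proof -
    obtain u where u: "N (CARD('n)) (x - N (CARD('n)) u) = 0" using fitting_sum by blast
    obtain k where "CARD('n) = Suc k" using zero_less_card_finite gr0_conv_Suc by blast
    then have "x - N (CARD('n)) u - x = N (Suc 0) (- N k u)" by (simp add: nilpow_minus)
    then show ?thesis using u by (metis rangeI)
  qed
  define i where "i = (LEAST i. ?P i)"
  obtain y where y: "y - x \<in> NV" "N i y = 0" using LeastI[of ?P, OF m] by (auto simp: i_def)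
  have "i \<le> CARD('n)" unfolding i_def by (rule Least_le[of ?P, OF m])
  moreover have i: "i \<noteq> 0"
  proof
    assume "i = 0"
    then have "- x \<in> NV" using y by simp
    then show False using assms vec.subspace_neg[OF subspace_NV, of "- x"] by simp
  qed
  moreover have "N (i - 1) y \<notin> range (N i)"
  proof
    assume "N (i - 1) y \<in> range (N i)"
    then obtain u where u: "N (i - 1) y = N i u" by blast
    then have "N (i - 1) (y - N (Suc 0) u) = 0" using i by (simp add: nilpow_diff)
    moreover have "y - N (Suc 0) u - x \<in> NV"
      using vec.subspace_diff[OF subspace_NV y(1), of "N (Suc 0) u"] by (simp add: algebra_simps)
    ultimately have "i \<le> i - 1" unfolding i_def by (intro Least_le) blast
    then show False using i by simp
  qed
  ultimately show thesis using that[of i y] y by (simp add: primitive_def)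
qed

lemma coset_invariant_primitive:
  assumes "primitive i y" "y \<in> add_coset NV x"
  shows "coset_invariant (add_coset NV x) = {(i, B y (N (i - 1) y))}"
proof -
  have "z - y \<in> NV" if "z \<in> add_coset NV x" for z
    using that assms(2) by (metis add_coset_eqI mem_add_coset subspace_NV)
  note mem = this
  have "(j, B z (N (j - 1) z)) = (i, B y (N (i - 1) y))"
    if "z \<in> add_coset NV x" "primitive j z" for j z
    using primitive_unique[OF assms(1) that(2) mem[OF that(1)]] by simp
  note uniq = this
  show ?thesis
  proof
    show "coset_invariant (add_coset NV x) \<subseteq> {(i, B y (N (i - 1) y))}"
    proof
      fix p assume "p \<in> coset_invariant (add_coset NV x)"
      then obtain j z where "p = (j, B z (N (j - 1) z))" "z \<in> add_coset NV x" "primitive j z"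
        unfolding coset_invariant_def by blast
      then show "p \<in> {(i, B y (N (i - 1) y))}" using uniq by simp
    qed
    show "{(i, B y (N (i - 1) y))} \<subseteq> coset_invariant (add_coset NV x)"
      using assms unfolding coset_invariant_def by blast
  qed
qed

lemma coset_invariant_trivial: "x \<in> NV \<Longrightarrow> coset_invariant (add_coset NV x) = {}"
proof -
  assume x: "x \<in> NV"
  have "\<not> primitive i y" if "y \<in> add_coset NV x" for i y
  proof
    assume p: "primitive i y"
    have "y \<in> NV"
      using x that vec.subspace_add[OF subspace_NV] by (auto simp: add_coset_def)
    then obtain u where "y = N (Suc 0) u" by blast
    then have "N (i - 1) y = N i u" using primitive_pos[OF p] by simp
    then show False using p by (simp add: primitive_def)
  qed
  then show ?thesis by (auto simp: coset_invariant_def)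
qed

lemma image_coset_invariant:
  "coset_invariant ` quotient_space UNIV NV =
    insert {} ((\<lambda>p. {p}) ` Sigma {1..CARD('n)} top_values)"
proof
  show "coset_invariant ` quotient_space UNIV NV \<subseteq>
      insert {} ((\<lambda>p. {p}) ` Sigma {1..CARD('n)} top_values)"
  proof (clarsimp simp: quotient_space_def)
    fix x assume *: "coset_invariant (add_coset NV x) \<notin> (\<lambda>p. {p}) ` Sigma {Suc 0..CARD('n)} top_values"
    show "coset_invariant (add_coset NV x) = {}"
    proof (rule ccontr)
      assume "coset_invariant (add_coset NV x) \<noteq> {}"
      then have "x \<notin> NV" using coset_invariant_trivial by blast
      then obtain i y where i: "i \<in> {1..CARD('n)}" "primitive i y" "y - x \<in> NV"
        by (rule coset_has_primitive)
      then have "coset_invariant (add_coset NV x) = {(i, B y (N (i - 1) y))}"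
        by (intro coset_invariant_primitive) (simp_all add: mem_add_coset subspace_NV)
      then show False using * i by (force simp: top_values_def)
    qed
  qed
  show "insert {} ((\<lambda>p. {p}) ` Sigma {1..CARD('n)} top_values) \<subseteq>
      coset_invariant ` quotient_space UNIV NV"
  proof -
    have "{} \<in> coset_invariant ` quotient_space UNIV NV"
      using coset_invariant_trivial[OF vec.subspace_0[OF subspace_NV]]
      by (force simp: quotient_space_def)
    moreover have "{(i, c)} \<in> coset_invariant ` quotient_space UNIV NV" if "c \<in> top_values i" for i c
    proof -
      obtain x where "primitive i x" "c = B x (N (i - 1) x)"
        using \<open>c \<in> top_values i\<close> unfolding top_values_def by blast
      then have "coset_invariant (add_coset NV x) = {(i, c)}"
        by (simp add: coset_invariant_primitive add_coset_self subspace_NV)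
      then show ?thesis by (force simp: quotient_space_def)
    qed
    ultimately show ?thesis by auto
  qed
qed

lemma commuting_isometries_inj:
  assumes "h \<in> commuting_isometries" and x: "h *v x = 0"
  shows "x = 0"
proof (rule nondeg)
  fix y
  have "B (h *v x) (h *v y) = B x y" using assms(1) by (simp add: commuting_isometries_def)
  then show "B x y = 0" by (simp add: x)
qed

lemma commuting_isometries_surj:
  assumes "h \<in> commuting_isometries"
  shows "surj ((*v) h)"
proof (rule vec.linear_injective_imp_surjective)
  show "inj ((*v) h)"
    unfolding vec.inj_iff_eq_0 using commuting_isometries_inj[OF assms] by blast
qed auto

lemma commuting_isometries_image_coset:
  assumes h: "h \<in> commuting_isometries"
  shows "(*v) h ` add_coset NV x = add_coset NV (h *v x)"
proof -
  have "(*v) h ` NV = (\<lambda>u. N (Suc 0) (h *v u)) ` UNIV"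
    by (simp add: image_image commuting_isometries_N[OF h])
  also have "\<dots> = NV"
    using commuting_isometries_surj[OF h] by (metis image_image)
  finally have "(*v) h ` NV = NV" .
  moreover have "(*v) h ` add_coset NV x = (\<lambda>u. h *v x + u) ` ((*v) h ` NV)"
    by (simp add: add_coset_def image_image matrix_vector_right_distrib)
  ultimately show ?thesis by (simp add: add_coset_def)
qed

lemma primitive_commuting_isometry:
  assumes h: "h \<in> commuting_isometries" and x: "primitive i x"
  shows "primitive i (h *v x)"
proof -
  have "N (i - 1) (h *v x) \<notin> range (N i)"
  proof
    assume "N (i - 1) (h *v x) \<in> range (N i)"
    then obtain u where "N (i - 1) (h *v x) = N i u" by blast
    moreover obtain v where "u = h *v v" using commuting_isometries_surj[OF h] by (metis surjD)
    ultimately have "h *v (N (i - 1) x - N i v) = 0"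
      by (simp add: commuting_isometries_N[OF h] matrix_vector_mult_diff_distrib)
    then have "N (i - 1) x - N i v = 0" by (rule commuting_isometries_inj[OF h])
    then show False using x by (auto simp: primitive_def)
  qed
  then show ?thesis using x by (simp add: primitive_def commuting_isometries_N[OF h])
qed

lemma coset_invariant_image:
  assumes h: "h \<in> commuting_isometries"
  shows "coset_invariant ((*v) h ` add_coset NV x) = coset_invariant (add_coset NV x)"
proof (cases "x \<in> NV")
  case True
  then have "h *v x \<in> NV" by (auto simp flip: commuting_isometries_N[OF h])
  then show ?thesis
    using True by (simp add: commuting_isometries_image_coset[OF h] coset_invariant_trivial)
next
  case False
  then obtain i y where y: "primitive i y" "y \<in> add_coset NV x"
    by (metis coset_has_primitive mem_add_coset subspace_NV)
  have "h *v y \<in> add_coset NV (h *v x)"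
    using imageI[OF y(2), of "(*v) h"] commuting_isometries_image_coset[OF h] by simp
  then have "coset_invariant (add_coset NV (h *v x)) = {(i, B (h *v y) (N (i - 1) (h *v y)))}"
    by (intro coset_invariant_primitive primitive_commuting_isometry[OF h] y)
  also have "\<dots> = coset_invariant (add_coset NV x)"
    using h coset_invariant_primitive[OF y]
    by (simp add: commuting_isometries_N) (simp add: commuting_isometries_def)
  finally show ?thesis by (simp add: commuting_isometries_image_coset[OF h])
qed

lemma one_commuting_isometry: "mat 1 \<in> commuting_isometries"
  by (simp add: commuting_isometries_def)

lemma coset_invariant_eq_imp_conjugate:
  assumes "coset_invariant (add_coset NV x) = coset_invariant (add_coset NV y)"
  shows "\<exists>h \<in> commuting_isometries. (*v) h ` add_coset NV x = add_coset NV y"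
proof (cases "x \<in> NV \<or> y \<in> NV")
  case True
  have "z \<in> NV" if "coset_invariant (add_coset NV z) = {}" for z
  proof (rule ccontr)
    assume "z \<notin> NV"
    then obtain i w where "primitive i w" "w \<in> add_coset NV z"
      by (metis coset_has_primitive mem_add_coset subspace_NV)
    then show False using that coset_invariant_primitive[of i w z] by simp
  qed
  note triv = this
  have "x \<in> NV \<and> y \<in> NV"
    using True
  proof
    assume x: "x \<in> NV"
    show ?thesis using x triv[of y] assms coset_invariant_trivial[OF x] by simp
  next
    assume y: "y \<in> NV"
    show ?thesis using y triv[of x] assms coset_invariant_trivial[OF y] by simp
  qed
  then have "add_coset NV x = add_coset NV y"
    by (simp add: add_coset_eq_iff subspace_NV vec.subspace_diff)
  then show ?thesis using one_commuting_isometry by (intro bexI[of _ "mat 1"]) auto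
next
  case False
  then obtain i x' j y' where x': "primitive i x'" "x' \<in> add_coset NV x"
    and y': "primitive j y'" "y' \<in> add_coset NV y"
    by (metis coset_has_primitive mem_add_coset subspace_NV)
  then have "i = j" "B x' (N (i - 1) x') = B y' (N (i - 1) y')"
    using assms coset_invariant_primitive[OF x'] coset_invariant_primitive[OF y'] by auto
  then obtain h u where h: "h \<in> commuting_isometries" "h *v x' = y' + N (Suc 0) u"
    using commuting_isometry_transitive[of i x' y'] x' y' by (auto simp: primitive_def)
  have "(*v) h ` add_coset NV x = add_coset NV (h *v x')"
    using commuting_isometries_image_coset[OF h(1)] add_coset_eqI[OF subspace_NV x'(2)] by metis
  also have "\<dots> = add_coset NV y'"
    by (simp add: add_coset_eq_iff subspace_NV h)
  also have "\<dots> = add_coset NV y" using add_coset_eqI[OF subspace_NV y'(2)] by simp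
  finally show ?thesis using h by blast
qed

text \<open>Two cosets have the same orbit exactly when they have the same invariant, so invariants
  are counted instead. The summand \<open>1\<close> is the trivial coset.\<close>

lemma card_commuting_isometry_orbits:
  assumes fin: "finite (UNIV :: 'a set)"
  shows "card ((\<lambda>X. {(*v) h ` X | h. h \<in> commuting_isometries}) ` quotient_space UNIV NV) =
    1 + (\<Sum>i=1..CARD('n). card (top_values i))"
proof -
  let ?orb = "\<lambda>X. {(*v) h ` X | h. h \<in> commuting_isometries}"
  have sub: "?orb Y \<subseteq> ?orb X" if "h \<in> commuting_isometries" "(*v) h ` X = Y" for h X Y
  proof
    fix Z assume "Z \<in> ?orb Y"
    then obtain k where "k \<in> commuting_isometries" "Z = (*v) k ` Y" by blast
    then have "Z = (*v) (k ** h) ` X" "k ** h \<in> commuting_isometries"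
      using that commuting_isometries_mult
      by (auto simp: image_image simp flip: matrix_vector_mul_assoc)
    then show "Z \<in> ?orb X" by blast
  qed
  have "?orb X = ?orb Y \<longleftrightarrow> coset_invariant X = coset_invariant Y"
    if "X \<in> quotient_space UNIV NV" "Y \<in> quotient_space UNIV NV" for X Y
  proof
    obtain x y where xy: "X = add_coset NV x" "Y = add_coset NV y"
      using \<open>X \<in> _\<close> \<open>Y \<in> _\<close> by (auto simp: quotient_space_def)
    {
      assume eq: "?orb X = ?orb Y"
      have "Y \<in> ?orb Y"
        using one_commuting_isometry by (force intro!: exI[of _ "mat 1"])
      then have "Y \<in> ?orb X" by (simp only: eq)
      then obtain h where "h \<in> commuting_isometries" "Y = (*v) h ` X" by blast
      then show "coset_invariant X = coset_invariant Y" using coset_invariant_image xy by simp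
    }
    {
      assume "coset_invariant X = coset_invariant Y"
      then obtain h k where "h \<in> commuting_isometries" "(*v) h ` X = Y"
        "k \<in> commuting_isometries" "(*v) k ` Y = X"
        using coset_invariant_eq_imp_conjugate[of x y] coset_invariant_eq_imp_conjugate[of y x]
        unfolding xy by auto
      then show "?orb X = ?orb Y"
        using sub[of h X Y] sub[of k Y X] by (intro subset_antisym)
    }
  qed
  then have "card (?orb ` quotient_space UNIV NV) = card (coset_invariant ` quotient_space UNIV NV)"
    by (rule card_image_eq_card_image)
  also have "\<dots> = 1 + card ((\<lambda>p. {p}) ` Sigma {1..CARD('n)} top_values)"
    unfolding image_coset_invariant using finite_subset[OF subset_UNIV fin]
    by (subst card_insert_disjoint) auto
  also have "card ((\<lambda>p. {p}) ` Sigma {1..CARD('n)} top_values) = card (Sigma {1..CARD('n)} top_values)"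
    by (rule card_image) (simp add: inj_on_def)
  also have "\<dots> = (\<Sum>i=1..CARD('n). card (top_values i))"
    using finite_subset[OF subset_UNIV fin] by (intro card_SigmaI) auto
  finally show ?thesis .
qed

end

section \<open>Jordan bases\<close>

lemma independent_family_iff:
  fixes b :: "'i \<Rightarrow> 'a::field ^ 'n"
  assumes "finite I"
  shows "inj_on b I \<and> vec.independent (b ` I) \<longleftrightarrow>
    (\<forall>c. (\<Sum>p\<in>I. c p *s b p) = 0 \<longrightarrow> (\<forall>p\<in>I. c p = 0))" (is "?l \<longleftrightarrow> ?r")
proof
  assume ?l
  then have inj: "inj_on b I" and ind: "vec.independent (b ` I)" by auto
  show ?r
  proof (intro allI impI ballI)
    fix c p assume *: "(\<Sum>p\<in>I. c p *s b p) = 0" "p \<in> I"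
    have "(\<Sum>v\<in>b ` I. c (inv_into I b v) *s v) = (\<Sum>p\<in>I. c p *s b p)"
      using inj by (subst sum.reindex) (auto intro!: sum.cong)
    then have "\<forall>v\<in>b ` I. c (inv_into I b v) = 0"
      using ind * unfolding vec.independent_explicit by metis
    then show "c p = 0" using inj *(2) by auto
  qed
next
  assume r: ?r
  have inj: "inj_on b I"
  proof (rule inj_onI, rule ccontr)
    \<comment> \<open>Two equal members of the family give the nontrivial relation
      \<open>b p - b p' = 0\<close>.\<close>
    fix p p' assume p: "p \<in> I" "p' \<in> I" "b p = b p'" "p \<noteq> p'"
    define c where "c x = (if x = p then 1 else if x = p' then - 1 else (0::'a))" for x
    have "(\<Sum>x\<in>I. c x *s b x) = (\<Sum>x\<in>{p, p'}. c x *s b x)"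
      using p assms by (intro sum.mono_neutral_right) (auto simp: c_def)
    also have "\<dots> = 0" using p by (simp add: c_def)
    finally have "c p = 0" using r p(1) by blast
    then show False by (simp add: c_def)
  qed
  have "vec.independent (b ` I)"
    unfolding vec.independent_explicit
  proof (intro conjI allI impI)
    fix u assume "(\<Sum>v\<in>b ` I. u v *s v) = 0"
    then have "(\<Sum>p\<in>I. u (b p) *s b p) = 0"
      using inj by (simp add: sum.reindex)
    then have "\<forall>p\<in>I. u (b p) = 0" using r[rule_format, of "\<lambda>p. u (b p)"] by blast
    then show "\<forall>v\<in>b ` I. u v = 0" by blast
  qed (use assms in simp)
  then show ?l using inj by simp
qed

lemma span_family:
  fixes b :: "'i \<Rightarrow> 'a::field ^ 'n"
  assumes "finite I"
  shows "vec.span (b ` I) = range (\<lambda>c. \<Sum>p\<in>I. c p *s b p)"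
proof
  have "vec.subspace (range (\<lambda>c. \<Sum>p\<in>I. c p *s b p))"
    unfolding vec.subspace_def
  proof (intro conjI ballI allI)
    show "0 \<in> range (\<lambda>c. \<Sum>p\<in>I. c p *s b p)"
      by (rule image_eqI[of _ _ "\<lambda>_. 0"]) simp_all
  next
    fix x y assume "x \<in> range (\<lambda>c. \<Sum>p\<in>I. c p *s b p)" "y \<in> range (\<lambda>c. \<Sum>p\<in>I. c p *s b p)"
    then obtain c d where "x = (\<Sum>p\<in>I. c p *s b p)" "y = (\<Sum>p\<in>I. d p *s b p)" by blast
    then have "x + y = (\<Sum>p\<in>I. (c p + d p) *s b p)"
      by (simp add: sum.distrib vector_sadd_rdistrib)
    then show "x + y \<in> range (\<lambda>c. \<Sum>p\<in>I. c p *s b p)"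
      by (rule range_eqI[of _ _ "\<lambda>p. c p + d p"])
  next
    fix s x assume "x \<in> range (\<lambda>c. \<Sum>p\<in>I. c p *s b p)"
    then obtain c where "x = (\<Sum>p\<in>I. c p *s b p)" by blast
    then have "s *s x = (\<Sum>p\<in>I. (s * c p) *s b p)"
      by (simp add: vec.scale_sum_right)
    then show "s *s x \<in> range (\<lambda>c. \<Sum>p\<in>I. c p *s b p)"
      by (rule range_eqI[of _ _ "\<lambda>p. s * c p"])
  qed
  moreover have "b ` I \<subseteq> range (\<lambda>c. \<Sum>p\<in>I. c p *s b p)"
  proof
    fix x assume "x \<in> b ` I"
    then obtain q where q: "q \<in> I" "x = b q" by blast
    have "x = (\<Sum>p\<in>I. (if p = q then 1 else 0) *s b p)"
      using q assms by (simp add: if_distrib[of "\<lambda>c. c *s _"] cong: if_cong)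
    then show "x \<in> range (\<lambda>c. \<Sum>p\<in>I. c p *s b p)"
      by (rule range_eqI[of _ _ "\<lambda>p. if p = q then 1 else 0"])
  qed
  ultimately show "vec.span (b ` I) \<subseteq> range (\<lambda>c. \<Sum>p\<in>I. c p *s b p)"
    by (intro vec.span_minimal)
  show "range (\<lambda>c. \<Sum>p\<in>I. c p *s b p) \<subseteq> vec.span (b ` I)"
  proof clarify
    fix c show "(\<Sum>p\<in>I. c p *s b p) \<in> vec.span (b ` I)"
      by (intro vec.span_sum vec.span_scale vec.span_base imageI)
  qed
qed

abbreviation list_comb :: "'a::field ^ 'n ^ 'n \<Rightarrow> (('a ^ 'n) \<times> nat) list \<Rightarrow> (nat \<Rightarrow> nat \<Rightarrow> 'a) \<Rightarrow> 'a ^ 'n" where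
  "list_comb g L \<equiv> string_comb g (length L) (\<lambda>l. snd (L ! l)) (\<lambda>l. fst (L ! l))"

text \<open>Restates independence and span in terms of coefficient arrays, on which \<open>N\<close>
  is a shift and concatenation of lists is addition.\<close>

lemma jordan_basis_iff:
  "jordan_basis g W L \<longleftrightarrow>
     (\<forall>(v, k) \<in> set L. 0 < k \<and> nilpow g k v = 0) \<and>
     (\<forall>c. list_comb g L c = 0 \<longrightarrow> (\<forall>l<length L. \<forall>k<snd (L ! l). c l k = 0)) \<and>
     W = range (list_comb g L)"
proof -
  define I where "I = {(l, j). l < length L \<and> j < snd (L ! l)}"
  define b where "b = (\<lambda>(l, j). nilpow g j (fst (L ! l)))"
  have I: "I = (SIGMA l:{..<length L}. {..<snd (L ! l)})" by (auto simp: I_def)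
  have fin: "finite I" by (simp add: I)
  have comb: "(\<Sum>p\<in>I. c p *s b p) = list_comb g L (curry c)" for c
    unfolding I string_comb_def
    by (subst sum.Sigma) (simp_all add: b_def split_beta)
  have comb': "list_comb g L c = (\<Sum>p\<in>I. case_prod c p *s b p)" for c
    using comb[of "case_prod c"] by simp
  have "inj_on b I \<and> vec.independent (b ` I) \<longleftrightarrow>
      (\<forall>c. list_comb g L c = 0 \<longrightarrow> (\<forall>l<length L. \<forall>k<snd (L ! l). c l k = 0))"
    unfolding independent_family_iff[OF fin]
  proof (intro iffI allI impI ballI)
    fix c l k
    assume *: "\<forall>c. (\<Sum>p\<in>I. c p *s b p) = 0 \<longrightarrow> (\<forall>p\<in>I. c p = 0)" "list_comb g L c = 0"
      "l < length L" "k < snd (L ! l)"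
    then show "c l k = 0" using comb'[of c] by (force simp: I_def)
  next
    fix c p
    assume *: "\<forall>c. list_comb g L c = 0 \<longrightarrow> (\<forall>l<length L. \<forall>k<snd (L ! l). c l k = 0)"
      "(\<Sum>p\<in>I. c p *s b p) = 0" "p \<in> I"
    then show "c p = 0" using comb[of c] by (cases p) (force simp: I_def)
  qed
  note ind = this
  have span: "vec.span (b ` I) = range (list_comb g L)"
    unfolding span_family[OF fin] comb
  proof
    show "range (list_comb g L) \<subseteq> range (\<lambda>c. list_comb g L (curry c))"
    proof clarify
      fix c show "list_comb g L c \<in> range (\<lambda>c. list_comb g L (curry c))"
        by (rule range_eqI[of _ _ "case_prod c"]) simp
    qed
  qed auto
  have "inj_on b I \<and> vec.independent (b ` I) \<and> vec.span (b ` I) = W \<longleftrightarrow>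
      (inj_on b I \<and> vec.independent (b ` I)) \<and> W = vec.span (b ` I)"
    by (simp only: conj_assoc eq_commute)
  then show ?thesis
    unfolding jordan_basis_def Let_def nilpow_def[symmetric] I_def[symmetric] b_def[symmetric]
    by (simp only: ind span)
qed

lemma jordan_basis_nth:
  assumes "jordan_basis g W L" "l < length L"
  shows "0 < snd (L ! l)" "nilpow g (snd (L ! l)) (fst (L ! l)) = 0"
  using assms nth_mem[OF assms(2)] unfolding jordan_basis_iff by (cases "L ! l"; fastforce)+

lemma jordan_basis_subspace: "jordan_basis g W L \<Longrightarrow> vec.subspace W"
  by (simp add: jordan_basis_iff subspace_string_comb)

lemma jordan_basis_nilpow_closed:
  assumes "jordan_basis g W L" "x \<in> W"
  shows "nilpow g k x \<in> W"
proof (induction k)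
  case (Suc k)
  obtain c where "nilpow g k x = list_comb g L c"
    using Suc assms(1) by (auto simp: jordan_basis_iff)
  then have "nilpow g (Suc 0) (nilpow g k x) \<in> range (list_comb g L)"
    using nilpow_string_comb[of "length L" g "\<lambda>l. snd (L ! l)" "\<lambda>l. fst (L ! l)" c]
      jordan_basis_nth(2)[OF assms(1)] by simp
  then show ?case using assms(1) by (simp add: jordan_basis_iff)
qed (use assms in simp)

lemma jordan_basis_string_mem:
  assumes "jordan_basis g W L" "l < length L"
  shows "nilpow g k (fst (L ! l)) \<in> W"
proof (rule jordan_basis_nilpow_closed[OF assms(1)])
  have "list_comb g L (\<lambda>l' k. if k = 0 then if l' = l then 1 else 0 else 0) =
      (\<Sum>l'<length L. if l' = l then fst (L ! l) else 0)"
    unfolding string_comb_def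
  proof (intro sum.cong refl)
    fix l' assume "l' \<in> {..<length L}"
    then obtain n where n: "snd (L ! l') = Suc n"
      using jordan_basis_nth(1)[OF assms(1), of l'] gr0_conv_Suc by auto
    show "(\<Sum>k<snd (L ! l'). (if k = 0 then if l' = l then 1 else 0 else 0) *s nilpow g k (fst (L ! l'))) =
        (if l' = l then fst (L ! l) else 0)"
      unfolding n sum.lessThan_Suc_shift by simp
  qed
  also have "\<dots> = fst (L ! l)" using assms(2) by simp
  finally have "fst (L ! l) \<in> range (list_comb g L)" by (metis rangeI)
  then show "fst (L ! l) \<in> W" using assms(1) by (simp add: jordan_basis_iff)
qed

text \<open>\<open>N^n\<close> cuts the first \<open>n\<close> members off every string; truncated
  subtraction accounts for strings of length at most \<open>n\<close>.\<close>

lemma dim_nilpow_image: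
  assumes J: "jordan_basis g W L"
  shows "vec.dim (nilpow g n ` W) = (\<Sum>l<length L. snd (L ! l) - n)"
proof -
  define I where "I = {(l, j). l < length L \<and> j < snd (L ! l)}"
  define b where "b = (\<lambda>(l, j). (nil_part g ^^ j) (fst (L ! l)))"
  define I' where "I' = (SIGMA l:{..<length L}. {n..<snd (L ! l)})"
  have I: "inj_on b I" "vec.independent (b ` I)"
    using J unfolding jordan_basis_def Let_def I_def[symmetric] b_def[symmetric] by auto
  have "I' \<subseteq> I" by (auto simp: I_def I'_def)
  then have inj: "inj_on b I'" and ind: "vec.independent (b ` I')"
    using inj_on_subset[OF I(1)] vec.independent_mono[OF I(2) image_mono] by auto
  have b: "b (l, j) = nilpow g j (fst (L ! l))" for l j by (simp add: b_def nilpow_def)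
  have W: "vec.subspace W" by (rule jordan_basis_subspace[OF J])
  have sub: "vec.subspace (nilpow g n ` W)"
    using W linear_nilpow by (rule vec.linear_subspace_image[rotated])
  have "vec.span (b ` I') = nilpow g n ` W"
  proof
    show "vec.span (b ` I') \<subseteq> nilpow g n ` W"
    proof (rule vec.span_minimal[OF _ sub], clarsimp simp: I'_def)
      fix l j assume l: "l < length L" "n \<le> j" "j < snd (L ! l)"
      then have "b (l, j) = nilpow g n (nilpow g (j - n) (fst (L ! l)))" by (simp add: b)
      then show "b (l, j) \<in> nilpow g n ` W"
        using jordan_basis_string_mem[OF J l(1)] by blast
    qed
    show "nilpow g n ` W \<subseteq> vec.span (b ` I')"
    proof clarify
      fix x assume "x \<in> W"
      then obtain c where x: "x = list_comb g L c" using J by (auto simp: jordan_basis_iff)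
      have "nilpow g (n + k) (fst (L ! l)) \<in> vec.span (b ` I')" if "l < length L" for k l
      proof (cases "n + k < snd (L ! l)")
        case True
        then have "(l, n + k) \<in> I'" using that by (simp add: I'_def)
        from vec.span_base[OF imageI[OF this, of b]] show ?thesis by (simp add: b)
      next
        case False
        then have "nilpow g (n + k) (fst (L ! l)) = 0"
          by (intro nilpow_eq_0_mono[OF jordan_basis_nth(2)[OF J that]]) simp
        then show ?thesis by (simp add: vec.span_zero)
      qed
      then show "nilpow g n x \<in> vec.span (b ` I')"
        unfolding x string_comb_def nilpow_sum nilpow_scale
        by (intro vec.span_sum vec.span_scale) simp
    qed
  qed
  then have "vec.dim (nilpow g n ` W) = card (b ` I')"
    using sub by (intro vec.dim_eq_card ind) (metis vec.span_eq_iff)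
  also have "\<dots> = (\<Sum>l<length L. snd (L ! l) - n)"
    using inj by (simp add: card_image I'_def)
  finally show ?thesis .
qed

lemma sum_nth_eq_sum_list: "(\<Sum>l<length L. f (L ! l)) = sum_list (map f L)"
  by (simp add: sum_list_sum_nth atLeast0LessThan)

text \<open>The truncated function \<open>k - n\<close> of \<open>n\<close> is piecewise linear with
  its only corner at \<open>n = k\<close>, so its second difference at \<open>i\<close> is
  \<open>1\<close> if \<open>k = i\<close> and \<open>0\<close> otherwise. Together with
  \<open>dim_nilpow_image\<close>, block numbers become invariants of the subspace.\<close>

lemma count_list_second_difference:
  fixes ks :: "nat list"
  assumes "0 < i"
  shows "count_list ks i + 2 * (\<Sum>k\<leftarrow>ks. k - i) = (\<Sum>k\<leftarrow>ks. k - (i - 1)) + (\<Sum>k\<leftarrow>ks. k - Suc i)"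
  using assms by (induction ks) auto

lemma count_list_jordan_type_unique:
  assumes "unipotent_jordan_type g W ks" "unipotent_jordan_type g W ks'"
  shows "count_list ks i = count_list ks' i"
proof (cases "i = 0")
  case True
  have "count_list ks 0 = 0" if "unipotent_jordan_type g W ks" for ks
    using that by (fastforce simp: unipotent_jordan_type_def jordan_basis_iff count_list_0_iff)
  then show ?thesis using assms True by simp
next
  case False
  have dim: "(\<Sum>k\<leftarrow>ks. k - n) = vec.dim (nilpow g n ` W)" if "unipotent_jordan_type g W ks" for ks n
  proof -
    obtain L where L: "jordan_basis g W L" "map snd L = ks"
      using \<open>unipotent_jordan_type g W ks\<close> by (auto simp: unipotent_jordan_type_def)
    show ?thesis
      using dim_nilpow_image[OF L(1), of n] sum_nth_eq_sum_list[of "\<lambda>p. snd p - n" L]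
      by (simp add: comp_def flip: L(2))
  qed
  have "count_list ks i + 2 * vec.dim (nilpow g i ` W) =
      count_list ks' i + 2 * vec.dim (nilpow g i ` W)"
    using count_list_second_difference[of i ks] count_list_second_difference[of i ks'] False
    unfolding dim[OF assms(1)] dim[OF assms(2)] by simp
  then show ?thesis by simp
qed

lemma jordan_blocks_eq:
  assumes "unipotent_jordan_type g W ks"
  shows "jordan_blocks g W i = count_list ks i"
  unfolding jordan_blocks_def
proof (rule the_equality)
  show "\<exists>ks'. unipotent_jordan_type g W ks' \<and> count_list ks i = count_list ks' i"
    using assms by blast
  show "c = count_list ks i" if "\<exists>ks'. unipotent_jordan_type g W ks' \<and> c = count_list ks' i" for c
    using that count_list_jordan_type_unique[OF assms] by auto
qed

text \<open>When all strings have length \<open>i\<close>, applying \<open>N^(i-1)\<close> leaves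
  only the coefficients at the generators, moved to the independent ends of the strings.\<close>

lemma homogeneous_type_kernel:
  assumes W: "unipotent_jordan_type g W (replicate a i)" and i: "0 < i"
    and x: "x \<in> W" "nilpow g (i - 1) x = 0"
  shows "\<exists>y \<in> W. x = nilpow g (Suc 0) y"
proof -
  obtain L where J: "jordan_basis g W L" and L: "map snd L = replicate a i"
    using W by (auto simp: unipotent_jordan_type_def)
  have len: "length L = a" using arg_cong[OF L, of length] by simp
  have snd: "snd (L ! l) = i" if "l < length L" for l
    using arg_cong[OF L, of "\<lambda>ks. ks ! l"] that len by simp
  obtain n where n: "i = Suc n" using i gr0_conv_Suc by blast
  obtain c where c: "x = list_comb g L c" using J x by (auto simp: jordan_basis_iff)
  \<comment> \<open>Separates the generators from the image of \<open>N\<close>. The coefficients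
    after the first move down one place and the freed last place \<open>k = n\<close> is filled with
    \<open>0\<close>.\<close>
  have split: "list_comb g L c = (\<Sum>l<length L. c l 0 *s fst (L ! l)) +
      nilpow g (Suc 0) (list_comb g L (\<lambda>l k. if k = n then 0 else c l (Suc k)))" for c
  proof -
    have "list_comb g L c = (\<Sum>l<length L. c l 0 *s fst (L ! l)) +
        (\<Sum>l<length L. \<Sum>k<n. c l (Suc k) *s nilpow g (Suc k) (fst (L ! l)))"
      unfolding string_comb_def sum.distrib[symmetric]
    proof (rule sum.cong[OF refl])
      fix l assume "l \<in> {..<length L}"
      then have "snd (L ! l) = Suc n" using snd n by simp
      then show "(\<Sum>k<snd (L ! l). c l k *s nilpow g k (fst (L ! l))) =
        c l 0 *s fst (L ! l) + (\<Sum>k<n. c l (Suc k) *s nilpow g (Suc k) (fst (L ! l)))"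
        by (simp only: sum.lessThan_Suc_shift) simp
    qed
    also have "(\<Sum>l<length L. \<Sum>k<n. c l (Suc k) *s nilpow g (Suc k) (fst (L ! l))) =
        nilpow g (Suc 0) (list_comb g L (\<lambda>l k. if k = n then 0 else c l (Suc k)))"
      unfolding string_comb_def nilpow_sum nilpow_scale using snd n by simp
    finally show ?thesis .
  qed
  define y where "y = list_comb g L (\<lambda>l k. if k = n then 0 else c l (Suc k))"
  have y: "y \<in> W" using J by (simp add: y_def jordan_basis_iff)
  have "nilpow g i y = 0"
    using unipotent_jordan_type_replicate_nilpotent[OF W y] by (simp add: nilpow_def)
  then have "(\<Sum>l<length L. c l 0 *s nilpow g n (fst (L ! l))) = 0"
    using x(2) split[of c] n
    by (simp add: c y_def[symmetric] nilpow_add nilpow_sum nilpow_scale)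
  moreover have "(\<Sum>l<length L. c l 0 *s nilpow g n (fst (L ! l))) =
      list_comb g L (\<lambda>l k. if k = n then c l 0 else 0)"
    unfolding string_comb_def
    by (intro sum.cong refl) (simp add: snd n if_distrib[of "\<lambda>c. c *s _"] cong: if_cong)
  ultimately have "list_comb g L (\<lambda>l k. if k = n then c l 0 else 0) = 0" by simp
  with J have *: "\<forall>l<length L. \<forall>k<snd (L ! l). (if k = n then c l 0 else 0) = 0"
    unfolding jordan_basis_iff by (elim conjE allE[where x = "\<lambda>l k. if k = n then c l 0 else 0"]) simp
  have "c l 0 = 0" if "l < length L" for l
    using *[rule_format, OF that, of n] snd[OF that] n by simp
  then show ?thesis using split[of c] y by (auto simp: c y_def)
qed

text \<open>Each block contributes the end of its string, so \<open>N^(i-1) W\<close> is a copy of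
  \<open>W / N W\<close> inside \<open>W\<close>, and dimension arguments about the top form can be
  made there.\<close>

lemma homogeneous_type_dim:
  assumes "unipotent_jordan_type g W (replicate a i)" and "0 < i"
  shows "vec.dim (nilpow g (i - 1) ` W) = a"
proof -
  obtain L where J: "jordan_basis g W L" and L: "map snd L = replicate a i"
    using assms by (auto simp: unipotent_jordan_type_def)
  have "vec.dim (nilpow g (i - 1) ` W) = (\<Sum>k\<leftarrow>map snd L. k - (i - 1))"
    using dim_nilpow_image[OF J, of "i - 1"] sum_nth_eq_sum_list[of "\<lambda>p. snd p - (i - 1)" L]
    by (simp add: comp_def)
  then show ?thesis using assms(2) by (simp add: L sum_list_replicate)
qed

lemma sum_lessThan_add:
  "(\<Sum>l<m + n. f l) = (\<Sum>l<m. f l) + (\<Sum>l<n. f (m + l) :: 'b::comm_monoid_add)" for m n :: nat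
  by (induction n) (simp_all add: add.assoc)

lemma jordan_basis_append:
  assumes J: "jordan_basis g W L" "jordan_basis g W' L'" and int: "W \<inter> W' \<subseteq> {0}"
  shows "jordan_basis g {x + y | x y. x \<in> W \<and> y \<in> W'} (L @ L')"
proof -
  have split: "list_comb g (L @ L') c = list_comb g L c + list_comb g L' (\<lambda>l. c (length L + l))" for c
  proof -
    have "list_comb g (L @ L') c =
      (\<Sum>l<length L. \<Sum>k<snd ((L @ L') ! l). c l k *s nilpow g k (fst ((L @ L') ! l))) +
      (\<Sum>l<length L'. \<Sum>k<snd ((L @ L') ! (length L + l)). c (length L + l) k *s
        nilpow g k (fst ((L @ L') ! (length L + l))))"
      unfolding string_comb_def length_append
      by (rule sum_lessThan_add)
    then show ?thesis by (simp add: string_comb_def nth_append)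
  qed
  have "{x + y | x y. x \<in> W \<and> y \<in> W'} = range (list_comb g (L @ L'))"
  proof
    show "range (list_comb g (L @ L')) \<subseteq> {x + y | x y. x \<in> W \<and> y \<in> W'}"
    proof
      fix z assume "z \<in> range (list_comb g (L @ L'))"
      then obtain c where "z = list_comb g (L @ L') c" by (rule rangeE)
      then show "z \<in> {x + y | x y. x \<in> W \<and> y \<in> W'}"
        unfolding split using J by (auto simp: jordan_basis_iff)
    qed
    show "{x + y | x y. x \<in> W \<and> y \<in> W'} \<subseteq> range (list_comb g (L @ L'))"
    proof clarify
      fix x y assume "x \<in> W" "y \<in> W'"
      then obtain c d where cd: "x = list_comb g L c" "y = list_comb g L' d"
        using J by (auto simp: jordan_basis_iff)
      have "list_comb g (L @ L') (\<lambda>l. if l < length L then c l else d (l - length L)) = x + y"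
        unfolding split cd by (intro arg_cong2[where f = "(+)"] string_comb_cong) simp_all
      then show "x + y \<in> range (list_comb g (L @ L'))" by (intro range_eqI) (rule HOL.sym)
    qed
  qed
  moreover have "c l k = 0" if c: "list_comb g (L @ L') c = 0" and l: "l < length (L @ L')"
    and k: "k < snd ((L @ L') ! l)" for c l k
  proof -
    define x y where "x = list_comb g L c" and "y = list_comb g L' (\<lambda>l. c (length L + l))"
    have xy: "x \<in> W" "y \<in> W'" using J by (auto simp: x_def y_def jordan_basis_iff)
    have "x = - y" using c unfolding split x_def y_def by (simp add: eq_neg_iff_add_eq_0)
    then have "x \<in> W'" using vec.subspace_neg[OF jordan_basis_subspace[OF J(2)] xy(2)] by simp
    then have "x = 0" using int xy by auto
    then have "y = 0" using \<open>x = - y\<close> by simp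
    show ?thesis
    proof (cases "l < length L")
      case True
      then show ?thesis
        using J(1) k \<open>x = 0\<close> unfolding x_def jordan_basis_iff by (simp add: nth_append)
    next
      case False
      then have "l - length L < length L'" "k < snd (L' ! (l - length L))"
        using l k by (simp_all add: nth_append)
      moreover have "\<forall>l<length L'. \<forall>k<snd (L' ! l). c (length L + l) k = 0"
        using J(2) \<open>y = 0\<close> unfolding y_def jordan_basis_iff
        by (elim conjE allE[where x = "\<lambda>l. c (length L + l)"]) simp
      ultimately have "c (length L + (l - length L)) k = 0" by blast
      then show ?thesis using False by simp
    qed
  qed
  ultimately show ?thesis
    using J unfolding jordan_basis_iff by auto
qed

section \<open>Values of the top form on a homogeneous block\<close>

text \<open>On nonzero \<open>s\<close> the map to \<open>d * s^2\<close> is two-to-one with fibres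
  \<open>{s, - s}\<close>.\<close>

lemma card_scaled_squares:
  fixes d :: "'a::field"
  assumes fin: "finite (UNIV :: 'a set)" and two: "(2::'a) \<noteq> 0" and d: "d \<noteq> 0"
  shows "card (UNIV :: 'a set) = Suc (2 * card ((\<lambda>s. d * s\<^sup>2) ` (UNIV - {0})))"
proof -
  let ?f = "\<lambda>s. d * s\<^sup>2"
  let ?A = "UNIV - {0} :: 'a set"
  have "card ?A = (\<Sum>y\<in>?f ` ?A. card {x \<in> ?A. ?f x = y})"
    using sum.image_gen[of ?A "\<lambda>_. 1::nat" ?f] fin by simp
  also have "\<dots> = (\<Sum>y\<in>?f ` ?A. 2)"
  proof (rule sum.cong[OF refl])
    fix y assume "y \<in> ?f ` ?A"
    then obtain s where s: "s \<noteq> 0" "y = d * s\<^sup>2" by blast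
    have "{x \<in> ?A. ?f x = y} = {s, - s}"
      using s d by (auto simp: power2_eq_iff)
    moreover have "s \<noteq> - s"
    proof
      assume "s = - s"
      then have "s - (- s) = 0" by (simp only: right_minus_eq)
      then have "2 * s = 0" by simp
      then show False using s two by simp
    qed
    ultimately show "card {x \<in> ?A. ?f x = y} = 2" by simp
  qed
  finally have "card ?A = 2 * card (?f ` ?A)" by simp
  moreover have "card (UNIV :: 'a set) = Suc (card ?A)"
    using fin by (metis UNIV_I card_Suc_Diff1)
  ultimately show ?thesis by metis
qed

text \<open>By counting, the values of \<open>d s\<^sup>2\<close> and those of \<open>c - e t\<^sup>2\<close> cannot be disjoint.\<close>

lemma binary_form_universal:
  fixes c d e :: "'a::field"
  assumes fin: "finite (UNIV :: 'a set)" and two: "(2::'a) \<noteq> 0" and de: "d \<noteq> 0" "e \<noteq> 0"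
  shows "\<exists>s t. d * s\<^sup>2 + e * t\<^sup>2 = c"
proof (rule ccontr)
  assume no: "\<nexists>s t. d * s\<^sup>2 + e * t\<^sup>2 = c"
  let ?S = "\<lambda>d. (\<lambda>s. d * s\<^sup>2) ` (UNIV :: 'a set)"
  \<comment> \<open>Together with zero there are \<open>(q + 1) / 2\<close> values, more than half
    of the field.\<close>
  have card: "card (UNIV :: 'a set) < 2 * card (?S d)" if "d \<noteq> 0" for d :: 'a
  proof -
    have "?S d = insert 0 ((\<lambda>s. d * s\<^sup>2) ` (UNIV - {0}))" by (auto simp: image_iff)
    moreover have "0 \<notin> (\<lambda>s. d * s\<^sup>2) ` (UNIV - {0})" using that by auto
    ultimately have "card (?S d) = Suc (card ((\<lambda>s. d * s\<^sup>2) ` (UNIV - {0})))"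
      using finite_subset[OF subset_UNIV fin] by simp
    then show ?thesis using card_scaled_squares[OF fin two that] by simp
  qed
  have "?S d \<inter> (\<lambda>x. c - x) ` ?S e = {}"
  proof (rule ccontr)
    assume "?S d \<inter> (\<lambda>x. c - x) ` ?S e \<noteq> {}"
    then obtain s t where "d * s\<^sup>2 = c - e * t\<^sup>2" by auto
    then have "d * s\<^sup>2 + e * t\<^sup>2 = c" by simp
    then show False using no by blast
  qed
  then have "card (?S d) + card ((\<lambda>x. c - x) ` ?S e) = card (?S d \<union> (\<lambda>x. c - x) ` ?S e)"
    using finite_subset[OF subset_UNIV fin] by (intro card_Un_disjoint[symmetric]) auto
  also have "\<dots> \<le> card (UNIV :: 'a set)"
    using fin by (intro card_mono) auto
  also have "card ((\<lambda>x. c - x) ` ?S e) = card (?S e)"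
    by (intro card_image) (simp add: inj_on_def)
  finally show False using card[OF de(1)] card[OF de(2)] by simp
qed

section \<open>The top form on the pieces of an orthogonal splitting\<close>

locale orthogonal_blocks = orthogonal_isometry B g
  for B :: "'a::field ^ 'n \<Rightarrow> 'a ^ 'n \<Rightarrow> 'a" and g :: "'a ^ 'n ^ 'n" +
  fixes W :: "nat \<Rightarrow> ('a ^ 'n) set" and a :: "nat \<Rightarrow> nat"
  assumes type: "i \<in> {1..CARD('n)} \<Longrightarrow> unipotent_jordan_type g (W i) (replicate (a i) i)"
    and orth: "i \<in> {1..CARD('n)} \<Longrightarrow> j \<in> {1..CARD('n)} \<Longrightarrow> i \<noteq> j \<Longrightarrow> x \<in> W i \<Longrightarrow> y \<in> W j \<Longrightarrow> B x y = 0"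
    and sums: "{\<Sum>i=1..CARD('n). w i | w. \<forall>i \<in> {1..CARD('n)}. w i \<in> W i} = {x. N (CARD('n)) x = 0}"
    and direct: "(\<And>i. i \<in> {1..CARD('n)} \<Longrightarrow> w i \<in> W i) \<Longrightarrow> (\<Sum>i=1..CARD('n). w i) = 0 \<Longrightarrow>
      i \<in> {1..CARD('n)} \<Longrightarrow> w i = 0"
begin

lemma index_pos: "i \<in> {1..CARD('n)} \<Longrightarrow> 0 < i"
  by simp

lemma W_subspace: "i \<in> {1..CARD('n)} \<Longrightarrow> vec.subspace (W i)"
  using type jordan_basis_subspace unfolding unipotent_jordan_type_def by blast

lemma W_N: "i \<in> {1..CARD('n)} \<Longrightarrow> x \<in> W i \<Longrightarrow> N k x \<in> W i"
  using type jordan_basis_nilpow_closed unfolding unipotent_jordan_type_def by blast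

lemma W_nil: "i \<in> {1..CARD('n)} \<Longrightarrow> x \<in> W i \<Longrightarrow> N i x = 0"
  using unipotent_jordan_type_replicate_nilpotent[OF type] by (simp add: nilpow_def)

lemma W_kernel: "i \<in> {1..CARD('n)} \<Longrightarrow> x \<in> W i \<Longrightarrow> N (i - 1) x = 0 \<Longrightarrow> \<exists>y \<in> W i. x = N (Suc 0) y"
  using homogeneous_type_kernel[OF type index_pos] by blast

lemma W_dim: "i \<in> {1..CARD('n)} \<Longrightarrow> vec.dim (N (i - 1) ` W i) = a i"
  using homogeneous_type_dim[OF type index_pos] .

lemma components:
  assumes "N (CARD('n)) x = 0"
  obtains w where "\<And>i. i \<in> {1..CARD('n)} \<Longrightarrow> w i \<in> W i" "x = (\<Sum>i\<in>{1..CARD('n)}. w i)"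
proof -
  have "x \<in> {\<Sum>i=1..CARD('n). w i | w. \<forall>i \<in> {1..CARD('n)}. w i \<in> W i}"
    unfolding sums using assms by simp
  then show thesis using that by blast
qed

lemma W_unipotent: "i \<in> {1..CARD('n)} \<Longrightarrow> x \<in> W i \<Longrightarrow> N (CARD('n)) x = 0"
  by (rule nilpow_eq_0_mono[OF W_nil]) auto

lemma top_values_eq:
  assumes i: "i \<in> {1..CARD('n)}"
  shows "top_values i = {B w (N (i - 1) w) | w. w \<in> W i \<and> N (i - 1) w \<noteq> 0}" (is "_ = ?R")
proof
  show "?R \<subseteq> top_values i"
  proof clarify
    fix w assume w: "w \<in> W i" "N (i - 1) w \<noteq> 0"
    have "N (i - 1) w \<notin> range (N i)"
    proof
      assume "N (i - 1) w \<in> range (N i)"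
      then obtain u where u: "N (i - 1) w = N i u" by blast
      have "N (CARD('n) + 1) u = 0"
      proof -
        have "N (CARD('n) + i) u = N (CARD('n)) (N (i - 1) w)" unfolding u by simp
        also have "\<dots> = 0" using W_unipotent[OF i W_N[OF i w(1)]] .
        finally show ?thesis
          using ker_N_stable[of i u] nilpow_eq_0_mono[of g "CARD('n)" u "CARD('n) + 1"] by simp
      qed
      then have "N (CARD('n)) u = 0" by (rule ker_N_stable)
      then obtain v where v: "\<And>j. j \<in> {1..CARD('n)} \<Longrightarrow> v j \<in> W j" "u = (\<Sum>j\<in>{1..CARD('n)}. v j)"
        using components by blast
      \<comment> \<open>The component in \<open>W j\<close> of \<open>N^i u - N^(i-1) w\<close>,
        which is zero. Since \<open>N^i\<close> kills \<open>W i\<close>, the component at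
        \<open>i\<close> is just \<open>- N^(i-1) w\<close>.\<close>
      define d where "d j = N i (v j) - (if j = i then N (i - 1) w else 0)" for j
      have "d i = 0"
      proof (rule direct[of d])
        show "d j \<in> W j" if "j \<in> {1..CARD('n)}" for j
          unfolding d_def using W_N v(1) w(1) that W_subspace
          by (auto intro!: vec.subspace_diff simp: vec.subspace_0)
        have "(\<Sum>j\<in>{1..CARD('n)}. d j) = N i u - N (i - 1) w"
          using i by (simp add: d_def v(2) sum_subtractf nilpow_sum)
        then show "(\<Sum>j=1..CARD('n). d j) = 0" using u by simp
      qed (rule i)
      moreover have "N i (v i) = 0" by (rule W_nil[OF i v(1)[OF i]])
      ultimately show False using w by (simp add: d_def)
    qed
    then have "primitive i w" using W_nil[OF i w(1)] by (simp add: primitive_def)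
    then show "B w (N (i - 1) w) \<in> top_values i" unfolding top_values_def by blast
  qed
  show "top_values i \<subseteq> ?R"
  proof
    fix c assume "c \<in> top_values i"
    then obtain x where x: "primitive i x" and c: "c = B x (N (i - 1) x)"
      unfolding top_values_def by blast
    have Nx: "N i x = 0" using x by (simp add: primitive_def)
    then have "N (CARD('n)) x = 0" using i by (intro nilpow_eq_0_mono[OF Nx]) auto
    then obtain w where w: "\<And>j. j \<in> {1..CARD('n)} \<Longrightarrow> w j \<in> W j" "x = (\<Sum>j\<in>{1..CARD('n)}. w j)"
      using components by blast
    have Nw: "N i (w j) = 0" if "j \<in> {1..CARD('n)}" for j
    proof (rule direct[of "\<lambda>j. N i (w j)", OF _ _ that])
      show "(\<Sum>j=1..CARD('n). N i (w j)) = 0" using Nx by (simp add: w(2) nilpow_sum)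
    qed (simp add: W_N w(1))
    have small: "N (i - 1) (w j) = 0" if "j \<in> {1..CARD('n)}" "j < i" for j
      using that by (intro nilpow_eq_0_mono[OF W_nil[OF that(1) w(1)[OF that(1)]]]) auto
    \<comment> \<open>For \<open>j > i\<close>, already \<open>N^i\<close> kills \<open>w j\<close>,
      hence so does \<open>N^(j-1)\<close>, and in a homogeneous piece that kernel is the image of
      \<open>N\<close>. Such components therefore affect neither the top value nor
      primitivity.\<close>
    have large: "\<exists>v. w j = N (Suc 0) v" if "j \<in> {1..CARD('n)}" "i < j" for j
    proof -
      have "N (j - 1) (w j) = 0"
        using that by (intro nilpow_eq_0_mono[OF Nw[OF that(1)]]) auto
      then show ?thesis using W_kernel[OF that(1) w(1)[OF that(1)]] by blast
    qed
    have other: "B (w j) (N (i - 1) (w j)) = 0" if j: "j \<in> {1..CARD('n)}" "j \<noteq> i" for j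
    proof (cases "j < i")
      case False
      then obtain v where v: "w j = N (Suc 0) v" using large[of j] j by auto
      have "B (N (Suc 0) v) (N (i - 1) (w j)) = 0"
        using N_pairing_0[OF Nw[OF j(1)], of "Suc 0" "i - 1" v] i by simp
      then show ?thesis by (simp flip: v)
    qed (simp add: small[OF j(1), simplified])
    have "c = (\<Sum>j\<in>{1..CARD('n)}. \<Sum>k\<in>{1..CARD('n)}. B (w k) (N (i - 1) (w j)))"
      by (simp add: c w(2) nilpow_sum sum_left sum_right)
    also have "\<dots> = (\<Sum>j\<in>{1..CARD('n)}. \<Sum>k\<in>{1..CARD('n)}. if k = j then B (w j) (N (i - 1) (w j)) else 0)"
      using orth w(1) W_N by (intro sum.cong refl) auto
    also have "\<dots> = (\<Sum>j\<in>{1..CARD('n)}. if j = i then B (w i) (N (i - 1) (w i)) else 0)"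
      using other by (intro sum.cong refl) auto
    also have "\<dots> = B (w i) (N (i - 1) (w i))" using i by simp
    finally have "c = B (w i) (N (i - 1) (w i))" .
    moreover have "N (i - 1) (w i) \<noteq> 0"
    proof
      assume 0: "N (i - 1) (w i) = 0"
      have "N (i - 1) (w j) \<in> range (N i)" if j: "j \<in> {1..CARD('n)}" for j
      proof (cases "j \<le> i")
        case True
        then have "N (i - 1) (w j) = N i 0" using small[OF j] 0 by (cases "j = i") auto
        then show ?thesis by blast
      next
        case False
        then obtain v where "w j = N (Suc 0) v" using large[OF j] by auto
        then have "N (i - 1) (w j) = N i v" using index_pos[OF i] by simp
        then show ?thesis by blast
      qed
      then have "N (i - 1) x \<in> range (N i)"
        unfolding w(2) nilpow_sum by (intro vec.subspace_sum subspace_range_nilpow)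
      then show False using x by (simp add: primitive_def)
    qed
    ultimately show "c \<in> ?R" using w(1)[OF i] by blast
  qed
qed

text \<open>Orthogonality to \<open>W i\<close> extends to the whole unipotent space, because the
  other pieces are orthogonal anyway. The vector then lies in both the kernel and the range of
  \<open>N^m\<close>.\<close>

lemma radical:
  assumes i: "i \<in> {1..CARD('n)}" and w: "w \<in> W i" and 0: "\<And>z. z \<in> W i \<Longrightarrow> B z (N (i - 1) w) = 0"
  shows "N (i - 1) w = 0"
proof -
  have "B z (N (i - 1) w) = 0" if z: "N (CARD('n)) z = 0" for z
  proof -
    obtain v where v: "\<And>j. j \<in> {1..CARD('n)} \<Longrightarrow> v j \<in> W j" "z = (\<Sum>j\<in>{1..CARD('n)}. v j)"
      using components[OF z] by blast
    have "B (v j) (N (i - 1) w) = 0" if "j \<in> {1..CARD('n)}" for j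
      using orth[OF that i _ v(1)[OF that] W_N[OF i w]] 0 v(1)[OF that] by (cases "j = i") auto
    then show ?thesis by (simp add: v(2) sum_left)
  qed
  then obtain u where u: "N (i - 1) w = N (CARD('n)) u" using orth_ker_N by blast
  then have "N (CARD('n) + CARD('n)) u = 0" using W_unipotent[OF i W_N[OF i w, of "i - 1"]] by simp
  then show ?thesis using ker_N_stable u by simp
qed

lemma exists_nonzero_top: "i \<in> {1..CARD('n)} \<Longrightarrow> a i \<noteq> 0 \<Longrightarrow> \<exists>w \<in> W i. N (i - 1) w \<noteq> 0"
  using W_dim[of i] vec.dim_eq_0[of "N (i - 1) ` W i"] by auto

lemma top_form_sym:
  "i \<in> {1..CARD('n)} \<Longrightarrow> odd i \<Longrightarrow> y \<in> W i \<Longrightarrow> B y (N (i - 1) x) = B x (N (i - 1) y)"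
  using top_pairing_sym[OF W_nil, of i y x] by (simp add: odd_pos)

text \<open>One step of diagonalization. If every vector orthogonal to \<open>F\<close> is
  isotropic, polarization makes the form vanish on that complement, which is then contained in the
  radical; so the images of \<open>F\<close> span \<open>N^(i-1) W_i\<close>, against
  \<open>card F < a i\<close>.\<close>

lemma orthogonal_extension:
  assumes i: "i \<in> {1..CARD('n)}" "odd i" and F: "finite F" "F \<subseteq> W i" "card F < a i"
    and nz: "\<And>e. e \<in> F \<Longrightarrow> B e (N (i - 1) e) \<noteq> 0"
    and ortho: "\<And>e f. e \<in> F \<Longrightarrow> f \<in> F \<Longrightarrow> e \<noteq> f \<Longrightarrow> B e (N (i - 1) f) = 0"
  shows "\<exists>w \<in> W i. B w (N (i - 1) w) \<noteq> 0 \<and> (\<forall>e\<in>F. B w (N (i - 1) e) = 0)"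
proof (rule ccontr)
  assume no: "\<not> ?thesis"
  define U where "U = {w \<in> W i. \<forall>e\<in>F. B w (N (i - 1) e) = 0}"
  have iso: "B w (N (i - 1) w) = 0" if "w \<in> U" for w
    using no that unfolding U_def by blast
  have U_add: "u + v \<in> U" if "u \<in> U" "v \<in> U" for u v
    using that vec.subspace_add[OF W_subspace[OF i(1)]] by (simp add: U_def add_left)
  have UU: "B u (N (i - 1) v) = 0" if "u \<in> U" "v \<in> U" for u v
  proof -
    have "B v (N (i - 1) u) = B u (N (i - 1) v)"
      using top_form_sym[OF i] that by (simp add: U_def)
    moreover have "B (u + v) (N (i - 1) (u + v)) = B u (N (i - 1) u) + B u (N (i - 1) v) +
        (B v (N (i - 1) u) + B v (N (i - 1) v))"
      by (simp only: bilin nilpow_add ac_simps)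
    ultimately have "2 * B u (N (i - 1) v) = 0"
      using iso[OF that(1)] iso[OF that(2)] iso[OF U_add[OF that]] by (simp only:) simp
    then show ?thesis using two by simp
  qed
  \<comment> \<open>Orthogonal projection onto the span of \<open>F\<close> for the top
    form.\<close>
  define p where "p z = (\<Sum>e\<in>F. (B z (N (i - 1) e) / B e (N (i - 1) e)) *s e)" for z
  have pW: "p z \<in> W i" for z
    unfolding p_def using F W_subspace[OF i(1)]
    by (intro vec.subspace_sum vec.subspace_scale) auto
  have dec: "z - p z \<in> U" if "z \<in> W i" for z
  proof -
    have "B (p z) (N (i - 1) e) = B z (N (i - 1) e)" if "e \<in> F" for e
    proof -
      have "B (p z) (N (i - 1) e) =
        (\<Sum>f\<in>F. (B z (N (i - 1) f) / B f (N (i - 1) f)) * B f (N (i - 1) e))"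
        by (simp add: p_def sum_left scale_left)
      also have "\<dots> = (\<Sum>f\<in>F. if f = e then B z (N (i - 1) e) else 0)"
        using nz ortho that by (intro sum.cong refl) auto
      also have "\<dots> = B z (N (i - 1) e)" using that F(1) by simp
      finally show ?thesis .
    qed
    then show ?thesis
      using vec.subspace_diff[OF W_subspace[OF i(1)] that pW] by (simp add: U_def diff_left)
  qed
  have null: "N (i - 1) u = 0" if u: "u \<in> U" for u
  proof (rule radical[OF i(1)])
    show "u \<in> W i" using u by (simp add: U_def)
    fix z assume z: "z \<in> W i"
    have "B (p z) (N (i - 1) u) = 0"
    proof -
      have "B e (N (i - 1) u) = 0" if "e \<in> F" for e
        using top_form_sym[OF i, of e u] u that F(2) by (auto simp: U_def)
      then show ?thesis by (simp add: p_def sum_left scale_left)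
    qed
    then show "B z (N (i - 1) u) = 0" using UU[OF dec[OF z] u] by (simp add: diff_left)
  qed
  have "N (i - 1) ` W i \<subseteq> vec.span (N (i - 1) ` F)"
  proof clarify
    fix z assume "z \<in> W i"
    then have "N (i - 1) z = N (i - 1) (p z)" using null[OF dec] by (simp add: nilpow_diff)
    also have "\<dots> = (\<Sum>e\<in>F. (B z (N (i - 1) e) / B e (N (i - 1) e)) *s N (i - 1) e)"
      by (simp add: p_def nilpow_sum nilpow_scale)
    also have "\<dots> \<in> vec.span (N (i - 1) ` F)"
      by (intro vec.span_sum vec.span_scale vec.span_base imageI)
    finally show "N (i - 1) z \<in> vec.span (N (i - 1) ` F)" .
  qed
  then have "a i \<le> card (N (i - 1) ` F)"
    unfolding W_dim[OF i(1), symmetric] using F(1) by (intro vec.dim_le_card) auto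
  also have "\<dots> \<le> card F" by (rule card_image_le[OF F(1)])
  finally show False using F(3) by simp
qed

lemma top_values_even:
  assumes i: "i \<in> {1..CARD('n)}" "even i" "a i \<noteq> 0"
  shows "top_values i = {0}"
proof -
  have "B w (N (i - 1) w) = 0" if "w \<in> W i" for w
  proof -
    have "odd (i - 1)" using i by (cases i) auto
    then have "2 * B w (N (i - 1) w) = 0"
      using top_pairing_sym[OF W_nil[OF i(1) that], of w] by simp
    then show ?thesis using two by simp
  qed
  note zero = this
  obtain w where "w \<in> W i" "N (i - 1) w \<noteq> 0" using exists_nonzero_top[OF i(1,3)] by blast
  then show ?thesis
    unfolding top_values_eq[OF i(1)] using zero[of w] zero by fastforce
qed

lemma top_values_empty: "i \<in> {1..CARD('n)} \<Longrightarrow> a i = 0 \<Longrightarrow> top_values i = {}"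
  unfolding top_values_eq using W_dim[of i] vec.dim_eq_0[of "N (i - 1) ` W i"] by fastforce

lemma card_top_values_1:
  assumes fin: "finite (UNIV :: 'a set)" and i: "i \<in> {1..CARD('n)}" "odd i" "a i = 1"
  shows "card (top_values i) = (card (UNIV :: 'a set) - 1) div 2"
proof -
  obtain e where e: "e \<in> W i" "B e (N (i - 1) e) \<noteq> 0"
    using orthogonal_extension[OF i(1,2), of "{}"] i(3) by auto
  define d where "d = B e (N (i - 1) e)"
  have "N (i - 1) e \<noteq> 0" using e by auto
  \<comment> \<open>Both sides have dimension one, so modulo the radical each \<open>w\<close> is a
    multiple \<open>s\<close> of \<open>e\<close> and its value is \<open>d * s^2\<close>.\<close>
  have "vec.span {N (i - 1) e} = N (i - 1) ` W i"
  proof (rule vec.subspace_dim_equal)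
    have sub: "vec.subspace (N (i - 1) ` W i)"
      using W_subspace[OF i(1)] linear_nilpow by (rule vec.linear_subspace_image[rotated])
    show "vec.span {N (i - 1) e} \<subseteq> N (i - 1) ` W i"
      using e by (intro vec.span_minimal sub) auto
    show "vec.subspace (N (i - 1) ` W i)" by (rule sub)
    have "vec.independent {N (i - 1) e}" using \<open>N (i - 1) e \<noteq> 0\<close> by (simp add: vec.dependent_single)
    then have "vec.dim {N (i - 1) e} = 1" by (simp add: vec.dim_eq_card_independent)
    then show "vec.dim (N (i - 1) ` W i) \<le> vec.dim (vec.span {N (i - 1) e})"
      using W_dim[OF i(1)] i(3) by (simp add: vec.dim_span)
  qed simp
  then have line: "\<exists>s. N (i - 1) w = s *s N (i - 1) e" if "w \<in> W i" for w
    using that by (metis imageI vec.span_singleton rangeE)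
  have val: "B w (N (i - 1) w) = d * s\<^sup>2" if "w \<in> W i" "N (i - 1) w = s *s N (i - 1) e" for w s
  proof -
    have "B w (N (i - 1) w) = s * B w (N (i - 1) e)" using that(2) by (simp add: scale_right)
    also have "B w (N (i - 1) e) = B e (N (i - 1) w)" by (rule top_form_sym[OF i(1,2) that(1)])
    also have "\<dots> = s * d" using that(2) by (simp add: scale_right d_def)
    finally show ?thesis by (simp add: power2_eq_square)
  qed
  have "top_values i = (\<lambda>s. d * s\<^sup>2) ` (UNIV - {0})"
    unfolding top_values_eq[OF i(1)]
  proof
    show "{B w (N (i - 1) w) |w. w \<in> W i \<and> N (i - 1) w \<noteq> 0} \<subseteq> (\<lambda>s. d * s\<^sup>2) ` (UNIV - {0})"
    proof clarify
      fix w assume w: "w \<in> W i" "N (i - 1) w \<noteq> 0"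
      obtain s where s: "N (i - 1) w = s *s N (i - 1) e" using line[OF w(1)] by blast
      then have "s \<noteq> 0" using w by auto
      then show "B w (N (i - 1) w) \<in> (\<lambda>s. d * s\<^sup>2) ` (UNIV - {0})"
        using val[OF w(1) s] by auto
    qed
    show "(\<lambda>s. d * s\<^sup>2) ` (UNIV - {0}) \<subseteq> {B w (N (i - 1) w) |w. w \<in> W i \<and> N (i - 1) w \<noteq> 0}"
    proof clarify
      fix s :: 'a assume "s \<noteq> 0"
      define w where "w = s *s e"
      have w: "w \<in> W i" "N (i - 1) w = s *s N (i - 1) e"
        using vec.subspace_scale[OF W_subspace[OF i(1)] e(1)] by (simp_all add: w_def nilpow_scale)
      then have "N (i - 1) w \<noteq> 0" using \<open>s \<noteq> 0\<close> \<open>N (i - 1) e \<noteq> 0\<close> by simp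
      then show "\<exists>w. d * s\<^sup>2 = B w (N (i - 1) w) \<and> w \<in> W i \<and> N (i - 1) w \<noteq> 0"
        using val[OF w] w(1) by metis
    qed
  qed
  then show ?thesis using card_scaled_squares[OF fin two, of d] e by (simp add: d_def)
qed

lemma nonzero_top_values:
  assumes fin: "finite (UNIV :: 'a set)" and i: "i \<in> {1..CARD('n)}" "odd i" "2 \<le> a i"
  shows "UNIV - {0} \<subseteq> top_values i" and "3 \<le> a i \<Longrightarrow> 0 \<in> top_values i"
proof -
  let ?b = "\<lambda>x y. B x (N (i - 1) y)"
  obtain e where e: "e \<in> W i" "?b e e \<noteq> 0"
    using orthogonal_extension[OF i(1,2), of "{}"] i(3) by auto
  obtain f where f: "f \<in> W i" "?b f f \<noteq> 0" "?b f e = 0"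
    using orthogonal_extension[OF i(1,2), of "{e}"] i(3) e by auto
  have fe: "?b e f = 0" using top_form_sym[OF i(1,2) e(1), of f] f by simp
  have comb: "s *s e + t *s f \<in> W i" for s t
    using W_subspace[OF i(1)] e f by (intro vec.subspace_add vec.subspace_scale)
  have val: "?b (s *s e + t *s f) (s *s e + t *s f) = ?b e e * s\<^sup>2 + ?b f f * t\<^sup>2" for s t
    using fe f(3) by (simp add: bilin Nlin power2_eq_square algebra_simps)
  show "UNIV - {0} \<subseteq> top_values i"
  proof
    fix c :: 'a assume c: "c \<in> UNIV - {0}"
    obtain s t where st: "?b e e * s\<^sup>2 + ?b f f * t\<^sup>2 = c"
      using binary_form_universal[OF fin two e(2) f(2)] by blast
    define w where "w = s *s e + t *s f"
    have "?b w w = c" unfolding w_def val st ..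
    moreover have "w \<in> W i" unfolding w_def by (rule comb)
    moreover have "N (i - 1) w \<noteq> 0" using calculation(1) c by auto
    ultimately show "c \<in> top_values i" unfolding top_values_eq[OF i(1)] by blast
  qed
  show "0 \<in> top_values i" if "3 \<le> a i"
  proof -
    have "e \<noteq> f" using e f by auto
    then obtain h where h: "h \<in> W i" "?b h h \<noteq> 0" "?b h e = 0" "?b h f = 0"
      using orthogonal_extension[OF i(1,2), of "{e, f}"] \<open>3 \<le> a i\<close> e f fe
      by (auto simp: all_conj_distrib)
    have eh: "?b e h = 0" "?b f h = 0"
      using top_form_sym[OF i(1,2) e(1), of h] top_form_sym[OF i(1,2) f(1), of h] h by auto
    \<comment> \<open>The binary form takes the value opposite to that of the third orthogonal
      vector \<open>h\<close>, so the sum with \<open>h\<close> is isotropic. It is nontrivial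
      because it still pairs with \<open>h\<close>.\<close>
    obtain s t where st: "?b e e * s\<^sup>2 + ?b f f * t\<^sup>2 = - ?b h h"
      using binary_form_universal[OF fin two e(2) f(2)] by blast
    define z where "z = s *s e + t *s f"
    define w where "w = z + h"
    have zh: "?b z h = 0" "?b h z = 0"
      using eh h by (simp_all add: z_def bilin Nlin)
    have "?b z z = - ?b h h" unfolding z_def val st ..
    then have "?b w w = 0" using zh by (simp add: w_def bilin Nlin)
    moreover have "w \<in> W i"
      unfolding w_def z_def by (rule vec.subspace_add[OF W_subspace[OF i(1)] comb h(1)])
    moreover have "N (i - 1) w \<noteq> 0"
    proof
      assume "N (i - 1) w = 0"
      then have "?b h w = 0" by simp
      then show False using zh h by (simp add: w_def bilin Nlin)
    qed
    ultimately show ?thesis unfolding top_values_eq[OF i(1)] by force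
  qed
qed

lemma card_top_values_odd:
  assumes fin: "finite (UNIV :: 'a set)" and i: "i \<in> {1..CARD('n)}" "odd i" "a i \<noteq> 0"
  shows "card (top_values i) =
    (if a i > 2 then card (UNIV :: 'a set)
     else if a i = 2 then (if \<exists>w \<in> W i. N (i - 1) w \<noteq> 0 \<and> B w (N (i - 1) w) = 0
       then card (UNIV :: 'a set) else card (UNIV :: 'a set) - 1)
     else (card (UNIV :: 'a set) - 1) div 2)"
proof -
  have zero: "0 \<in> top_values i \<longleftrightarrow> (\<exists>w \<in> W i. N (i - 1) w \<noteq> 0 \<and> B w (N (i - 1) w) = 0)"
    unfolding top_values_eq[OF i(1)] by force
  consider "a i = 1" | "2 \<le> a i" "0 \<in> top_values i" | "2 \<le> a i" "0 \<notin> top_values i"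
    using i(3) by linarith
  then show ?thesis
  proof cases
    case 1
    then show ?thesis using card_top_values_1[OF fin i(1,2)] by simp
  next
    case 2
    then have "top_values i = UNIV" using nonzero_top_values(1)[OF fin i(1,2)] by blast
    then show ?thesis using 2 zero by auto
  next
    case 3
    have "top_values i = UNIV - {0}"
      using nonzero_top_values(1)[OF fin i(1,2) 3(1)] 3(2) by blast
    then have "card (top_values i) = card (UNIV :: 'a set) - 1"
      using fin by (simp add: card_Diff_singleton)
    moreover have "\<not> 3 \<le> a i"
      using nonzero_top_values(2)[OF fin i(1,2) 3(1)] 3(2) by blast
    then have "a i = 2" using 3(1) by linarith
    moreover have no: "\<not> (\<exists>w \<in> W i. N (i - 1) w \<noteq> 0 \<and> B w (N (i - 1) w) = 0)"
      using 3(2) zero by blast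
    ultimately show ?thesis by (simp only: no less_irrefl if_False refl if_True)
  qed
qed

end

section \<open>Existence of the block decomposition\<close>

lemma string_comb_cong_strings:
  "(\<And>l. l < r \<Longrightarrow> K l = K' l \<and> v l = v' l) \<Longrightarrow> string_comb g r K v c = string_comb g r K' v' c"
  by (simp add: string_comb_def)

lemma count_list_replicate_self: "count_list (replicate n x) x = n"
  by (induction n) auto

lemma jordan_basis_Nil: "jordan_basis g {0} []"
proof -
  have "range (list_comb g []) = {0}" by (auto simp: string_comb_def)
  then show ?thesis by (simp add: jordan_basis_iff)
qed

context orthogonal_isometry
begin

lemma jordan_basis_dual_strings:
  assumes D: "dual_strings r i u x" and i: "0 < i"
  shows "jordan_basis g (range (string_comb g r (\<lambda>_. i) x)) (map (\<lambda>l. (x l, i)) [0..<r])"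
proof -
  let ?L = "map (\<lambda>l. (x l, i)) [0..<r]"
  have comb: "list_comb g ?L c = string_comb g r (\<lambda>_. i) x c" for c
    by (simp, rule string_comb_cong_strings) simp
  have "c l k = 0" if "list_comb g ?L c = 0" "l < length ?L" "k < snd (?L ! l)" for c l k
  proof (rule dual_strings_independent[OF D])
    show "B (N j (u l)) (string_comb g r (\<lambda>_. i) x c) = 0" for j l
      using that(1) unfolding comb by simp
  qed (use that in simp_all)
  moreover have "range (list_comb g ?L) = range (string_comb g r (\<lambda>_. i) x)"
    by (intro image_cong refl comb)
  ultimately show ?thesis
    using D i unfolding jordan_basis_iff by (auto simp: dual_strings_def)
qed

text \<open>One string suffices if the form \<open>B x (N\<^sup>i\<^sup>-\<^sup>1 y)\<close> has a non-isotropic vector; otherwise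
  two strings paired with each other are needed.\<close>

lemma exists_self_dual_strings:
  assumes U: "vec.subspace U" "\<And>x k. x \<in> U \<Longrightarrow> N k x \<in> U"
    and nondeg_U: "\<And>x. x \<in> U \<Longrightarrow> (\<And>y. y \<in> U \<Longrightarrow> B x y = 0) \<Longrightarrow> x = 0"
    and nil: "\<And>x. x \<in> U \<Longrightarrow> N i x = 0" and x0: "x0 \<in> U" "N (i - 1) x0 \<noteq> 0"
  obtains r u x where "dual_strings r i u x" "0 < r" "\<And>l. l < r \<Longrightarrow> x l \<in> U"
    "x ` {..<r} = u ` {..<r}"
proof (cases "\<exists>x\<in>U. B x (N (i - 1) x) \<noteq> 0")
  case True
  then obtain x where x: "x \<in> U" "B x (N (i - 1) x) \<noteq> 0" by blast
  show thesis
    by (rule that[of 1 "\<lambda>_. x" "\<lambda>_. x"]) (use x nil in \<open>simp_all add: dual_strings_def\<close>)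
next
  case False
  then have iso: "B x (N (i - 1) x) = 0" if "x \<in> U" for x using that by blast
  have "\<not> (\<forall>y\<in>U. B (N (i - 1) x0) y = 0)" using nondeg_U[of "N (i - 1) x0"] U(2) x0 by blast
  then obtain y where y: "y \<in> U" "B y (N (i - 1) x0) \<noteq> 0" by (metis sym)
  have "B x0 (N (i - 1) y) \<noteq> 0"
    using top_pairing_sym[OF nil[OF x0(1)], of y] y(2) by simp
  \<comment> \<open>Crossing the two vectors puts their mutual pairing on the diagonal; the entries
    off the diagonal are top values of single vectors, zero by \<open>iso\<close>.\<close>
  then have "dual_strings 2 i (\<lambda>l. if l = 0 then y else x0) (\<lambda>l. if l = 0 then x0 else y)"
    using y x0 nil iso unfolding dual_strings_def by (simp add: less_2_cases_iff)
  moreover have "(\<lambda>l. if l = 0 then x0 else y) ` {..<2::nat} = (\<lambda>l. if l = 0 then y else x0) ` {..<2::nat}"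
    by (auto simp: numeral_2_eq_2 lessThan_Suc)
  ultimately show thesis using that[of 2] x0 y by simp
qed

text \<open>The strings are recorded in \<open>L\<close>, so that a Jordan basis of the whole space
  arises by concatenation and the block numbers can be read off. Directness on the unipotent space
  comes afterwards from nondegeneracy.\<close>

definition orthogonal_type_decomposition ::
    "('a ^ 'n) set \<Rightarrow> (nat \<Rightarrow> ('a ^ 'n) set) \<Rightarrow> (nat \<Rightarrow> (('a ^ 'n) \<times> nat) list) \<Rightarrow> bool" where
  "orthogonal_type_decomposition U W L \<longleftrightarrow>
    (\<forall>i\<in>{1..CARD('n)}. jordan_basis g (W i) (L i) \<and> (\<forall>p\<in>set (L i). snd p = i)) \<and>
    (\<forall>i\<in>{1..CARD('n)}. \<forall>j\<in>{1..CARD('n)}. i \<noteq> j \<longrightarrow> (\<forall>x\<in>W i. \<forall>y\<in>W j. B x y = 0)) \<and>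
    {\<Sum>i=1..CARD('n). w i | w. \<forall>i\<in>{1..CARD('n)}. w i \<in> W i} = U"

lemma orthogonal_type_decomposition_sums:
  "orthogonal_type_decomposition U W L \<Longrightarrow>
    {\<Sum>i=1..CARD('n). w i | w. \<forall>i\<in>{1..CARD('n)}. w i \<in> W i} = U"
  by (simp only: orthogonal_type_decomposition_def)

lemma orthogonal_type_decomposition_basis:
  "orthogonal_type_decomposition U W L \<Longrightarrow> i \<in> {1..CARD('n)} \<Longrightarrow> jordan_basis g (W i) (L i)"
  unfolding orthogonal_type_decomposition_def by (elim conjE) (drule (1) bspec, erule conjunct1)

lemma orthogonal_type_decomposition_orth:
  assumes "orthogonal_type_decomposition U W L" "i \<in> {1..CARD('n)}" "j \<in> {1..CARD('n)}" "i \<noteq> j"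
    and "x \<in> W i" "y \<in> W j"
  shows "B x y = 0"
  using assms(1)[unfolded orthogonal_type_decomposition_def, THEN conjunct2, THEN conjunct1,
      rule_format, OF assms(2-6)] .

lemma orthogonal_type_decomposition_mem:
  assumes D: "orthogonal_type_decomposition U W L" and j: "j \<in> {1..CARD('n)}" and x: "x \<in> W j"
  shows "x \<in> U"
proof -
  have sub: "vec.subspace (W i)" if "i \<in> {1..CARD('n)}" for i
    using jordan_basis_subspace[OF orthogonal_type_decomposition_basis[OF D that]] .
  have "(\<Sum>i=1..CARD('n). if i = j then x else 0) = x" using j by simp
  moreover have "\<forall>i\<in>{1..CARD('n)}. (if i = j then x else 0) \<in> W i"
    using x vec.subspace_0[OF sub] by simp
  ultimately have "x \<in> {\<Sum>i=1..CARD('n). w i | w. \<forall>i\<in>{1..CARD('n)}. w i \<in> W i}"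
    by (intro CollectI exI[of _ "\<lambda>i. if i = j then x else 0"]) simp
  then show ?thesis unfolding orthogonal_type_decomposition_sums[OF D] .
qed

text \<open>New strings of length \<open>i\<close> enlarge only \<open>W i\<close>, and its
  orthogonality to the other pieces survives because these lie in \<open>U'\<close>.\<close>

lemma orthogonal_type_decomposition_extend:
  assumes D: "orthogonal_type_decomposition U' W L" and i: "i \<in> {1..CARD('n)}"
    and X: "jordan_basis g X LX" "\<And>p. p \<in> set LX \<Longrightarrow> snd p = i"
    and int: "U' \<inter> X \<subseteq> {0}" and perp: "\<And>x z. x \<in> X \<Longrightarrow> z \<in> U' \<Longrightarrow> B x z = 0"
  shows "orthogonal_type_decomposition {x + z | x z. x \<in> X \<and> z \<in> U'}
    (W(i := {y + x | y x. y \<in> W i \<and> x \<in> X})) (L(i := L i @ LX))"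
proof -
  note mem = orthogonal_type_decomposition_mem[OF D]
  note D' = D[unfolded orthogonal_type_decomposition_def]
  define W' where "W' = W(i := {y + x | y x. y \<in> W i \<and> x \<in> X})"
  have "W i \<inter> X \<subseteq> {0}" using mem[OF i] int by blast
  then have Ji: "jordan_basis g {y + x | y x. y \<in> W i \<and> x \<in> X} (L i @ LX)"
    by (intro jordan_basis_append X orthogonal_type_decomposition_basis[OF D i])
  have W'j: "W' j = W j" if "j \<noteq> i" for j using that by (simp add: W'_def)
  have W'i: "W' i = {y + x | y x. y \<in> W i \<and> x \<in> X}" by (simp add: W'_def)
  have o: "B x y = 0" if j: "j \<in> {1..CARD('n)}" "j \<noteq> i" "x \<in> W' i" "y \<in> W j" for x y j
  proof -
    obtain a b where ab: "x = a + b" "a \<in> W i" "b \<in> X" using j(3) unfolding W'i by blast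
    have "B a y = 0"
      using j(2) by (intro orthogonal_type_decomposition_orth[OF D i j(1) _ ab(2) j(4)]) simp
    moreover have "B b y = 0" using perp[OF ab(3) mem[OF j(1,4)]] .
    ultimately show ?thesis by (simp add: ab add_left)
  qed
  have orth: "B x y = 0" if jk: "j \<in> {1..CARD('n)}" "k \<in> {1..CARD('n)}" "j \<noteq> k" "x \<in> W' j" "y \<in> W' k" for j k x y
  proof -
    consider "j = i" | "k = i" | "j \<noteq> i" "k \<noteq> i" by blast
    then show ?thesis
    proof cases
      case 1
      then show ?thesis using o[of k x y] jk W'j[of k] by simp
    next
      case 2
      then show ?thesis using o[of j y x] jk W'j[of j] sym[of x y] by simp
    next
      case 3
      then have "x \<in> W j" "y \<in> W k" using jk W'j by auto
      then show ?thesis by (rule orthogonal_type_decomposition_orth[OF D jk(1-3)])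
    qed
  qed
  have "{\<Sum>i=1..CARD('n). w i | w. \<forall>i\<in>{1..CARD('n)}. w i \<in> W' i} = {x + z | x z. x \<in> X \<and> z \<in> U'}"
  proof
    show "{\<Sum>i=1..CARD('n). w i | w. \<forall>i\<in>{1..CARD('n)}. w i \<in> W' i} \<subseteq> {x + z | x z. x \<in> X \<and> z \<in> U'}"
    proof clarify
      fix w assume w: "\<forall>i\<in>{1..CARD('n)}. w i \<in> W' i"
      then have "w i \<in> W' i" using i by blast
      then obtain a b where ab: "w i = a + b" "a \<in> W i" "b \<in> X" unfolding W'i by blast
      define v where "v = w(i := a)"
      have "v j \<in> W j" if "j \<in> {1..CARD('n)}" for j
        using bspec[OF w that] W'j[of j] ab by (auto simp: v_def)
      then have "(\<Sum>j=1..CARD('n). v j) \<in> U'"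
        unfolding orthogonal_type_decomposition_sums[OF D, symmetric] by blast
      moreover have "(\<Sum>j=1..CARD('n). w j) = b + (\<Sum>j=1..CARD('n). v j)"
      proof -
        have "(\<Sum>j=1..CARD('n). w j) = (\<Sum>j=1..CARD('n). v j + (if j = i then b else 0))"
          by (intro sum.cong refl) (simp add: v_def ab)
        then show ?thesis using i by (simp add: sum.distrib)
      qed
      ultimately show "\<exists>x z. (\<Sum>j=1..CARD('n). w j) = x + z \<and> x \<in> X \<and> z \<in> U'" using ab by blast
    qed
    show "{x + z | x z. x \<in> X \<and> z \<in> U'} \<subseteq> {\<Sum>i=1..CARD('n). w i | w. \<forall>i\<in>{1..CARD('n)}. w i \<in> W' i}"
    proof clarify
      fix x z assume x: "x \<in> X" and "z \<in> U'"
      then have "z \<in> {\<Sum>i=1..CARD('n). w i | w. \<forall>i\<in>{1..CARD('n)}. w i \<in> W i}" unfolding orthogonal_type_decomposition_sums[OF D] by simp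
      then obtain w where w: "z = (\<Sum>j=1..CARD('n). w j)" "\<forall>j\<in>{1..CARD('n)}. w j \<in> W j" by blast
      have "x + z = (\<Sum>j=1..CARD('n). w j + (if j = i then x else 0))"
        using i by (simp add: w sum.distrib)
      moreover have "\<forall>j\<in>{1..CARD('n)}. w j + (if j = i then x else 0) \<in> W' j"
      proof
        fix j assume j: "j \<in> {1..CARD('n)}"
        have "w i + x \<in> W' i" unfolding W'i using bspec[OF w(2) i] x by blast
        then show "w j + (if j = i then x else 0) \<in> W' j"
          using bspec[OF w(2) j] W'j[of j] by auto
      qed
      ultimately show "\<exists>w. x + z = (\<Sum>i=1..CARD('n). w i) \<and> (\<forall>i\<in>{1..CARD('n)}. w i \<in> W' i)" by blast
    qed
  qed
  then show ?thesis
    unfolding orthogonal_type_decomposition_def W'_def[symmetric]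
    using orth D' Ji X(2) W'i W'j by auto
qed

lemma exists_orthogonal_type_decomposition:
  assumes "vec.subspace U" "\<And>x k. x \<in> U \<Longrightarrow> N k x \<in> U" "\<And>x. x \<in> U \<Longrightarrow> N (CARD('n)) x = 0"
    and "\<And>x. x \<in> U \<Longrightarrow> (\<And>y. y \<in> U \<Longrightarrow> B x y = 0) \<Longrightarrow> x = 0"
  shows "\<exists>W L. orthogonal_type_decomposition U W L"
  using assms
proof (induction "vec.dim U" arbitrary: U rule: less_induct)
  case less
  note U = less.prems
  show ?case
  proof (cases "U \<subseteq> {0}")
    case True
    then have U0: "U = {0}" using vec.subspace_0[OF U(1)] by blast
    have "{\<Sum>i=1..CARD('n). w i | w. \<forall>i\<in>{1..CARD('n)}. w i \<in> {0 :: 'a ^ 'n}} = {0}"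
    proof
      show "{0} \<subseteq> {\<Sum>i=1..CARD('n). w i | w. \<forall>i\<in>{1..CARD('n)}. w i \<in> {0 :: 'a ^ 'n}}"
        by (intro subsetI CollectI exI[of _ "\<lambda>_. 0"]) simp
    qed auto
    then have "orthogonal_type_decomposition U (\<lambda>_. {0}) (\<lambda>_. [])"
      unfolding orthogonal_type_decomposition_def U0 by (simp add: jordan_basis_Nil)
    then show ?thesis by blast
  next
    case False
    \<comment> \<open>The nilpotency index on \<open>U\<close>: \<open>N^i\<close> kills all of
      \<open>U\<close>, while some vector has a nonzero image under \<open>N^(i-1)\<close>, as
      needed for dual strings.\<close>
    define i where "i = (LEAST i. \<forall>x\<in>U. N i x = 0)"
    have m: "\<forall>x\<in>U. N (CARD('n)) x = 0" using U(3) by blast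
    have nil: "N i x = 0" if "x \<in> U" for x
      using LeastI[of "\<lambda>i. \<forall>x\<in>U. N i x = 0", OF m] that by (simp add: i_def)
    have i_le: "i \<le> k" if "\<forall>x\<in>U. N k x = 0" for k
      unfolding i_def by (rule Least_le) (rule that)
    have i0: "0 < i" using nil False by (cases i) auto
    have i: "i \<in> {1..CARD('n)}" using i_le[OF m] i0 by simp
    have "\<not> (\<forall>x\<in>U. N (i - 1) x = 0)"
    proof
      assume "\<forall>x\<in>U. N (i - 1) x = 0"
      then have "i \<le> i - 1" by (rule i_le)
      then show False using i0 by simp
    qed
    then obtain x0 where x0: "x0 \<in> U" "N (i - 1) x0 \<noteq> 0" by blast
    obtain r u x where D: "dual_strings r i u x" and r: "0 < r" and x: "\<And>l. l < r \<Longrightarrow> x l \<in> U"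
      and xu: "x ` {..<r} = u ` {..<r}"
      using exists_self_dual_strings[OF U(1,2,4) nil x0] by blast
    define X where "X = range (string_comb g r (\<lambda>_. i) x)"
    \<comment> \<open>Since \<open>x\<close> and \<open>u\<close> run through the same vectors, this
      is the orthogonal complement in \<open>U\<close> of the strings spanning
      \<open>X\<close>.\<close>
    define U' where "U' = {z \<in> U. \<forall>j. \<forall>l<r. B (N j (u l)) z = 0}"
    have u_nil: "N i (u l) = 0" if "l < r" for l using D that by (simp add: dual_strings_def)
    have XU: "y \<in> U" if "y \<in> X" for y
      using that x U(1,2) unfolding X_def string_comb_def
      by (auto intro!: vec.subspace_sum vec.subspace_scale)
    have U'U: "U' \<subseteq> U" by (auto simp: U'_def)
    have perp: "B y z = 0" if "y \<in> X" "z \<in> U'" for y z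
    proof -
      have "B (N k (x l)) z = 0" if "l < r" for k l
      proof -
        have "x l \<in> u ` {..<r}" using that xu by blast
        then show ?thesis using \<open>z \<in> U'\<close> by (auto simp: U'_def)
      qed
      then show ?thesis
        using \<open>y \<in> X\<close> by (auto simp: X_def string_comb_def sum_left scale_left)
    qed
    have int: "U' \<inter> X \<subseteq> {0}"
    proof
      fix z assume z: "z \<in> U' \<inter> X"
      then obtain c where c: "z = string_comb g r (\<lambda>_. i) x c" by (auto simp: X_def)
      have zU: "z \<in> U'" using z by blast
      have "c l k = 0" if lk: "l < r" "k < i" for l k
      proof (rule dual_strings_independent[OF D _ lk])
        show "B (N j (u l)) (string_comb g r (\<lambda>_. i) x c) = 0" if "l < r" for j l
          using zU that unfolding c[symmetric] U'_def by blast
      qed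
      then show "z \<in> {0}" unfolding c by (simp add: string_comb_0)
    qed
    have decomp: "U = {y + z | y z. y \<in> X \<and> z \<in> U'}"
    proof
      show "{y + z | y z. y \<in> X \<and> z \<in> U'} \<subseteq> U"
        using XU U'U vec.subspace_add[OF U(1)] by auto
      show "U \<subseteq> {y + z | y z. y \<in> X \<and> z \<in> U'}"
      proof
        fix z assume z: "z \<in> U"
        obtain c where c: "\<forall>j<i. \<forall>l<r. B (N j (u l)) (z - string_comb g r (\<lambda>_. i) x c) = 0"
          using dual_strings_decomp[OF D] by blast
        define y where "y = string_comb g r (\<lambda>_. i) x c"
        have y: "y \<in> X" by (simp add: y_def X_def)
        have "B (N j (u l)) (z - y) = 0" if "l < r" for j l
          using c that nilpow_eq_0_mono[OF u_nil[OF that], of j]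
          by (cases "j < i") (auto simp: y_def)
        then have "z - y \<in> U'" using vec.subspace_diff[OF U(1) z XU[OF y]] by (simp add: U'_def)
        moreover have "z = y + (z - y)" by simp
        ultimately show "z \<in> {y + z | y z. y \<in> X \<and> z \<in> U'}" using y by blast
      qed
    qed
    have "\<exists>W L. orthogonal_type_decomposition U' W L"
    proof (rule less.hyps)
      show U': "vec.subspace U'"
        using U(1) unfolding vec.subspace_def U'_def by (simp add: add_right scale_right)
      \<comment> \<open>The string of \<open>u 0\<close> pairs nontrivially with \<open>x 0\<close>,
        so the complement is proper and the dimension drops.\<close>
      have "x 0 \<notin> U'"
      proof
        assume "x 0 \<in> U'"
        then have "B (x 0) (N (i - 1) (u 0)) = 0" using r sym by (simp add: U'_def)
        then have "B (u 0) (N (i - 1) (x 0)) = 0"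
          using top_pairing_sym[OF u_nil[OF r], of "x 0"] by simp
        then show False using D r by (simp add: dual_strings_def)
      qed
      then have "U' \<subset> U" using U'U x[OF r] by blast
      then show "vec.dim U' < vec.dim U"
        using U' U(1) by (intro vec.dim_psubset) (metis vec.span_eq_iff)
      show "N k z \<in> U'" if z: "z \<in> U'" for z k
      proof -
        have "B (N j (u l)) (N k z) = 0" if "l < r" for j l
        proof -
          have "B z (N b (u l)) = 0" for b using z that by (simp add: U'_def sym[of z])
          then have "B (N k z) (N j (u l)) = 0"
            by (intro N_pairing_vanish[OF u_nil[OF that], of 0]) simp_all
          then show ?thesis by (simp add: sym[of _ "N k z"])
        qed
        then show ?thesis using U(2) z by (simp add: U'_def)
      qed
      show "N (CARD('n)) z = 0" if "z \<in> U'" for z using U(3) U'U that by blast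
      show "z = 0" if z: "z \<in> U'" "\<And>y. y \<in> U' \<Longrightarrow> B z y = 0" for z
      proof (rule U(4))
        show "z \<in> U" using z U'U by blast
        fix y assume "y \<in> U"
        then obtain a b where "y = a + b" "a \<in> X" "b \<in> U'" unfolding decomp by blast
        then show "B z y = 0" using z(2) perp[OF _ z(1)] by (simp add: add_right sym[of z a])
      qed
    qed
    then obtain W L where WL: "orthogonal_type_decomposition U' W L" by blast
    have "jordan_basis g X (map (\<lambda>l. (x l, i)) [0..<r])"
      unfolding X_def by (rule jordan_basis_dual_strings[OF D i0])
    from orthogonal_type_decomposition_extend[OF WL i this _ int perp]
    show ?thesis unfolding decomp[symmetric] by fastforce
  qed
qed

section \<open>Directness and Jordan type of the splitting\<close>

lemma nondegenerate_unipotent: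
  assumes x: "N (CARD('n)) x = 0" and orth: "\<And>z. N (CARD('n)) z = 0 \<Longrightarrow> B x z = 0"
  shows "x = 0"
proof -
  have "x \<in> range (N (CARD('n)))" by (rule orth_ker_N) (metis orth sym)
  then obtain u where u: "x = N (CARD('n)) u" by blast
  then have "N (CARD('n) + CARD('n)) u = 0" using x by simp
  then show ?thesis using ker_N_stable u by simp
qed

lemma orthogonal_type_decomposition_direct:
  assumes D: "orthogonal_type_decomposition {x. N (CARD('n)) x = 0} W L"
    and w: "\<And>i. i \<in> {1..CARD('n)} \<Longrightarrow> w i \<in> W i" and 0: "(\<Sum>i=1..CARD('n). w i) = 0"
    and j: "j \<in> {1..CARD('n)}"
  shows "w j = 0"
proof (rule nondegenerate_unipotent)
  show "N (CARD('n)) (w j) = 0"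
    using orthogonal_type_decomposition_mem[OF D j w[OF j]] by simp
  fix z assume "N (CARD('n)) z = 0"
  then have "z \<in> {\<Sum>i=1..CARD('n). w i | w. \<forall>i\<in>{1..CARD('n)}. w i \<in> W i}"
    unfolding orthogonal_type_decomposition_sums[OF D] by simp
  then obtain v where v: "z = (\<Sum>i=1..CARD('n). v i)" "\<forall>i\<in>{1..CARD('n)}. v i \<in> W i" by blast
  note o = orthogonal_type_decomposition_orth[OF D]
  have "B (w j) z = (\<Sum>i=1..CARD('n). if i = j then B (w j) (v j) else 0)"
    unfolding v(1) sum_right using o[OF j] w[OF j] v(2) by (intro sum.cong refl) auto
  also have "\<dots> = B (w j) (v j)" using j by simp
  also have "\<dots> = (\<Sum>i=1..CARD('n). if i = j then B (w j) (v j) else 0)" using j by simp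
  also have "\<dots> = (\<Sum>i=1..CARD('n). B (w i) (v j))"
    using o[OF _ j] w v(2) j by (intro sum.cong refl) auto
  also have "\<dots> = 0" using 0 by (simp flip: sum_left)
  finally show "B (w j) z = 0" .
qed

lemma orthogonal_type_decomposition_jordan_basis:
  assumes D: "orthogonal_type_decomposition {x. N (CARD('n)) x = 0} W L"
  shows "jordan_basis g {x. N (CARD('n)) x = 0} (concat (map L [1..<Suc (CARD('n))]))"
proof -
  \<comment> \<open>Partial sums meet the next piece in zero, so Jordan bases can be appended one
    block size at a time.\<close>
  define P where "P n = {\<Sum>i=1..n. w i | w. \<forall>i\<in>{1..n}. w i \<in> W i}" for n :: nat
  have "jordan_basis g (P n) (concat (map L [1..<Suc n]))" if "n \<le> CARD('n)" for n
    using that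
  proof (induction n)
    case 0
    then show ?case by (simp add: P_def jordan_basis_Nil)
  next
    case (Suc n)
    have Sn: "Suc n \<in> {1..CARD('n)}" using Suc.prems by simp
    have sub: "vec.subspace (W i)" if "i \<in> {1..CARD('n)}" for i
      using jordan_basis_subspace[OF orthogonal_type_decomposition_basis[OF D that]] .
    have int: "P n \<inter> W (Suc n) \<subseteq> {0}"
    proof
      fix x assume "x \<in> P n \<inter> W (Suc n)"
      then obtain w where w: "x = (\<Sum>i=1..n. w i)" "\<forall>i\<in>{1..n}. w i \<in> W i" and x: "x \<in> W (Suc n)"
        by (auto simp: P_def)
      \<comment> \<open>A vector of the intersection gives the relation \<open>x - x = 0\<close>
        between components, padded with zeros to all indices so that directness applies.\<close>
      define d where "d i = (if i \<le> n then w i else if i = Suc n then - x else 0)" for i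
      have "d (Suc n) = 0"
      proof (rule orthogonal_type_decomposition_direct[OF D _ _ Sn])
        show "d i \<in> W i" if "i \<in> {1..CARD('n)}" for i
          using that w(2) x vec.subspace_neg[OF sub[OF Sn] x] vec.subspace_0[OF sub[OF that]]
          by (auto simp: d_def)
        have "(\<Sum>i=1..CARD('n). d i) = (\<Sum>i=1..Suc n. d i)"
          using Suc.prems by (intro sum.mono_neutral_right) (auto simp: d_def)
        also have "\<dots> = (\<Sum>i=1..n. d i) + d (Suc n)" by simp
        also have "(\<Sum>i=1..n. d i) = x" unfolding w(1) by (intro sum.cong refl) (simp add: d_def)
        finally show "(\<Sum>i=1..CARD('n). d i) = 0" by (simp add: d_def)
      qed
      then show "x \<in> {0}" by (simp add: d_def)
    qed
    have "P (Suc n) = {x + y | x y. x \<in> P n \<and> y \<in> W (Suc n)}"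
    proof
      show "P (Suc n) \<subseteq> {x + y | x y. x \<in> P n \<and> y \<in> W (Suc n)}"
        unfolding P_def by (auto; force)
      show "{x + y | x y. x \<in> P n \<and> y \<in> W (Suc n)} \<subseteq> P (Suc n)"
      proof clarify
        fix x y assume "x \<in> P n" and y: "y \<in> W (Suc n)"
        then obtain w where w: "x = (\<Sum>i=1..n. w i)" "\<forall>i\<in>{1..n}. w i \<in> W i" by (auto simp: P_def)
        have "x + y = (\<Sum>i=1..Suc n. (w(Suc n := y)) i)" by (simp add: w(1))
        moreover have "\<forall>i\<in>{1..Suc n}. (w(Suc n := y)) i \<in> W i" using w(2) y by auto
        ultimately show "x + y \<in> P (Suc n)"
          unfolding P_def by (intro CollectI exI[of _ "w(Suc n := y)"] conjI)
      qed
    qed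
    moreover have "jordan_basis g (P n) (concat (map L [1..<Suc n]))" using Suc by simp
    moreover have "jordan_basis g (W (Suc n)) (L (Suc n))"
      by (rule orthogonal_type_decomposition_basis[OF D Sn])
    ultimately show ?case using jordan_basis_append[OF _ _ int] by simp
  qed
  from this[of "CARD('n)"] show ?thesis
    using orthogonal_type_decomposition_sums[OF D] by (simp only: P_def le_refl)
qed

lemma orthogonal_type_decomposition_count:
  assumes D: "orthogonal_type_decomposition {x. N (CARD('n)) x = 0} W L" and i: "i \<in> {1..CARD('n)}"
  shows "jordan_blocks g {x. N (CARD('n)) x = 0} i = length (L i)"
    and "unipotent_jordan_type g (W i) (replicate (length (L i)) i)"
proof -
  note D' = D[unfolded orthogonal_type_decomposition_def]
  have snd: "map snd (L j) = replicate (length (L j)) j" if "j \<in> {1..CARD('n)}" for j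
    using D' that by (intro replicate_eqI) auto
  have "count_list (map snd (concat (map L [1..<Suc n]))) i = (if i \<le> n then length (L i) else 0)"
    if "n \<le> CARD('n)" for n
    using that
  proof (induction n)
    case (Suc n)
    then have "map snd (L (Suc n)) = replicate (length (L (Suc n))) (Suc n)" by (intro snd) simp
    then show ?case using Suc i by (auto simp: count_list_append le_Suc_eq count_list_replicate_self)
  qed (use i in simp)
  note count = this
  let ?L = "concat (map L [1..<Suc (CARD('n))])"
  have "unipotent_jordan_type g {x. N (CARD('n)) x = 0} (map snd ?L)"
    using orthogonal_type_decomposition_jordan_basis[OF D] unfolding unipotent_jordan_type_def by blast
  then have "jordan_blocks g {x. N (CARD('n)) x = 0} i = count_list (map snd ?L) i"
    by (rule jordan_blocks_eq)
  also have "\<dots> = length (L i)" using count[OF order_refl] i by (simp del: upt_Suc)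
  finally show "jordan_blocks g {x. N (CARD('n)) x = 0} i = length (L i)" .
  show "unipotent_jordan_type g (W i) (replicate (length (L i)) i)"
    unfolding unipotent_jordan_type_def
    using orthogonal_type_decomposition_basis[OF D i] snd[OF i] by blast
qed

end

section \<open>The number of orbits\<close>

lemma two_neq_zero_if_odd_card:
  assumes "odd (CARD('a::{field,finite}))"
  shows "(2::'a) \<noteq> 0"
proof
  assume "(2::'a) = 0"
  then have "of_nat 2 = (0::'a)" by simp
  then have "CHAR('a) dvd 2" by (simp only: of_nat_eq_0_iff_char_dvd)
  then have "CHAR('a) = 1 \<or> CHAR('a) = 2"
    by (metis One_nat_def prime_nat_iff two_is_prime_nat)
  moreover have "CHAR('a) \<noteq> 1" by (metis of_nat_CHAR of_nat_1 zero_neq_one)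
  ultimately have "CHAR('a) = 2" by blast
  then have "2 dvd CARD('a)" using CHAR_dvd_CARD[where 'a = 'a] by simp
  then show False using assms by simp
qed

lemma polar_form_commute: "polar_form Q x y = polar_form Q y x"
  by (simp add: polar_form_def add.commute)

lemma polar_form_self:
  assumes "quadratic_form Q"
  shows "polar_form Q x x = 2 * Q x"
proof -
  have "Q (2 *s x) = 2\<^sup>2 * Q x" using assms by (simp add: quadratic_form_def)
  moreover have "2 *s x = x + x"
    by (metis one_add_one vector_sadd_rdistrib vector_smult_lid)
  ultimately show ?thesis by (simp add: polar_form_def power2_eq_square)
qed

lemma conjugacy_class_subset:
  assumes C: "C \<in> conjugacy_classes (isometry_group Q)" and g: "g \<in> C"
  shows "g \<in> carrier (isometry_group Q)"
proof -
  interpret G: group "isometry_group Q" by (rule group_isometry_group)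
  obtain r where r: "r \<in> carrier (isometry_group Q)"
    and C': "C = {(\<lambda>x \<in> carrier (isometry_group Q). k \<otimes>\<^bsub>isometry_group Q\<^esub> x
      \<otimes>\<^bsub>isometry_group Q\<^esub> inv\<^bsub>isometry_group Q\<^esub> k) r | k. k \<in> carrier (isometry_group Q)}"
    using C unfolding conjugacy_classes_def orbits_def orbit_def by blast
  then obtain k where "k \<in> carrier (isometry_group Q)"
    "g = k \<otimes>\<^bsub>isometry_group Q\<^esub> r \<otimes>\<^bsub>isometry_group Q\<^esub> inv\<^bsub>isometry_group Q\<^esub> k"
    using g restrict_apply'[OF r] by auto
  then show ?thesis using r by simp
qed

lemma orthogonal_isometry_polar_form:
  fixes Q :: "'a::field ^ 'n \<Rightarrow> 'a"
  assumes "quadratic_form Q" "nondegenerate (polar_form Q)" "g \<in> carrier (isometry_group Q)"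
    and "(2::'a) \<noteq> 0"
  shows "orthogonal_isometry (polar_form Q) g"
proof
  have lin: "Vector_Spaces.linear (*s) (*) (\<lambda>x. polar_form Q x z)" for z
    using assms(1) by (simp add: quadratic_form_def bilinear_form_def)
  note hom = lin[unfolded linear_iff_module_hom]
  show "polar_form Q (x + y) z = polar_form Q x z + polar_form Q y z" for x y z
    by (rule module_hom.add[OF hom])
  show "polar_form Q (s *s x) z = s * polar_form Q x z" for s x z
    by (rule module_hom.scale[OF hom])
  show "polar_form Q x y = polar_form Q y x" for x y by (rule polar_form_commute)
  show "x = 0" if "\<And>y. polar_form Q x y = 0" for x
    using assms(2) that by (simp add: nondegenerate_def)
  show "polar_form Q (g *v x) (g *v y) = polar_form Q x y" for x y
    using assms(3) by (intro polar_isometry) (simp add: isometry_group_def)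
  show "(2::'a) \<noteq> 0" by fact
qed

text \<open>\<open>polar_form Q x x = 2 * Q x\<close> with \<open>2\<close> invertible, so
  isometries of the polar form preserve \<open>Q\<close>; they are injective by nondegeneracy, hence
  invertible.\<close>

lemma centralizer_eq_commuting_isometries:
  fixes Q :: "'a::field ^ 'n \<Rightarrow> 'a"
  assumes Q: "quadratic_form Q" and O: "orthogonal_isometry (polar_form Q) g"
  shows "centralizer (isometry_group Q) g = orthogonal_isometry.commuting_isometries (polar_form Q) g"
proof -
  interpret orthogonal_isometry "polar_form Q" g by (rule O)
  have "invertible h \<and> (\<forall>x. Q (h *v x) = Q x)" if h: "h \<in> commuting_isometries" for h
  proof
    show "invertible h"
      using commuting_isometries_inj[OF h]
      by (auto simp: invertible_left_inverse matrix_left_invertible_injective vec.inj_iff_eq_0)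
    have "2 * Q (h *v x) = 2 * Q x" for x
      using h unfolding commuting_isometries_def by (simp flip: polar_form_self[OF Q])
    then show "\<forall>x. Q (h *v x) = Q x" using two by simp
  qed
  then show ?thesis
    using polar_isometry[of Q]
    by (auto simp: centralizer_def isometry_group_def commuting_isometries_def)
qed

lemma orthogonal_blocks_block_decomposition:
  fixes Q :: "'a::field ^ 'n \<Rightarrow> 'a"
  assumes O: "orthogonal_isometry (polar_form Q) g" and W: "block_decomposition Q g W"
  shows "orthogonal_blocks (polar_form Q) g W (jordan_blocks g (unipotent_space g))"
proof -
  interpret orthogonal_isometry "polar_form Q" g by (rule O)
  note W' = W[unfolded block_decomposition_def]
  show ?thesis
  proof
    show "unipotent_jordan_type g (W i) (replicate (jordan_blocks g (unipotent_space g) i) i)"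
      if "i \<in> {1..CARD('n)}" for i
      using bspec[OF conjunct1[OF W'] that] by blast
    show "polar_form Q x y = 0"
      if ij: "i \<in> {1..CARD('n)}" "j \<in> {1..CARD('n)}" "i \<noteq> j" and xy: "x \<in> W i" "y \<in> W j" for i j x y
      using bspec[OF bspec[OF conjunct1[OF conjunct2[OF W']] ij(1)] ij(2)] ij(3) xy by blast
    show "{\<Sum>i=1..CARD('n). w i | w. \<forall>i \<in> {1..CARD('n)}. w i \<in> W i} = {x. N (CARD('n)) x = 0}"
      using conjunct1[OF conjunct2[OF conjunct2[OF W']]] by (simp only: unipotent_space_def nilpow_def)
    show "w i = 0" if "\<And>i. i \<in> {1..CARD('n)} \<Longrightarrow> w i \<in> W i" "(\<Sum>i=1..CARD('n). w i) = 0"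
      "i \<in> {1..CARD('n)}" for w i
      using conjunct2[OF conjunct2[OF conjunct2[OF W']], rule_format, of w i] that by blast
  qed
qed

lemma exists_block_decomposition:
  fixes Q :: "'a::field ^ 'n \<Rightarrow> 'a"
  assumes O: "orthogonal_isometry (polar_form Q) g"
  shows "\<exists>W. block_decomposition Q g W"
proof -
  interpret orthogonal_isometry "polar_form Q" g by (rule O)
  let ?U = "{x. N (CARD('n)) x = 0}"
  have U: "unipotent_space g = ?U" by (simp add: unipotent_space_def nilpow_def)
  have "\<exists>W L. orthogonal_type_decomposition ?U W L"
  proof (rule exists_orthogonal_type_decomposition)
    show "N k x \<in> ?U" if "x \<in> ?U" for x k
      using that nilpow_eq_0_mono[of g "CARD('n)" x "CARD('n) + k"] by simp
    show "x = 0" if "x \<in> ?U" "\<And>y. y \<in> ?U \<Longrightarrow> polar_form Q x y = 0" for x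
      using nondegenerate_unipotent that by simp
  qed (simp_all add: subspace_ker_nilpow)
  then obtain W L where D: "orthogonal_type_decomposition ?U W L" by blast
  have basis: "jordan_basis g (W i) (L i)" if "i \<in> {1..CARD('n)}" for i
    by (rule orthogonal_type_decomposition_basis[OF D that])
  have "(*v) g ` W i \<subseteq> W i" if "i \<in> {1..CARD('n)}" for i
    using jordan_basis_subspace[OF basis[OF that]] jordan_basis_nilpow_closed[OF basis[OF that]]
    by (auto simp: mult_eq_nilpow intro!: vec.subspace_add)
  moreover have "unipotent_jordan_type g (W i) (replicate (jordan_blocks g (unipotent_space g) i) i)"
    if "i \<in> {1..CARD('n)}" for i
    unfolding U orthogonal_type_decomposition_count(1)[OF D that]
    by (rule orthogonal_type_decomposition_count(2)[OF D that])
  ultimately have "block_decomposition Q g W"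
    unfolding block_decomposition_def
    using jordan_basis_subspace[OF basis] orthogonal_type_decomposition_orth[OF D]
      orthogonal_type_decomposition_sums[OF D] orthogonal_type_decomposition_direct[OF D]
    by (intro conjI ballI allI impI) (simp_all only: U, blast+)
  then show ?thesis by blast
qed

text \<open>On a homogeneous piece the image of \<open>N\<close> is the kernel of
  \<open>N^(i-1)\<close>, so a coset is nontrivial exactly when its representatives survive
  \<open>N^(i-1)\<close>.\<close>

lemma sign_plus_iff:
  fixes Q :: "'a::field ^ 'n \<Rightarrow> 'a"
  assumes Q: "quadratic_form Q" and g: "g \<in> carrier (isometry_group Q)"
    and O: "orthogonal_isometry (polar_form Q) g" and W: "block_decomposition Q g W"
    and i: "i \<in> {1..CARD('n)}"
  shows "sign_plus Q g i (W i) \<longleftrightarrow>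
    (\<exists>w\<in>W i. nilpow g (i - 1) w \<noteq> 0 \<and> polar_form Q w (nilpow g (i - 1) w) = 0)"
proof -
  interpret orthogonal_blocks "polar_form Q" g W "jordan_blocks g (unipotent_space g)"
    by (rule orthogonal_blocks_block_decomposition[OF O W])
  have im: "nil_part g ` W i = N (Suc 0) ` W i" by (simp add: nil_part_eq_nilpow)
  have sub: "vec.subspace (N (Suc 0) ` W i)"
    using W_subspace[OF i] linear_nilpow by (rule vec.linear_subspace_image[rotated])
  have triv: "add_coset (N (Suc 0) ` W i) w = N (Suc 0) ` W i \<longleftrightarrow> N (i - 1) w = 0" if w: "w \<in> W i" for w
  proof -
    have "add_coset (N (Suc 0) ` W i) 0 = N (Suc 0) ` W i" by (simp add: add_coset_def)
    then have "add_coset (N (Suc 0) ` W i) w = N (Suc 0) ` W i \<longleftrightarrow> w \<in> N (Suc 0) ` W i"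
      using add_coset_eq_iff[OF sub, of w 0] by simp
    also have "\<dots> \<longleftrightarrow> N (i - 1) w = 0"
    proof
      assume "w \<in> N (Suc 0) ` W i"
      then obtain v where "v \<in> W i" "w = N (Suc 0) v" by blast
      then show "N (i - 1) w = 0" using W_nil[OF i] index_pos[OF i] by simp
    next
      assume "N (i - 1) w = 0"
      then show "w \<in> N (Suc 0) ` W i" using W_kernel[OF i w] by blast
    qed
    finally show ?thesis .
  qed
  have val: "top_form Q g i (add_coset (N (Suc 0) ` W i) w) (add_coset (N (Suc 0) ` W i) w) =
      polar_form Q w (N (i - 1) w)" if "w \<in> W i" for w
    using top_form_coset[OF Q g W i that that] by (simp only: im nilpow_def)
  show ?thesis
    unfolding sign_plus_def quotient_space_def im using triv val by auto
qed

lemma card_centralizer_orbits: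
  fixes Q :: "'a::{field,finite} ^ 'n \<Rightarrow> 'a"
  assumes Q: "quadratic_form Q" and g: "g \<in> carrier (isometry_group Q)"
    and O: "orthogonal_isometry (polar_form Q) g" and W: "block_decomposition Q g W"
    and a: "a = jordan_blocks g (unipotent_space g)"
  shows "card (centralizer_orbits (isometry_group Q) g) =
    1 + card {i \<in> {1..CARD('n)}. even i \<and> a i \<noteq> 0} +
      (\<Sum>i \<in> {i \<in> {1..CARD('n)}. odd i \<and> a i \<noteq> 0}.
         if a i > 2 then CARD('a)
         else if a i = 2 then (if sign_plus Q g i (W i) then CARD('a) else CARD('a) - 1)
         else (CARD('a) - 1) div 2)"
proof -
  interpret orthogonal_blocks "polar_form Q" g W a
    unfolding a by (rule orthogonal_blocks_block_decomposition[OF O W])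
  let ?f = "\<lambda>i. if a i > 2 then CARD('a)
         else if a i = 2 then (if sign_plus Q g i (W i) then CARD('a) else CARD('a) - 1)
         else (CARD('a) - 1) div 2"
  have "centralizer_orbits (isometry_group Q) g =
      (\<lambda>X. {(*v) h ` X | h. h \<in> commuting_isometries}) ` quotient_space UNIV NV"
    unfolding centralizer_orbits_eq centralizer_eq_commuting_isometries[OF Q O] commutator_space_eq
    by (simp only: setcompr_eq_image Collect_mem_eq)
  then have "card (centralizer_orbits (isometry_group Q) g) = 1 + (\<Sum>i=1..CARD('n). card (top_values i))"
    by (simp only: card_commuting_isometry_orbits[OF finite])
  also have "(\<Sum>i=1..CARD('n). card (top_values i)) =
      (\<Sum>i=1..CARD('n). (if even i \<and> a i \<noteq> 0 then 1 else 0) + (if odd i \<and> a i \<noteq> 0 then ?f i else 0))"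
  proof (rule sum.cong[OF refl])
    fix i assume i: "i \<in> {1..CARD('n)}"
    show "card (top_values i) =
      (if even i \<and> a i \<noteq> 0 then 1 else 0) + (if odd i \<and> a i \<noteq> 0 then ?f i else 0)"
    proof (cases "a i = 0")
      case True
      then show ?thesis using top_values_empty[OF i] by simp
    next
      case False
      show ?thesis
      proof (cases "even i")
        case True
        then show ?thesis using top_values_even[OF i True False] False by simp
      next
        case odd: False
        have "card (top_values i) = ?f i"
          using card_top_values_odd[OF finite i odd False]
          by (simp only: sign_plus_iff[OF Q g O W i])
        then show ?thesis using odd False by (simp only: simp_thms if_True if_False add_0)
      qed
    qed
  qed
  also have "\<dots> = card {i \<in> {1..CARD('n)}. even i \<and> a i \<noteq> 0} +
      (\<Sum>i \<in> {i \<in> {1..CARD('n)}. odd i \<and> a i \<noteq> 0}. ?f i)"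
  proof -
    have "card {i \<in> {1..CARD('n)}. even i \<and> a i \<noteq> 0} =
        (\<Sum>i=1..CARD('n). if even i \<and> a i \<noteq> 0 then 1 else 0)"
      by (simp add: sum.inter_filter[symmetric] card_eq_sum del: sum_constant)
    moreover have "(\<Sum>i \<in> {i \<in> {1..CARD('n)}. odd i \<and> a i \<noteq> 0}. ?f i) =
        (\<Sum>i=1..CARD('n). if odd i \<and> a i \<noteq> 0 then ?f i else 0)"
      by (intro sum.inter_filter) simp
    ultimately show ?thesis by (simp only: sum.distrib)
  qed
  finally show ?thesis by (simp only: add.assoc)
qed

text \<open>The existence clause keeps the formula, which is asserted for every block decomposition,
  from being vacuous.\<close>

theorem theorem6p1:
  fixes Q :: "('a::{field,finite}) ^ 'n \<Rightarrow> 'a"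
    and C :: "('a ^ 'n ^ 'n) set"
    and g :: "'a ^ 'n ^ 'n"
    and q m :: nat
    and a :: "nat \<Rightarrow> nat"
  assumes "q = CARD('a)" and "odd q" and "m = CARD('n)"
    and "quadratic_form Q" and "nondegenerate (polar_form Q)"
    and "C \<in> conjugacy_classes (isometry_group Q)" and "g \<in> C"
    and "a = jordan_blocks g (unipotent_space g)"
  shows "(\<exists>W. block_decomposition Q g W) \<and>
    (\<forall>W. block_decomposition Q g W \<longrightarrow>
       class_orbit_number (isometry_group Q) C =
         1 + card {i \<in> {1..m}. even i \<and> a i \<noteq> 0} +
         (\<Sum>i \<in> {i \<in> {1..m}. odd i \<and> a i \<noteq> 0}.
            if a i > 2 then q
            else if a i = 2 then (if sign_plus Q g i (W i) then q else q - 1)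
            else (q - 1) div 2))"
proof -
  have g: "g \<in> carrier (isometry_group Q)" by (rule conjugacy_class_subset[OF assms(6,7)])
  have "(2::'a) \<noteq> 0" using assms(1,2) by (intro two_neq_zero_if_odd_card) simp
  then have O: "orthogonal_isometry (polar_form Q) g"
    by (rule orthogonal_isometry_polar_form[OF assms(4,5) g])
  show ?thesis
    unfolding class_orbit_number_eq[OF assms(6,7)] assms(1,3)
    using exists_block_decomposition[OF O] card_centralizer_orbits[OF assms(4) g O _ assms(8)]
    by blast
qed

end
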